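(* Let $x(z)=\sum_{k\ge1}c_kz^k$ be an arbitrary invertible (under composition, i.e. $c_1\neq0$) formal power series, and associate to it the linear change of variables $p\mapsto p(q)$ given by $p_b=\sum_{k\ge b}c_k^b\,q_k$, where the coefficients $c^b_k$ are determined by the expansion $x(z)^b=\sum_{k\ge b}c_k^bz^k$. Then there is a quadratic function $Q(p_1,p_2,\dots)$ such that the transformation sending an arbitrary series $\Phi(p_1,p_2,\dots)$ to the series $$\Psi(q_1,q_2,\dots)=(\Phi+Q)\big|_{p\to p(q)}$$ is an automorphism of the KP hierarchy: it sends solutions (in the variables $p_i$) to solutions (in the variables $q_i$). Moreover, in the case when $x(z)=\frac{z}{1+\beta z}e^{-\frac{\beta z}{1+\beta z}}$, this quadratic function is $Q=-H_{0,2}$, where $$H_{0,2}=\frac12\sum_{b_1,b_2\ge1}\frac{b_1^{b_1}b_2^{b_2}}{(b_1+b_2)\,b_1!\,b_2!}p_{b_1}p_{b_2}\beta^{b_1+b_2}.$$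
   Context: Series are formal power series with coefficients in $\mathbb C$ (in the second statement $\beta$ is a parameter, so coefficients may be taken in $\mathbb C[[\beta]]$). A quadratic function is a possibly infinite sum $\sum_{i,j\ge1}Q_{ij}p_ip_j$. KP hierarchy. Let $R$ be a commutative $\mathbb Q$-algebra. A formal power series $F\in R[[p_1,p_2,\dots]]$ is a solution of the KP hierarchy in the variables $p_i$ if $\tau=e^{F-F(0)}$ satisfies the Hirota bilinear identity: the coefficient of $z^{-1}$ in $$\exp\Bigl(\sum_{k\ge1}\frac{(p_k-p_k')z^k}{k}\Bigr)\,\tau(p_1-z^{-1},p_2-z^{-2},\dots)\,\tau(p_1'+z^{-1},p_2'+z^{-2},\dots)$$ vanishes identically in $p,p'$. (The normalization is such that the first equation of the hierarchy is $F_{2,2}=-\frac12F_{1,1}^2+F_{3,1}-\frac1{12}F_{1,1,1,1}$, where indices denote partial derivatives in the $p_i$.) *)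

theory Defs
  imports Complex_Main "HOL-Library.Multiset" "HOL-Library.Groups_Big_Fun"
    "HOL-Computational_Algebra.Formal_Power_Series"
begin

section \<open>Commutative rational algebras\<close>

text \<open>
  A commutative ring is a \<open>\<rat>\<close>-algebra (in a unique way) iff all positive natural numbers are
  invertible in it. The symbol \<open>/\<close> is constrained only for such denominators.
\<close>

class rat_algebra = comm_ring_1 + inverse +
  assumes divide_of_nat: "n > 0 \<Longrightarrow> x / of_nat n * of_nat n = x"

subclass (in field_char_0) rat_algebra
  by unfold_locales simp

instance fps :: (field_char_0) rat_algebra
proof
  fix n :: nat and x :: "'a fps"
  assume "n > 0"
  then have "(of_nat n :: 'a fps) dvd x"
    by (simp add: fps_of_nat [symmetric] fps_dvd_iff)
  then show "x / of_nat n * of_nat n = x"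
    by simp
qed


section \<open>Power series in arbitrarily many variables\<close>

text \<open>
  The type \<open>('v, 'a) mps\<close> is the ring of all formal power series over \<open>'a\<close> in the variables
  indexed by \<open>'v\<close>; monomials are multisets of variables. Both the number of
  monomials and the number of variables occurring in a single series may be infinite.
\<close>

typedef ('v, 'a) mps = "UNIV :: ('v multiset \<Rightarrow> 'a) set"
  morphisms mcoeff Abs_mps ..

setup_lifting type_definition_mps

lemma mps_eqI: "(\<And>m. mcoeff F m = mcoeff G m) \<Longrightarrow> F = G"
  by transfer auto

lemma finite_msplit: "finite {(a, b). a + b = (m :: 'v multiset)}"
proof (induction m)
  case empty
  have "{(a, b). a + b = ({#} :: 'v multiset)} = {({#}, {#})}" by auto
  then show ?case by simp
next
  case (add x m)
  let ?S = "{(a, b). a + b = m}"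
  have "{(a, b). a + b = add_mset x m} \<subseteq>
      (\<lambda>(a, b). (add_mset x a, b)) ` ?S \<union> (\<lambda>(a, b). (a, add_mset x b)) ` ?S"
  proof clarify
    fix a b
    assume ab: "a + b = add_mset x m"
      and nb: "(a, b) \<notin> (\<lambda>(a, b). (a, add_mset x b)) ` ?S"
    have "x \<in># a + b" using ab by simp
    then consider "x \<in># a" | "x \<in># b" by auto
    then show "(a, b) \<in> (\<lambda>(a, b). (add_mset x a, b)) ` ?S"
    proof cases
      case 1
      then obtain a' where "a = add_mset x a'" by (metis insert_DiffM)
      with ab show ?thesis by force
    next
      case 2
      then obtain b' where "b = add_mset x b'" by (metis insert_DiffM)
      with ab nb show ?thesis by force
    qed
  qed
  then show ?case
    by (rule finite_subset) (use add.IH in auto)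
qed

instantiation mps :: (type, comm_ring_1) comm_ring_1
begin

lift_definition zero_mps :: "('a, 'b) mps" is "\<lambda>_. 0" .

lift_definition one_mps :: "('a, 'b) mps" is "\<lambda>m. if m = {#} then 1 else 0" .

lift_definition plus_mps :: "('a, 'b) mps \<Rightarrow> ('a, 'b) mps \<Rightarrow> ('a, 'b) mps"
  is "\<lambda>F G m. F m + G m" .

lift_definition minus_mps :: "('a, 'b) mps \<Rightarrow> ('a, 'b) mps \<Rightarrow> ('a, 'b) mps"
  is "\<lambda>F G m. F m - G m" .

lift_definition uminus_mps :: "('a, 'b) mps \<Rightarrow> ('a, 'b) mps"
  is "\<lambda>F m. - F m" .

lift_definition times_mps :: "('a, 'b) mps \<Rightarrow> ('a, 'b) mps \<Rightarrow> ('a, 'b) mps"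
  is "\<lambda>F G m. \<Sum>(a, b) \<in> {(a, b). a + b = m}. F a * G b" .

instance
proof
  fix F G H :: "('a, 'b) mps"
  show "F + G + H = F + (G + H)" by transfer (simp add: add.assoc)
  show "F + G = G + F" by transfer (simp add: add.commute)
  show "0 + F = F" by transfer simp
  show "- F + F = 0" by transfer simp
  show "F - G = F + - G" by transfer simp
  show "(0 :: ('a, 'b) mps) \<noteq> 1" by transfer (auto dest: fun_cong [of _ _ "{#}"])
  show "(F + G) * H = F * H + G * H"
    by transfer (simp add: case_prod_unfold distrib_right sum.distrib)
  show "1 * F = F"
  proof transfer
    fix F :: "'a multiset \<Rightarrow> 'b"
    show "(\<lambda>m. \<Sum>(a, b) \<in> {(a, b). a + b = m}. (if a = {#} then 1 else 0) * F b) = F"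
    proof
      fix m :: "'a multiset"
      have "(\<Sum>(a, b) \<in> {(a, b). a + b = m}. (if a = {#} then 1 else 0) * F b)
          = (\<Sum>(a, b) \<in> {({#} :: 'a multiset, m)}. (if a = {#} then 1 else 0) * F b)"
        by (rule sum.mono_neutral_right [OF finite_msplit]) (auto split: if_splits)
      then show "(\<Sum>(a, b) \<in> {(a, b). a + b = m}. (if a = {#} then 1 else 0) * F b) = F m"
        by simp
    qed
  qed
  show "F * G = G * F"
  proof transfer
    fix F G :: "'a multiset \<Rightarrow> 'b"
    show "(\<lambda>m. \<Sum>(a, b) \<in> {(a, b). a + b = m}. F a * G b)
        = (\<lambda>m. \<Sum>(a, b) \<in> {(a, b). a + b = m}. G a * F b)"
      by (rule ext, rule sum.reindex_bij_witness [of _ prod.swap prod.swap])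
        (auto simp: ac_simps)
  qed
  show "F * G * H = F * (G * H)"
  proof transfer
    fix F G H :: "'a multiset \<Rightarrow> 'b"
    show "(\<lambda>m. \<Sum>(a, c) \<in> {(a, c). a + c = m}.
              (\<Sum>(a, b) \<in> {(a', b). a' + b = a}. F a * G b) * H c)
        = (\<lambda>m. \<Sum>(a, c) \<in> {(a, c). a + c = m}.
              F a * (\<Sum>(b, c) \<in> {(b, c'). b + c' = c}. G b * H c))"
    proof
      fix m :: "'a multiset"
      have "(\<Sum>(s, c) \<in> {(a, c). a + c = m}.
              (\<Sum>(a, b) \<in> {(a', b). a' + b = s}. F a * G b) * H c)
          = (\<Sum>u \<in> {(a, c). a + c = m}. \<Sum>v \<in> {(a', b). a' + b = fst u}.
              F (fst v) * G (snd v) * H (snd u))"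
        by (simp add: case_prod_unfold sum_distrib_right)
      also have "\<dots> = (\<Sum>w \<in> Sigma {(a, c). a + c = m} (\<lambda>u. {(a', b). a' + b = fst u}).
              F (fst (snd w)) * G (snd (snd w)) * H (snd (fst w)))"
        by (subst sum.Sigma) (auto simp: finite_msplit [unfolded case_prod_unfold] case_prod_unfold)
      also have "\<dots> = (\<Sum>w \<in> Sigma {(a, c). a + c = m} (\<lambda>u. {(b, c'). b + c' = snd u}).
              F (fst (fst w)) * (G (fst (snd w)) * H (snd (snd w))))"
        by (rule sum.reindex_bij_witness
            [of _ "\<lambda>((a, s), (b, c)). ((a + b, c), (a, b))" "\<lambda>((s, c), (a, b)). ((a, b + c), (b, c))"])
          (auto simp: ac_simps)
      also have "\<dots> = (\<Sum>u \<in> {(a, c). a + c = m}. \<Sum>v \<in> {(b, c'). b + c' = snd u}.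
              F (fst u) * (G (fst v) * H (snd v)))"
        by (subst sum.Sigma) (auto simp: finite_msplit [unfolded case_prod_unfold] case_prod_unfold)
      also have "\<dots> = (\<Sum>(a, s) \<in> {(a, c). a + c = m}.
              F a * (\<Sum>(b, c) \<in> {(b, c'). b + c' = s}. G b * H c))"
        by (simp add: case_prod_unfold sum_distrib_left)
      finally show "(\<Sum>(a, c) \<in> {(a, c). a + c = m}.
              (\<Sum>(a, b) \<in> {(a', b). a' + b = a}. F a * G b) * H c)
        = (\<Sum>(a, c) \<in> {(a, c). a + c = m}.
              F a * (\<Sum>(b, c) \<in> {(b, c'). b + c' = c}. G b * H c))" .
    qed
  qed
qed

end

lift_definition mconst :: "'a \<Rightarrow> ('v, 'a :: zero) mps"
  is "\<lambda>c m. if m = {#} then c else 0" .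

lift_definition mvar :: "'v \<Rightarrow> ('v, 'a :: zero_neq_one) mps"
  is "\<lambda>v m. if m = {#v#} then 1 else 0" .

text \<open>
  Infinite sums are taken coefficientwise. They are meaningful for families in which each
  monomial has a nonzero coefficient in only finitely many members (for other families
  \<open>Sum_any\<close> returns the value 0); every family below to which \<open>msum\<close> is applied has this
  property.
\<close>

definition msum :: "('i \<Rightarrow> ('v, 'a :: comm_monoid_add) mps) \<Rightarrow> ('v, 'a) mps" where
  "msum f = Abs_mps (\<lambda>m. \<Sum>i. mcoeff (f i) m)"

text \<open>For series \<open>F\<close> without constant term.\<close>

definition mexp :: "('v, 'a :: rat_algebra) mps \<Rightarrow> ('v, 'a) mps" where
  "mexp F = msum (\<lambda>n :: nat. mconst (1 / of_nat (fact n)) * F ^ n)"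

definition msubst ::
  "('v \<Rightarrow> ('w, 'a :: comm_ring_1) mps) \<Rightarrow> ('v, 'a) mps \<Rightarrow> ('w, 'a) mps" where
  "msubst s F = msum (\<lambda>m. mconst (mcoeff F m) * (\<Prod>v \<in># m. s v))"


section \<open>The KP hierarchy\<close>

text \<open>
  Throughout, the variable with index \<open>i :: nat\<close> is \<open>p\<^sub>i\<^sub>+\<^sub>1\<close> (so that indices run over all
  natural numbers, and \<open>Suc i\<close> is the index used on paper).

  The Hirota identity concerns power series in the \<open>p\<close> and \<open>p'\<close> that are infinite in
  both directions in \<open>z\<close>. We expand its three factors in the power series ring
  in \<open>p\<close>, \<open>p'\<close> and two further independent variables \<open>Z\<close> and \<open>Zinv\<close> standing for \<open>z\<close>
  and \<open>z\<^sup>-\<^sup>1\<close>, and identify \<open>Z\<^sup>i Zinv\<^sup>j\<close> with \<open>z\<^sup>i\<^sup>-\<^sup>j\<close> only when the coefficient of \<open>z\<^sup>-\<^sup>1\<close> is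
  extracted. In a fixed monomial in \<open>p, p'\<close> the power of \<open>Z\<close> is bounded, hence the
  sum defining this coefficient is finite.
\<close>

datatype kp_var = P nat | P' nat | Z | Zinv

definition hirota_product :: "(nat, 'a :: rat_algebra) mps \<Rightarrow> (kp_var, 'a) mps" where
  "hirota_product \<tau> =
     mexp (msum (\<lambda>i. mconst (1 / of_nat (Suc i)) * (mvar (P i) - mvar (P' i)) * mvar Z ^ Suc i))
     * msubst (\<lambda>i. mvar (P i) - mvar Zinv ^ Suc i) \<tau>
     * msubst (\<lambda>i. mvar (P' i) + mvar Zinv ^ Suc i) \<tau>"

text \<open>The coefficient of \<open>z\<^sup>-\<^sup>1 p\<^sup>a p'\<^sup>b\<close>, where \<open>a\<close> and \<open>b\<close> are monomials.\<close>

definition hirota_coeff :: "(nat, 'a :: rat_algebra) mps \<Rightarrow> nat multiset \<Rightarrow> nat multiset \<Rightarrow> 'a" where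
  "hirota_coeff \<tau> a b =
     (\<Sum>n. mcoeff (hirota_product \<tau>)
       (image_mset P a + image_mset P' b + replicate_mset n Z + replicate_mset (Suc n) Zinv))"

definition KP_solution :: "(nat, 'a :: rat_algebra) mps \<Rightarrow> bool" where
  "KP_solution F \<longleftrightarrow> (\<forall>a b. hirota_coeff (mexp (F - mconst (mcoeff F {#}))) a b = 0)"

text \<open>
  Since the \<open>p\<^sub>i\<close> and the \<open>q\<^sub>i\<close> range over the same index set, series in either set of
  variables have the same type.
\<close>

definition KP_automorphism :: "((nat, 'a :: rat_algebra) mps \<Rightarrow> (nat, 'a) mps) \<Rightarrow> bool" where
  "KP_automorphism T \<longleftrightarrow> bij_betw T {F. KP_solution F} {F. KP_solution F}"


section \<open>Linear changes of variables and quadratic functions\<close>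

definition quadratic :: "(nat, 'a :: comm_ring_1) mps \<Rightarrow> bool" where
  "quadratic Q \<longleftrightarrow> (\<exists>c. Q = msum (\<lambda>(i, j). mconst (c i j) * mvar i * mvar j))"

text \<open>
  The substitution \<open>p\<^sub>b = \<Sum>\<^sub>k c\<^sub>k\<^sup>b q\<^sub>k\<close> with \<open>c\<^sub>k\<^sup>b\<close> the coefficient of \<open>z\<^sup>k\<close> in \<open>x(z)\<^sup>b\<close>. When
  \<open>x\<close> has no constant term, \<open>c\<^sub>k\<^sup>b = 0\<close> for \<open>k < b\<close>, so the sum effectively runs over \<open>k \<ge> b\<close>.
\<close>

definition change_vars :: "'a :: comm_ring_1 fps \<Rightarrow> (nat, 'a) mps \<Rightarrow> (nat, 'a) mps" where
  "change_vars x = msubst (\<lambda>i. msum (\<lambda>j. mconst (fps_nth (x ^ Suc i) (Suc j)) * mvar j))"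

definition KP_transform ::
  "'a :: comm_ring_1 fps \<Rightarrow> (nat, 'a) mps \<Rightarrow> (nat, 'a) mps \<Rightarrow> (nat, 'a) mps" where
  "KP_transform x Q \<Phi> = change_vars x (\<Phi> + Q)"


section \<open>The Hodge specialization\<close>

text \<open>
  Here the coefficient ring is \<open>\<complex>[[\<beta>]]\<close>, that is, \<open>\<beta>\<close> is \<open>fps_X :: complex fps\<close>, whereas \<open>z\<close>
  is \<open>fps_X :: complex fps fps\<close>.
\<close>

definition hodge_beta :: "complex fps" where
  "hodge_beta = fps_X"

definition hodge_x :: "complex fps fps" where
  "hodge_x =
     fps_X / (1 + fps_const hodge_beta * fps_X)
     * (fps_exp 1 oo (- (fps_const hodge_beta * fps_X / (1 + fps_const hodge_beta * fps_X))))"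

definition hodge_H02 :: "(nat, complex fps) mps" where
  "hodge_H02 = mconst (1 / 2) * msum (\<lambda>(i, j). let b1 = Suc i; b2 = Suc j in
     mconst (of_nat (b1 ^ b1 * b2 ^ b2) / of_nat ((b1 + b2) * fact b1 * fact b2)
       * hodge_beta ^ (b1 + b2)) * mvar i * mvar j)"

end

(*
Write v = 1/z. Rescaling p_k by v^k turns the Hirota identity into the vanishing of the degree 1
part of an ordinary power series in p, p', v, so that no Laurent series are needed. Put v = x(u).
A KP solution in the variables p(q) then satisfies the Hirota identity in q with parameter u, up to
two discrepancies: the exponential prefactor changes by terms that are linear in q - q', and the
residue form dz becomes (dz/dw) dw with w = 1/u. A quadratic Q with bilinear form B contributes
-B(p - p', [v]) + B([v], [v]), and both discrepancies cancel exactly when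
B([v1], [v2]) = log (x'(0) u1 u2 (v1 - v2) / (v1 v2 (u1 - u2))): the linear terms agree by expanding
this logarithm in u1, and on the diagonal it equals log (x'(0) dz/dw). It is a symmetric power
series without pure terms in v1 or v2, so Q exists, and the condition for the inverse of x is solved
by the transported -Q.

For x = t exp (- beta t) with t = u / (1 + beta u), one has 1/u1 - 1/u2 = 1/t1 - 1/t2. By Lagrange
inversion, H_{0,2} satisfies a first-order equation for the Euler derivation in v1, v2; the required
exponential satisfies the corresponding equation and has the same lowest-degree terms.
*)
theory Submission
  imports Defs
begin

text \<open>Both claims are instances of one statement over an integral domain that is a Q-algebra,
  with x'(0) a unit: the domain is C, or C[[beta]]. Reciprocals are therefore carried as explicit
  witnesses, chiefly J = u / x(u), and the logarithmic identity behind the linear terms is proved by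
  comparing exponentials, \<open>mexp\<close> being injective. The discrepancies cancel only up to
  factors free of the spectral parameter: Q(p), Q(p') and a linear form coming from log (x'(0) u /
  x(u)) survive. After the rescaling such factors are exactly of \<open>kp_degree\<close> 0, and
  multiplication by them cannot create a residue. All linear terms are treated at once by a marking
  variable t whose powers stand for the p_k. The condition on B at the points t u and u then
  contains log (1 - t), which encodes the sum of p_k / k, and log (1 - x(t u) / x(u)), which encodes
  what the substitution v = x(u) makes of it.\<close>

lemma mcoeff_zero [simp]: "mcoeff 0 m = 0"
  by transfer simp

lemma mcoeff_one: "mcoeff 1 m = (if m = {#} then 1 else 0)"
  by transfer simp

lemma mcoeff_add [simp]: "mcoeff (F + G) m = mcoeff F m + mcoeff G m"
  by transfer simp

lemma mcoeff_diff [simp]: "mcoeff (F - G) m = mcoeff F m - mcoeff G m"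
  by transfer simp

lemma mcoeff_uminus [simp]: "mcoeff (- F) m = - mcoeff F m"
  by transfer simp

lemma mcoeff_mult: "mcoeff (F * G) m = (\<Sum>(a, b) \<in> {(a, b). a + b = m}. mcoeff F a * mcoeff G b)"
  by transfer simp

lemma mcoeff_sum [simp]: "mcoeff (sum f A) m = (\<Sum>i\<in>A. mcoeff (f i) m)"
  by (induction A rule: infinite_finite_induct) auto

lemma mcoeff_mconst: "mcoeff (mconst c) m = (if m = {#} then c else 0)"
  by transfer simp

lemma mcoeff_mvar: "mcoeff (mvar v) m = (if m = {#v#} then 1 else 0)"
  by transfer simp

lemma mcoeff_mult_nonzero:
  assumes "mcoeff (F * G) m \<noteq> 0"
  shows "\<exists>p\<in>{(a, b). a + b = m}. mcoeff F (fst p) \<noteq> 0 \<and> mcoeff G (snd p) \<noteq> 0"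
proof -
  from assms obtain p where "p \<in> {(a, b). a + b = m}" "(case p of (a, b) \<Rightarrow> mcoeff F a * mcoeff G b) \<noteq> 0"
    unfolding mcoeff_mult by (rule sum.not_neutral_contains_not_neutral)
  then show ?thesis
    by (intro bexI [of _ p]) auto
qed

lemma mcoeff_mult_empty [simp]: "mcoeff (F * G) {#} = mcoeff F {#} * mcoeff G {#}"
proof -
  have "{(a, b). a + b = {#}} = {({#}, {#})}" by auto
  then show ?thesis by (simp add: mcoeff_mult)
qed

lemma mcoeff_power_empty [simp]: "mcoeff (F ^ n) {#} = mcoeff F {#} ^ n"
  by (induction n) (auto simp: mcoeff_one)

lemma mcoeff_mconst_mult [simp]:
  fixes F :: "('v, 'a :: comm_ring_1) mps"
  shows "mcoeff (mconst c * F) m = c * mcoeff F m"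
proof -
  have "mcoeff (mconst c * F) m = (\<Sum>(a, b) \<in> {({#} :: 'v multiset, m)}. mcoeff (mconst c) a * mcoeff F b)"
    unfolding mcoeff_mult
    by (rule sum.mono_neutral_right [OF finite_msplit]) (auto simp: mcoeff_mconst split: if_splits)
  then show ?thesis by (simp add: mcoeff_mconst)
qed

lemma mconst_add: "mconst (a + b) = mconst a + mconst b"
  by (rule mps_eqI) (simp add: mcoeff_mconst)

lemma mconst_diff: "mconst (a - b) = mconst a - mconst b"
  by (rule mps_eqI) (simp add: mcoeff_mconst)

lemma mconst_uminus: "mconst (- a) = - mconst a"
  by (rule mps_eqI) (simp add: mcoeff_mconst)

lemma mconst_mult: "mconst (a * b) = mconst a * mconst b"
  by (rule mps_eqI) (simp add: mcoeff_mconst)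

lemma mconst_0 [simp]: "mconst 0 = 0"
  by (rule mps_eqI) (simp add: mcoeff_mconst)

lemma mconst_1 [simp]: "mconst 1 = 1"
  by (rule mps_eqI) (simp add: mcoeff_mconst mcoeff_one)

lemma mconst_of_nat: "mconst (of_nat n) = of_nat n"
  by (induction n) (simp_all add: mconst_add)

lemma mconst_sum: "mconst (sum f A) = (\<Sum>i\<in>A. mconst (f i))"
  by (induction A rule: infinite_finite_induct) (auto simp: mconst_add)

section \<open>Monomials as series\<close>

definition mmono :: "'v multiset \<Rightarrow> ('v, 'a :: comm_ring_1) mps" where
  "mmono \<mu> = Abs_mps (\<lambda>m. if m = \<mu> then 1 else 0)"

lemma mcoeff_mmono: "mcoeff (mmono \<mu>) m = (if m = \<mu> then 1 else 0)"
  by (simp add: mmono_def Abs_mps_inverse)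

lemma mvar_eq_mmono: "mvar v = mmono {#v#}"
  by (rule mps_eqI) (simp add: mcoeff_mvar mcoeff_mmono)

lemma mmono_empty [simp]: "mmono {#} = 1"
  by (rule mps_eqI) (simp add: mcoeff_one mcoeff_mmono)

lemma mcoeff_mmono_mult:
  "mcoeff (mmono \<mu> * F) m = (if \<mu> \<subseteq># m then mcoeff F (m - \<mu>) else 0)"
proof (cases "\<mu> \<subseteq># m")
  case True
  have "mcoeff (mmono \<mu> * F) m = (\<Sum>(a, b) \<in> {(\<mu>, m - \<mu>)}. mcoeff (mmono \<mu>) a * mcoeff F b)"
    unfolding mcoeff_mult
    by (rule sum.mono_neutral_right [OF finite_msplit]) (auto simp: mcoeff_mmono True split: if_splits)
  then show ?thesis by (simp add: mcoeff_mmono True)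
next
  case False
  have "mcoeff (mmono \<mu> * F) m = 0"
    unfolding mcoeff_mult
    by (rule sum.neutral) (use False in \<open>auto simp: mcoeff_mmono\<close>)
  then show ?thesis by (simp add: False)
qed

lemma mcoeff_mmono_mult_add [simp]: "mcoeff (mmono \<mu> * F) (\<mu> + m) = mcoeff F m"
  by (simp add: mcoeff_mmono_mult)

lemma mmono_add: "mmono (\<mu> + \<nu>) = mmono \<mu> * mmono \<nu>"
  by (rule mps_eqI) (auto simp: mcoeff_mmono_mult mcoeff_mmono)

text \<open>Lets powers of the spectral parameter be divided out although the series ring has no
  division.\<close>

lemma mmono_mult_cancel:
  assumes "mmono \<mu> * F = mmono \<mu> * G"
  shows "F = G"
  by (metis assms mcoeff_mmono_mult_add mps_eqI)

lemma mvar_power_eq_mmono: "mvar v ^ n = mmono (replicate_mset n v)"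
  by (induction n) (simp_all add: mvar_eq_mmono flip: mmono_add)

lemma mmono_eq_prod: "(\<Prod>v\<in>#m. mvar v) = mmono m"
proof (induction m)
  case (add v m)
  then show ?case by (simp add: mvar_eq_mmono flip: mmono_add)
qed simp

section \<open>Summable families\<close>

text \<open>Where this fails, \<open>Sum_any\<close> silently returns 0, so the additive and
  multiplicative rules for \<open>msum\<close> assume it.\<close>

definition msummable :: "('i \<Rightarrow> ('v, 'a :: comm_monoid_add) mps) \<Rightarrow> bool" where
  "msummable f \<longleftrightarrow> (\<forall>m. finite {i. mcoeff (f i) m \<noteq> 0})"

lemma msummableD: "msummable f \<Longrightarrow> finite {i. mcoeff (f i) m \<noteq> 0}"
  by (simp add: msummable_def)

lemma mcoeff_msum: "mcoeff (msum f) m = Sum_any (\<lambda>i. mcoeff (f i) m)"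
  by (simp add: msum_def Abs_mps_inverse)

lemma mcoeff_msum_superset:
  assumes "finite A" "\<And>i. mcoeff (f i) m \<noteq> 0 \<Longrightarrow> i \<in> A"
  shows "mcoeff (msum f) m = (\<Sum>i\<in>A. mcoeff (f i) m)"
  unfolding mcoeff_msum by (rule Sum_any.expand_superset) (use assms in auto)

lemma msum_cong: "(\<And>i. f i = g i) \<Longrightarrow> msum f = msum g"
  by presburger

lemma msummable_finite: "finite (UNIV :: 'i set) \<Longrightarrow> msummable (f :: 'i \<Rightarrow> _)"
  unfolding msummable_def by (auto intro: finite_subset)

lemma msummable_mult_left:
  assumes "msummable f"
  shows "msummable (\<lambda>i. G * f i)"
  unfolding msummable_def
proof
  fix m
  have "{i. mcoeff (G * f i) m \<noteq> 0} \<subseteq> (\<Union>p\<in>{(a, b). a + b = m}. {i. mcoeff (f i) (snd p) \<noteq> 0})"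
    using mcoeff_mult_nonzero by fastforce
  moreover have "finite \<dots>"
    using assms by (intro finite_UN_I finite_msplit) (auto simp: msummable_def)
  ultimately show "finite {i. mcoeff (G * f i) m \<noteq> 0}" by (rule finite_subset)
qed

lemma msummable_mult_right: "msummable f \<Longrightarrow> msummable (\<lambda>i. f i * G)"
  using msummable_mult_left [of f G] by (simp add: mult.commute)

text \<open>A monomial has finitely many divisors, and summability of one factor already limits the
  indices at each of them; the other factor may be any family.\<close>

lemma msummable_mult_family:
  assumes "msummable f"
  shows "msummable (\<lambda>i. f i * g i)"
  unfolding msummable_def
proof
  fix m
  have "{i. mcoeff (f i * g i) m \<noteq> 0} \<subseteq> (\<Union>p\<in>{(a, b). a + b = m}. {i. mcoeff (f i) (fst p) \<noteq> 0})"
    using mcoeff_mult_nonzero by fastforce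
  moreover have "finite \<dots>"
    using assms by (intro finite_UN_I finite_msplit) (auto simp: msummable_def)
  ultimately show "finite {i. mcoeff (f i * g i) m \<noteq> 0}" by (rule finite_subset)
qed

lemma msummable_mult_family2:
  assumes "msummable f"
  shows "msummable (\<lambda>i. g i * f i)"
  using msummable_mult_family [OF assms, of g] by (simp add: mult.commute)

lemma msummable_prod:
  assumes "msummable f" "msummable g"
  shows "msummable (\<lambda>(i, j). f i * g j)"
  unfolding msummable_def
proof
  fix m
  have "{p. mcoeff (case p of (i, j) \<Rightarrow> f i * g j) m \<noteq> 0}
      \<subseteq> (\<Union>p\<in>{(a, b). a + b = m}. {i. mcoeff (f i) (fst p) \<noteq> 0} \<times> {i. mcoeff (g i) (snd p) \<noteq> 0})"
    using mcoeff_mult_nonzero by fastforce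
  moreover have "finite \<dots>"
    using assms by (intro finite_UN_I finite_msplit) (auto simp: msummable_def)
  ultimately show "finite {p. mcoeff (case p of (i, j) \<Rightarrow> f i * g j) m \<noteq> 0}" by (rule finite_subset)
qed

lemma msummable_add:
  assumes "msummable f" "msummable g"
  shows "msummable (\<lambda>i. f i + g i)"
  unfolding msummable_def
proof
  fix m
  have "{i. mcoeff (f i + g i) m \<noteq> 0} \<subseteq> {i. mcoeff (f i) m \<noteq> 0} \<union> {i. mcoeff (g i) m \<noteq> 0}"
    by auto
  then show "finite {i. mcoeff (f i + g i) m \<noteq> 0}"
    by (rule finite_subset) (use assms in \<open>auto simp: msummable_def\<close>)
qed

lemma msummable_uminus:
  fixes f :: "'i \<Rightarrow> ('v, 'a :: comm_ring_1) mps"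
  shows "msummable f \<Longrightarrow> msummable (\<lambda>i. - f i)"
  by (simp add: msummable_def)

lemma msummable_diff:
  fixes f :: "'i \<Rightarrow> ('v, 'a :: comm_ring_1) mps"
  shows "msummable f \<Longrightarrow> msummable g \<Longrightarrow> msummable (\<lambda>i. f i - g i)"
  using msummable_add [OF _ msummable_uminus, of f g] by simp

lemma msummable_inj:
  assumes "msummable f" "inj h"
  shows "msummable (\<lambda>i. f (h i))"
  unfolding msummable_def
proof
  fix m
  show "finite {i. mcoeff (f (h i)) m \<noteq> 0}"
    using finite_vimageI [OF msummableD [OF assms(1), of m] assms(2)] by (simp add: vimage_def)
qed

lemma msum_add:
  assumes "msummable f" "msummable g"
  shows "msum (\<lambda>i. f i + g i) = msum f + msum g"
  by (rule mps_eqI) (use assms in \<open>simp add: mcoeff_msum msummable_def Sum_any.distrib\<close>)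

lemma msum_uminus:
  fixes f :: "'i \<Rightarrow> ('v, 'a :: comm_ring_1) mps"
  shows "msum (\<lambda>i. - f i) = - msum f"
proof (rule mps_eqI)
  fix m
  show "mcoeff (msum (\<lambda>i. - f i)) m = mcoeff (- msum f) m"
    by (simp add: mcoeff_msum Sum_any.expand_set sum_negf)
qed

lemma msum_diff:
  fixes f :: "'i \<Rightarrow> ('v, 'a :: comm_ring_1) mps"
  assumes "msummable f" "msummable g"
  shows "msum (\<lambda>i. f i - g i) = msum f - msum g"
  using msum_add [OF assms(1) msummable_uminus [OF assms(2)]] by (simp add: msum_uminus)

lemma msum_mult_left:
  assumes "msummable f"
  shows "G * msum f = msum (\<lambda>i. G * f i)"
proof (rule mps_eqI)
  fix m
  define A where "A = (\<Union>p\<in>{(a, b). a + b = m}. {i. mcoeff (f i) (snd p) \<noteq> 0})"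
  have fin: "finite A"
    unfolding A_def using assms by (intro finite_UN_I finite_msplit) (auto simp: msummable_def)
  have "mcoeff (G * msum f) m
      = (\<Sum>p\<in>{(a, b). a + b = m}. mcoeff G (fst p) * mcoeff (msum f) (snd p))"
    by (simp add: mcoeff_mult case_prod_unfold)
  also have "\<dots> = (\<Sum>p\<in>{(a, b). a + b = m}. mcoeff G (fst p) * (\<Sum>i\<in>A. mcoeff (f i) (snd p)))"
    by (intro sum.cong refl arg_cong [of _ _ "times _"] mcoeff_msum_superset fin)
      (force simp: A_def)
  also have "\<dots> = (\<Sum>i\<in>A. mcoeff (G * f i) m)"
    by (simp add: mcoeff_mult case_prod_unfold sum_distrib_left sum.swap [of _ A])
  also have "\<dots> = mcoeff (msum (\<lambda>i. G * f i)) m"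
    by (rule mcoeff_msum_superset [symmetric, OF fin])
      (use mcoeff_mult_nonzero in \<open>fastforce simp: A_def\<close>)
  finally show "mcoeff (G * msum f) m = mcoeff (msum (\<lambda>i. G * f i)) m" .
qed

lemma msum_mult_right: "msummable f \<Longrightarrow> msum f * G = msum (\<lambda>i. f i * G)"
  using msum_mult_left [of f G] by (simp add: mult.commute)

text \<open>Reindexing along a map with finite fibres. When the fibres are the decompositions of an
  index, it turns a product of two sums into a Cauchy product.\<close>

lemma msum_group:
  assumes f: "msummable f" and g: "\<And>k. finite {i. g i = k}"
  shows "msum f = msum (\<lambda>k. \<Sum>i | g i = k. f i)"
    and "msummable (\<lambda>k. \<Sum>i | g i = k. f i)"
proof -
  have *: "{k. mcoeff (\<Sum>i | g i = k. f i) m \<noteq> 0} \<subseteq> g ` {i. mcoeff (f i) m \<noteq> 0}" for m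
    unfolding mcoeff_sum by (force elim: sum.not_neutral_contains_not_neutral)
  show "msummable (\<lambda>k. \<Sum>i | g i = k. f i)"
    unfolding msummable_def
    using * msummableD [OF f] by (metis (no_types, lifting) finite_imageI finite_subset)
  show "msum f = msum (\<lambda>k. \<Sum>i | g i = k. f i)"
  proof (rule mps_eqI)
    fix m
    let ?A = "{i. mcoeff (f i) m \<noteq> 0}"
    have fin: "finite ?A" using f by (rule msummableD)
    have "mcoeff (msum (\<lambda>k. \<Sum>i | g i = k. f i)) m
        = (\<Sum>k\<in>g ` ?A. mcoeff (\<Sum>i | g i = k. f i) m)"
      by (intro mcoeff_msum_superset finite_imageI fin subsetD [OF *]) simp
    also have "\<dots> = (\<Sum>k\<in>g ` ?A. \<Sum>i | i \<in> ?A \<and> g i = k. mcoeff (f i) m)"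
      unfolding mcoeff_sum
      by (intro sum.cong refl sum.mono_neutral_right g) auto
    also have "\<dots> = (\<Sum>i\<in>?A. mcoeff (f i) m)"
      using sum.image_gen [OF fin, of "\<lambda>i. mcoeff (f i) m" g] by simp
    also have "\<dots> = mcoeff (msum f) m"
      by (rule mcoeff_msum_superset [symmetric]) (use fin in auto)
    finally show "mcoeff (msum f) m = mcoeff (msum (\<lambda>k. \<Sum>i | g i = k. f i)) m" ..
  qed
qed

lemma msum_pair:
  assumes "msummable (\<lambda>(i, j). f i j)"
  shows "msum (\<lambda>(i, j). f i j) = msum (\<lambda>i. msum (f i))"
    and "msummable (\<lambda>i. msum (f i))"
proof -
  let ?A = "\<lambda>m. {(i, j). mcoeff (f i j) m \<noteq> 0}"
  have fin: "finite (?A m)" for m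
    using msummableD [OF assms, of m] by (simp add: case_prod_unfold)
  have inner: "mcoeff (msum (f i)) m = (\<Sum>j\<in>snd ` ?A m. mcoeff (f i j) m)" for i m
    by (rule mcoeff_msum_superset) (auto intro: finite_imageI fin image_eqI [of _ snd "(i, _)"])
  have outer: "i \<in> fst ` ?A m" if "mcoeff (msum (f i)) m \<noteq> 0" for i m
  proof -
    from that obtain j where "mcoeff (f i j) m \<noteq> 0"
      unfolding inner by (rule sum.not_neutral_contains_not_neutral)
    then show ?thesis by (intro image_eqI [of _ fst "(i, j)"]) auto
  qed
  show "msummable (\<lambda>i. msum (f i))"
    unfolding msummable_def
  proof
    fix m
    show "finite {i. mcoeff (msum (f i)) m \<noteq> 0}"
      by (rule finite_subset [of _ "fst ` ?A m"]) (use outer fin in auto)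
  qed
  show "msum (\<lambda>(i, j). f i j) = msum (\<lambda>i. msum (f i))"
  proof (rule mps_eqI)
    fix m
    have "mcoeff (msum (\<lambda>i. msum (f i))) m
        = (\<Sum>i\<in>fst ` ?A m. \<Sum>j\<in>snd ` ?A m. mcoeff (f i j) m)"
      unfolding inner [symmetric]
      by (intro mcoeff_msum_superset finite_imageI fin outer)
    also have "\<dots> = (\<Sum>p\<in>fst ` ?A m \<times> snd ` ?A m. mcoeff (case p of (i, j) \<Rightarrow> f i j) m)"
      by (simp add: sum.cartesian_product case_prod_unfold)
    also have "\<dots> = mcoeff (msum (\<lambda>(i, j). f i j)) m"
      by (rule mcoeff_msum_superset [symmetric]) (use fin in force)+
    finally show "mcoeff (msum (\<lambda>(i, j). f i j)) m = mcoeff (msum (\<lambda>i. msum (f i))) m" ..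
  qed
qed

lemma msum_bij:
  assumes "bij h"
  shows "msum (\<lambda>i. f (h i)) = msum f"
proof (rule mps_eqI)
  fix m
  show "mcoeff (msum (\<lambda>i. f (h i))) m = mcoeff (msum f) m"
    unfolding mcoeff_msum
    by (rule Sum_any.reindex_cong [of h, symmetric]) (use assms in \<open>auto simp: bij_def\<close>)
qed

lemma msummable_swap: "msummable (\<lambda>(i, j). f i j) \<Longrightarrow> msummable (\<lambda>(j, i). f i j)"
  using msummable_inj [of "\<lambda>(i, j). f i j" prod.swap] by (simp add: case_prod_unfold)

lemma msum_swap:
  assumes "msummable (\<lambda>(i, j). f i j)"
  shows "msum (\<lambda>i. msum (f i)) = msum (\<lambda>j. msum (\<lambda>i. f i j))"
proof -
  have "msum (\<lambda>(j, i). f i j) = msum (\<lambda>(i, j). f i j)"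
    using msum_bij [of prod.swap "\<lambda>(i, j). f i j"] by (simp add: case_prod_unfold)
  then show ?thesis
    using msum_pair [OF assms] msum_pair [OF msummable_swap [OF assms]] by simp
qed

lemma msum_mult:
  assumes "msummable f" "msummable g"
  shows "msum f * msum g = msum (\<lambda>(i, j). f i * g j)"
proof -
  have "msum f * msum g = msum (\<lambda>i. msum (\<lambda>j. f i * g j))"
    by (subst msum_mult_right [OF assms(1)]) (simp only: msum_mult_left [OF assms(2)])
  also have "\<dots> = msum (\<lambda>(i, j). f i * g j)"
    by (rule msum_pair(1) [symmetric]) (rule msummable_prod [OF assms])
  finally show ?thesis .
qed

lemma mcoeff_msum_single:
  assumes "\<And>i. mcoeff (f i) m \<noteq> 0 \<Longrightarrow> i = k"
  shows "mcoeff (msum f) m = mcoeff (f k) m"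
  using mcoeff_msum_superset [of "{k}" f m] assms by auto

lemma msum_single:
  assumes "\<And>i. i \<noteq> k \<Longrightarrow> f i = 0"
  shows "msum f = f k"
  by (rule mps_eqI, rule mcoeff_msum_single) (use assms in \<open>metis mcoeff_zero\<close>)

lemma msum_mmono: "msum (\<lambda>m. mconst (mcoeff F m) * mmono m) = F"
proof (rule mps_eqI)
  fix m
  have "mcoeff (msum (\<lambda>m. mconst (mcoeff F m) * mmono m)) m
      = mcoeff (mconst (mcoeff F m) * mmono m) m"
    by (rule mcoeff_msum_single) (auto simp: mcoeff_mmono split: if_splits)
  then show "mcoeff (msum (\<lambda>m. mconst (mcoeff F m) * mmono m)) m = mcoeff F m"
    by (simp add: mcoeff_mmono)
qed

section \<open>Substitution\<close>

text \<open>
  Under these two conditions \<open>msubst s\<close> is defined by summable families only and is a continuous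
  ring homomorphism.
\<close>

definition madm :: "('v \<Rightarrow> ('w, 'a :: comm_ring_1) mps) \<Rightarrow> bool" where
  "madm s \<longleftrightarrow> (\<forall>v. mcoeff (s v) {#} = 0) \<and> msummable s"

lemma madmI: "(\<And>v. mcoeff (s v) {#} = 0) \<Longrightarrow> msummable s \<Longrightarrow> madm s"
  by (simp add: madm_def)

lemma madm_empty: "madm s \<Longrightarrow> mcoeff (s v) {#} = 0"
  by (simp add: madm_def)

lemma madm_summable: "madm s \<Longrightarrow> msummable s"
  by (simp add: madm_def)

lemma finite_submultisets: "finite {a. a \<subseteq># (m :: 'v multiset)}"
proof -
  have "{a. a \<subseteq># m} = fst ` {(a, b). a + b = m}"
    by (auto simp: mset_subset_eq_exists_conv image_def)
  then show ?thesis by (simp add: finite_msplit)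
qed

lemma finite_multisets_size_le:
  assumes "finite S"
  shows "finite {M. set_mset M \<subseteq> S \<and> size M \<le> n}"
proof (rule finite_subset)
  show "{M. set_mset M \<subseteq> S \<and> size M \<le> n} \<subseteq> mset ` {xs. set xs \<subseteq> S \<and> length xs \<le> n}"
  proof
    fix M assume "M \<in> {M. set_mset M \<subseteq> S \<and> size M \<le> n}"
    moreover obtain xs where "mset xs = M" using ex_mset by blast
    ultimately show "M \<in> mset ` {xs. set xs \<subseteq> S \<and> length xs \<le> n}"
      by (intro image_eqI [of _ _ xs]) auto
  qed
  show "finite (mset ` {xs. set xs \<subseteq> S \<and> length xs \<le> n})"
    by (intro finite_imageI finite_lists_length_le assms)
qed

text \<open>Without constant terms every factor uses up at least one variable of m, and what it uses
  is a submonomial of m. The first fact bounds the size of M, the second its support, so finitely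
  many M reach a given m.\<close>

lemma mcoeff_prod_mset_nonzero:
  assumes s: "\<And>v. mcoeff (s v) {#} = (0 :: 'a :: comm_ring_1)"
    and "mcoeff (\<Prod>v\<in>#M. s v) m \<noteq> 0"
  shows "size M \<le> size m \<and> (\<forall>v\<in>#M. \<exists>a. a \<subseteq># m \<and> mcoeff (s v) a \<noteq> 0)"
  using assms(2)
proof (induction M arbitrary: m)
  case (add v M)
  from add.prems have "mcoeff (s v * (\<Prod>v\<in>#M. s v)) m \<noteq> 0" by simp
  from mcoeff_mult_nonzero [OF this] obtain a b
    where ab: "a + b = m" "mcoeff (s v) a \<noteq> 0" "mcoeff (\<Prod>v\<in>#M. s v) b \<noteq> 0"
    by auto
  have "a \<noteq> {#}" using ab(2) s by auto
  then have "size a \<ge> 1" by (cases a) auto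
  moreover have "size M \<le> size b" "\<forall>v\<in>#M. \<exists>a. a \<subseteq># b \<and> mcoeff (s v) a \<noteq> 0"
    using add.IH [OF ab(3)] by auto
  moreover have "a \<subseteq># m" "b \<subseteq># m" using ab(1) by auto
  ultimately show ?case
    using ab subset_mset.order_trans [of _ b m] by (fastforce simp: ab(1) [symmetric])
qed simp

lemma msummable_prod_mset:
  assumes "madm s"
  shows "msummable (\<lambda>M. \<Prod>v\<in>#M. s v)"
  unfolding msummable_def
proof
  fix m
  let ?S = "\<Union>a\<in>{a. a \<subseteq># m}. {v. mcoeff (s v) a \<noteq> 0}"
  have "finite ?S"
    using finite_submultisets assms by (auto simp: madm_def msummable_def)
  then have "finite {M. set_mset M \<subseteq> ?S \<and> size M \<le> size m}"
    by (rule finite_multisets_size_le)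
  moreover have "{M. mcoeff (\<Prod>v\<in>#M. s v) m \<noteq> 0} \<subseteq> {M. set_mset M \<subseteq> ?S \<and> size M \<le> size m}"
    using mcoeff_prod_mset_nonzero [of s _ m] madm_empty [OF assms] by fastforce
  ultimately show "finite {M. mcoeff (\<Prod>v\<in>#M. s v) m \<noteq> 0}"
    by (rule rev_finite_subset)
qed

lemma msummable_msubst: "madm s \<Longrightarrow> msummable (\<lambda>M. mconst (c M) * (\<Prod>v\<in>#M. s v))"
  by (intro msummable_mult_family2 msummable_prod_mset)

text \<open>The continuous linear extension of a map on monomials. It serves both for
  \<open>msubst\<close>, where the map is multiplicative, and for \<open>kp_row\<close>, where it is
  not.\<close>

definition mlin :: "('v multiset \<Rightarrow> ('w, 'a :: comm_ring_1) mps) \<Rightarrow> ('v, 'a) mps \<Rightarrow> ('w, 'a) mps" where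
  "mlin \<rho> F = msum (\<lambda>M. mconst (mcoeff F M) * \<rho> M)"

lemma msubst_eq_mlin: "msubst s F = mlin (\<lambda>M. \<Prod>v\<in>#M. s v) F"
  by (simp add: msubst_def mlin_def)

lemma mlin_add:
  assumes "msummable \<rho>"
  shows "mlin \<rho> (F + G) = mlin \<rho> F + mlin \<rho> G"
  unfolding mlin_def
  by (subst msum_add [symmetric]) (auto simp: assms msummable_mult_family2 mconst_add distrib_right)

lemma mlin_mmono: "mlin \<rho> (mmono M) = \<rho> M"
  unfolding mlin_def by (subst msum_single [of M]) (auto simp: mcoeff_mmono)

lemma mlin_mconst_mult:
  assumes "msummable \<rho>"
  shows "mlin \<rho> (mconst c * F) = mconst c * mlin \<rho> F"
  unfolding mlin_def
  by (subst msum_mult_left) (auto simp: assms msummable_mult_family2 mconst_mult mult.assoc)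

text \<open>The double family over M and i is summable: a target monomial is reached from finitely
  many M, and each M occurs in finitely many \<open>f i\<close>. Then the two sums may be
  exchanged.\<close>

lemma mlin_msum:
  assumes \<rho>: "msummable \<rho>" and f: "msummable f"
  shows "mlin \<rho> (msum f) = msum (\<lambda>i. mlin \<rho> (f i))"
    and "msummable (\<lambda>i. mlin \<rho> (f i))"
proof -
  have sum: "msummable (\<lambda>(M, i). mconst (mcoeff (f i) M) * \<rho> M)"
    unfolding msummable_def
  proof
    fix m
    let ?S = "{M. mcoeff (\<rho> M) m \<noteq> 0}"
    have "finite (SIGMA M : ?S. {i. mcoeff (f i) M \<noteq> 0})"
      using msummableD [OF \<rho>] msummableD [OF f] by blast
    then show "finite {p. mcoeff (case p of (M, i) \<Rightarrow> mconst (mcoeff (f i) M) * \<rho> M) m \<noteq> 0}"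
      by (rule rev_finite_subset) auto
  qed
  have *: "mconst (mcoeff (msum f) M) * \<rho> M = msum (\<lambda>i. mconst (mcoeff (f i) M) * \<rho> M)" for M
    by (rule mps_eqI)
      (simp add: mcoeff_msum Sum_any_left_distrib msummableD [OF f] flip: Sum_any_left_distrib)
  show "mlin \<rho> (msum f) = msum (\<lambda>i. mlin \<rho> (f i))"
    unfolding mlin_def * by (rule msum_swap [OF sum])
  show "msummable (\<lambda>i. mlin \<rho> (f i))"
    unfolding mlin_def by (rule msum_pair(2) [OF msummable_swap [OF sum]])
qed

lemma mlin_mult_mmono:
  fixes F :: "('v, 'a :: comm_ring_1) mps"
  assumes \<rho>: "msummable \<rho>" and N: "\<And>M. \<rho> (M + N) = \<rho> M * C"
  shows "mlin \<rho> (F * mmono N) = mlin \<rho> F * C"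
proof -
  have sum: "msummable (\<lambda>M. mconst (mcoeff F M) * mmono M :: ('v, 'a) mps)"
    by (rule msummable_mult_family2) (auto simp: msummable_def mcoeff_mmono)
  have "F * mmono N = msum (\<lambda>M. mconst (mcoeff F M) * mmono M) * mmono N"
    by (simp only: msum_mmono)
  also have "\<dots> = msum (\<lambda>M. mconst (mcoeff F M) * mmono (M + N))"
    by (subst msum_mult_right [OF sum]) (simp add: mmono_add mult.assoc)
  finally have "mlin \<rho> (F * mmono N) = msum (\<lambda>M. mlin \<rho> (mconst (mcoeff F M) * mmono (M + N)))"
    using msummable_mult_right [OF sum, of "mmono N"]
    by (simp add: mlin_msum \<rho> mmono_add mult.assoc)
  also have "\<dots> = msum (\<lambda>M. mconst (mcoeff F M) * \<rho> M * C)"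
    by (simp add: mlin_mconst_mult \<rho> mlin_mmono N mult.assoc)
  also have "\<dots> = mlin \<rho> F * C"
    unfolding mlin_def by (intro msum_mult_right [symmetric] msummable_mult_family2 \<rho>)
  finally show ?thesis .
qed

lemma msubst_add: "madm s \<Longrightarrow> msubst s (F + G) = msubst s F + msubst s G"
  unfolding msubst_eq_mlin by (intro mlin_add msummable_prod_mset)

lemma msubst_uminus: "msubst s (- F) = - msubst s F"
  unfolding msubst_def by (subst msum_uminus [symmetric]) (simp add: mconst_uminus)

lemma msubst_diff: "madm s \<Longrightarrow> msubst s (F - G) = msubst s F - msubst s G"
  using msubst_add [of s F "- G"] by (simp add: msubst_uminus)

lemma msubst_mmono [simp]: "msubst s (mmono M) = (\<Prod>v\<in>#M. s v)"
  unfolding msubst_eq_mlin by (rule mlin_mmono)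

lemma msubst_mvar [simp]: "msubst s (mvar v) = s v"
  by (simp add: mvar_eq_mmono)

lemma msubst_mconst [simp]: "msubst s (mconst c) = mconst c"
  unfolding msubst_def
  by (subst msum_single [of "{#}"]) (auto simp: mcoeff_mconst)

lemma msubst_0 [simp]: "msubst s 0 = 0"
  using msubst_mconst [of s 0] by simp

lemma msubst_1 [simp]: "msubst s 1 = 1"
  using msubst_mconst [of s 1] by simp

lemma msubst_mult:
  assumes "madm s"
  shows "msubst s (F * G) = msubst s F * msubst s G"
proof -
  let ?s = "\<lambda>M. \<Prod>v\<in>#M. s v"
  have sum: "msummable (\<lambda>(M, N). (mconst (mcoeff F M) * ?s M) * (mconst (mcoeff G N) * ?s N))"
    by (intro msummable_prod msummable_msubst assms)
  have fin: "finite {p. fst p + snd p = (K :: 'a multiset)}" for K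
    using finite_msplit [of K] by (simp add: case_prod_unfold)
  have "msubst s F * msubst s G
      = msum (\<lambda>(M, N). (mconst (mcoeff F M) * ?s M) * (mconst (mcoeff G N) * ?s N))"
    unfolding msubst_def by (intro msum_mult msummable_msubst assms)
  also have "\<dots> = msum (\<lambda>K. \<Sum>p | fst p + snd p = K.
      (mconst (mcoeff F (fst p)) * ?s (fst p)) * (mconst (mcoeff G (snd p)) * ?s (snd p)))"
    using msum_group(1) [OF sum fin] by (simp add: case_prod_unfold)
  also have "\<dots> = msum (\<lambda>K. mconst (mcoeff (F * G) K) * ?s K)"
    by (rule msum_cong)
      (auto simp: mcoeff_mult mconst_sum sum_distrib_right case_prod_unfold mconst_mult
        mult.assoc mult.left_commute intro!: sum.cong)
  finally show ?thesis by (simp add: msubst_def)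
qed

lemma msubst_power: "madm s \<Longrightarrow> msubst s (F ^ n) = msubst s F ^ n"
  by (induction n) (auto simp: msubst_mult)

lemma msubst_prod_mset: "madm s \<Longrightarrow> msubst s (\<Prod>v\<in>#M. t v) = (\<Prod>v\<in>#M. msubst s (t v))"
  by (induction M) (auto simp: msubst_mult)

lemma msubst_msum:
  assumes "madm s" "msummable f"
  shows "msubst s (msum f) = msum (\<lambda>i. msubst s (f i))"
    and "msummable (\<lambda>i. msubst s (f i))"
  unfolding msubst_eq_mlin by (intro mlin_msum msummable_prod_mset assms)+

lemma mcoeff_msubst_empty [simp]:
  assumes "madm s"
  shows "mcoeff (msubst s F) {#} = mcoeff F {#}"
proof -
  have "mcoeff (\<Prod>v\<in>#M. s v) {#} = 0" if "M \<noteq> {#}" for M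
    using mcoeff_prod_mset_nonzero [of s M "{#}"] madm_empty [OF assms] that by auto
  then have "mcoeff (msubst s F) {#} = mcoeff (mconst (mcoeff F {#}) * (\<Prod>v\<in>#{#}. s v)) {#}"
    unfolding msubst_def by (intro mcoeff_msum_single) force
  then show ?thesis by (simp add: mcoeff_mconst)
qed

lemma madm_msubst:
  assumes "madm s" "madm t"
  shows "madm (\<lambda>v. msubst s (t v))"
  using assms by (intro madmI msubst_msum(2)) (auto simp: madm_def)

lemma msubst_msubst:
  assumes "madm s" "madm t"
  shows "msubst s (msubst t F) = msubst (\<lambda>v. msubst s (t v)) F"
proof -
  have "msubst s (msubst t F) = msum (\<lambda>M. msubst s (mconst (mcoeff F M) * (\<Prod>v\<in>#M. t v)))"
    unfolding msubst_def [of t] by (intro msubst_msum assms msummable_msubst)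
  also have "\<dots> = msubst (\<lambda>v. msubst s (t v)) F"
    unfolding msubst_def [of "\<lambda>v. msubst s (t v)"]
    by (simp add: msubst_mult msubst_prod_mset assms)
  finally show ?thesis .
qed

lemma madm_mvar: "madm mvar"
proof (rule madmI)
  show "msummable (mvar :: _ \<Rightarrow> ('a, 'b) mps)"
    unfolding msummable_def
  proof
    fix m :: "'a multiset"
    have "{v. mcoeff (mvar v :: ('a, 'b) mps) m \<noteq> 0} \<subseteq> set_mset m"
      by (auto simp: mcoeff_mvar)
    then show "finite {v. mcoeff (mvar v :: ('a, 'b) mps) m \<noteq> 0}"
      by (rule finite_subset) auto
  qed
qed (simp add: mcoeff_mvar)

lemma msubst_mvar_id [simp]: "msubst mvar F = F"
  unfolding msubst_def by (simp add: mmono_eq_prod msum_mmono)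

lemma madm_finite: "(\<And>v. mcoeff (s v) {#} = 0) \<Longrightarrow> finite (UNIV :: 'v set) \<Longrightarrow> madm (s :: 'v \<Rightarrow> _)"
  by (intro madmI msummable_finite)

lemma msummable_mvar_inj: "inj f \<Longrightarrow> msummable (\<lambda>i. mvar (f i) :: ('v, 'a :: comm_ring_1) mps)"
  using msummable_inj [OF madm_summable [OF madm_mvar]] .

section \<open>Univariate series evaluated at multivariate ones\<close>

definition mfps :: "'a :: comm_ring_1 fps \<Rightarrow> ('v, 'a) mps \<Rightarrow> ('v, 'a) mps" where
  "mfps f F = msum (\<lambda>n. mconst (fps_nth f n) * F ^ n)"

lemma mcoeff_power_nonzero_size:
  assumes "mcoeff F {#} = 0" "mcoeff (F ^ n) m \<noteq> 0"
  shows "n \<le> size m"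
proof -
  have "F ^ n = (\<Prod>v\<in>#replicate_mset n (). F)" by simp
  then show ?thesis
    using mcoeff_prod_mset_nonzero [of "\<lambda>_. F" "replicate_mset n ()" m] assms by auto
qed

lemma msummable_power:
  assumes "mcoeff F {#} = 0"
  shows "msummable (\<lambda>n. F ^ n)"
  unfolding msummable_def
proof
  fix m
  show "finite {n. mcoeff (F ^ n) m \<noteq> 0}"
    by (rule finite_subset [of _ "{..size m}"]) (use mcoeff_power_nonzero_size [OF assms] in auto)
qed

lemma msummable_mfps: "mcoeff F {#} = 0 \<Longrightarrow> msummable (\<lambda>n. mconst (c n) * F ^ n)"
  by (intro msummable_mult_family2 msummable_power)

lemma mfps_add: "mcoeff F {#} = 0 \<Longrightarrow> mfps (f + g) F = mfps f F + mfps g F"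
  unfolding mfps_def
  by (subst msum_add [symmetric, OF msummable_mfps msummable_mfps])
    (auto simp: mconst_add distrib_right)

lemma mfps_uminus: "mfps (- f) F = - mfps f F"
  unfolding mfps_def by (subst msum_uminus [symmetric]) (simp add: mconst_uminus)

lemma mfps_diff: "mcoeff F {#} = 0 \<Longrightarrow> mfps (f - g) F = mfps f F - mfps g F"
  using mfps_add [of F f "- g"] by (simp add: mfps_uminus)

lemma mfps_const [simp]: "mfps (fps_const c) F = mconst c"
  unfolding mfps_def by (subst msum_single [of 0]) auto

lemma mfps_1 [simp]: "mfps 1 F = 1"
  using mfps_const [of 1] by (simp del: mfps_const)

lemma mfps_X [simp]: "mfps fps_X F = F"
  unfolding mfps_def by (subst msum_single [of 1]) auto

lemma mfps_mult:
  assumes "mcoeff F {#} = 0"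
  shows "mfps (f * g) F = mfps f F * mfps g F"
proof -
  have sum: "msummable (\<lambda>(i, j). (mconst (fps_nth f i) * F ^ i) * (mconst (fps_nth g j) * F ^ j))"
    by (intro msummable_prod msummable_mfps assms)
  have set: "{p. fst p + snd p = n} = (\<lambda>i. (i, n - i)) ` {0..n}" for n :: nat
    by force
  have fin: "finite {p. fst p + snd p = n}" for n :: nat
    unfolding set by simp
  have "mfps f F * mfps g F
      = msum (\<lambda>(i, j). (mconst (fps_nth f i) * F ^ i) * (mconst (fps_nth g j) * F ^ j))"
    unfolding mfps_def by (intro msum_mult msummable_mfps assms)
  also have "\<dots> = msum (\<lambda>n. \<Sum>p | fst p + snd p = n.
      (mconst (fps_nth f (fst p)) * F ^ fst p) * (mconst (fps_nth g (snd p)) * F ^ snd p))"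
    using msum_group(1) [OF sum fin] by (simp add: case_prod_unfold)
  also have "\<dots> = msum (\<lambda>n. mconst (fps_nth (f * g) n) * F ^ n)"
  proof (rule msum_cong)
    fix n
    have "(\<Sum>p | fst p + snd p = n.
        (mconst (fps_nth f (fst p)) * F ^ fst p) * (mconst (fps_nth g (snd p)) * F ^ snd p))
      = (\<Sum>i = 0..n. (mconst (fps_nth f i) * F ^ i) * (mconst (fps_nth g (n - i)) * F ^ (n - i)))"
      unfolding set by (subst sum.reindex) (auto simp: inj_on_def)
    also have "\<dots> = (\<Sum>i = 0..n. mconst (fps_nth f i * fps_nth g (n - i)) * F ^ n)"
    proof (rule sum.cong [OF refl])
      fix i assume "i \<in> {0..n}"
      then have "F ^ n = F ^ i * F ^ (n - i)" by (simp flip: power_add)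
      then show "(mconst (fps_nth f i) * F ^ i) * (mconst (fps_nth g (n - i)) * F ^ (n - i))
          = mconst (fps_nth f i * fps_nth g (n - i)) * F ^ n"
        by (simp add: mconst_mult ac_simps)
    qed
    finally show "(\<Sum>p | fst p + snd p = n.
        (mconst (fps_nth f (fst p)) * F ^ fst p) * (mconst (fps_nth g (snd p)) * F ^ snd p))
      = mconst (fps_nth (f * g) n) * F ^ n"
      by (simp add: fps_mult_nth mconst_sum sum_distrib_right)
  qed
  finally show ?thesis by (simp add: mfps_def)
qed

lemma mfps_power: "mcoeff F {#} = 0 \<Longrightarrow> mfps (f ^ n) F = mfps f F ^ n"
  by (induction n) (auto simp: mfps_mult)

lemma mcoeff_mfps_empty [simp]:
  assumes "mcoeff F {#} = 0"
  shows "mcoeff (mfps f F) {#} = fps_nth f 0"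
proof -
  have "mcoeff (mfps f F) {#} = mcoeff (mconst (fps_nth f 0) * F ^ 0) {#}"
    unfolding mfps_def by (rule mcoeff_msum_single) (use assms in \<open>auto simp: power_0_left split: if_splits\<close>)
  then show ?thesis by (simp add: mcoeff_mconst)
qed

lemma mfps_compose:
  assumes F: "mcoeff F {#} = 0" and g: "fps_nth g 0 = 0"
  shows "mfps (f oo g) F = mfps f (mfps g F)"
proof -
  have nz: "n \<le> k" if "fps_nth (g ^ n) k \<noteq> 0" for n k
    using that g startsby_zero_power_prefix [of g n] by (meson not_less)
  have sum: "msummable (\<lambda>(k, n). mconst (fps_nth f n * fps_nth (g ^ n) k) * F ^ k)"
    unfolding msummable_def
  proof
    fix m
    have "{p. mcoeff (case p of (k, n) \<Rightarrow> mconst (fps_nth f n * fps_nth (g ^ n) k) * F ^ k) m \<noteq> 0}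
        \<subseteq> (SIGMA k : {..size m}. {..k})"
      by (auto dest!: mult_not_zero intro: nz mcoeff_power_nonzero_size [OF F])
    then show "finite {p. mcoeff (case p of (k, n) \<Rightarrow> mconst (fps_nth f n * fps_nth (g ^ n) k) * F ^ k) m \<noteq> 0}"
      by (rule finite_subset) auto
  qed
  have "mfps f (mfps g F) = msum (\<lambda>n. mconst (fps_nth f n) * mfps (g ^ n) F)"
    by (simp add: mfps_def [of f] mfps_power F)
  also have "\<dots> = msum (\<lambda>n. msum (\<lambda>k. mconst (fps_nth f n * fps_nth (g ^ n) k) * F ^ k))"
    unfolding mfps_def
    by (subst msum_mult_left) (auto simp: F mconst_mult mult.assoc intro: msummable_mfps)
  also have "\<dots> = msum (\<lambda>k. msum (\<lambda>n. mconst (fps_nth f n * fps_nth (g ^ n) k) * F ^ k))"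
    by (rule msum_swap [symmetric, OF sum])
  also have "\<dots> = msum (\<lambda>k. mconst (fps_nth (f oo g) k) * F ^ k)"
  proof (rule msum_cong, rule mps_eqI)
    fix k m
    have "mcoeff (msum (\<lambda>n. mconst (fps_nth f n * fps_nth (g ^ n) k) * F ^ k)) m
       = (\<Sum>n = 0..k. mcoeff (mconst (fps_nth f n * fps_nth (g ^ n) k) * F ^ k) m)"
      by (rule mcoeff_msum_superset) (auto dest!: mult_not_zero intro: nz)
    then show "mcoeff (msum (\<lambda>n. mconst (fps_nth f n * fps_nth (g ^ n) k) * F ^ k)) m
        = mcoeff (mconst (fps_nth (f oo g) k) * F ^ k) m"
      by (simp add: fps_compose_nth sum_distrib_right)
  qed
  finally show ?thesis by (simp add: mfps_def)
qed

lemma msubst_mfps: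
  assumes "madm s" "mcoeff F {#} = 0"
  shows "msubst s (mfps f F) = mfps f (msubst s F)"
  unfolding mfps_def
  by (subst msubst_msum) (auto simp: assms msubst_mult msubst_power msummable_mfps)

section \<open>Exponential and logarithm\<close>

lemma rat_inverse: "n > 0 \<Longrightarrow> of_nat n * (1 / of_nat n) = (1 :: 'a :: rat_algebra)"
  using divide_of_nat [of n "1 :: 'a"] by (simp add: mult.commute)

text \<open>\<open>/\<close> is specified in \<open>rat_algebra\<close> only for denominators
  \<open>of_nat n\<close> with n > 0, so rational identities are proved by multiplying up and
  cancelling such integers.\<close>

lemma rat_cancel:
  assumes "n > 0" "of_nat n * a = of_nat n * (b :: 'a :: rat_algebra)"
  shows "a = b"
proof -
  have "(1 / of_nat n) * (of_nat n * a) = (1 / of_nat n) * (of_nat n * b)"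
    using assms(2) by simp
  then show ?thesis
    using rat_inverse [OF assms(1), where 'a = 'a]
    by (simp only: mult.assoc [symmetric] mult.commute [of "1 / _"] mult_1)
qed

definition fexp :: "'a :: rat_algebra fps" where
  "fexp = Abs_fps (\<lambda>n. 1 / of_nat (fact n))"

lemma fexp_nth: "fps_nth fexp n = 1 / of_nat (fact n)"
  by (simp add: fexp_def)

lemma one_divide_fact_0: "1 / of_nat (fact 0) = (1 :: 'a :: rat_algebra)"
  using rat_inverse [of "fact 0", where 'a = 'a] by simp

lemma mexp_eq_mfps: "mexp F = mfps fexp F"
  by (simp add: mexp_def mfps_def fexp_def)

lemma mcoeff_mexp_empty: "mcoeff F {#} = 0 \<Longrightarrow> mcoeff (mexp F) {#} = 1"
  using one_divide_fact_0 by (simp add: mexp_eq_mfps fexp_nth)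

lemma msubst_mexp: "madm s \<Longrightarrow> mcoeff F {#} = 0 \<Longrightarrow> msubst s (mexp F) = mexp (msubst s F)"
  by (simp add: mexp_eq_mfps msubst_mfps)

lemma mexp_0 [simp]: "mexp 0 = 1"
  unfolding mexp_def
  by (subst msum_single [of 0]) (use one_divide_fact_0 [where 'a = 'b] in \<open>auto simp: power_0_left\<close>)

lemma divide_fact_binomial:
  assumes "k \<le> n"
  shows "(1 / of_nat (fact n)) * of_nat (n choose k)
    = (1 / of_nat (fact k)) * (1 / of_nat (fact (n - k)) :: 'a :: rat_algebra)"
proof (rule rat_cancel [of "fact k * fact (n - k)"])
  let ?i = "\<lambda>n. 1 / of_nat (fact n) :: 'a"
  have "of_nat (fact k * fact (n - k)) * (?i n * of_nat (n choose k))
      = of_nat (fact k * fact (n - k) * (n choose k)) * ?i n"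
    by (simp add: ac_simps)
  also have "fact k * fact (n - k) * (n choose k) = (fact n :: nat)"
    by (rule binomial_fact_lemma [OF assms])
  also have "of_nat (fact n) * ?i n = 1"
    by (rule rat_inverse) simp
  also have "1 = (of_nat (fact k) * ?i k) * (of_nat (fact (n - k)) * ?i (n - k))"
    by (subst (1 2) rat_inverse) simp_all
  also have "\<dots> = of_nat (fact k * fact (n - k)) * (?i k * ?i (n - k))"
    by (simp add: ac_simps)
  finally show "of_nat (fact k * fact (n - k)) * (?i n * of_nat (n choose k))
    = of_nat (fact k * fact (n - k)) * (?i k * ?i (n - k))" .
qed simp

lemma mexp_add:
  fixes F G :: "('v, 'a :: rat_algebra) mps"
  assumes "mcoeff F {#} = 0" "mcoeff G {#} = 0"
  shows "mexp (F + G) = mexp F * mexp G"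
proof -
  let ?i = "\<lambda>n. 1 / of_nat (fact n) :: 'a"
  have sum: "msummable (\<lambda>(i, j). (mconst (?i i) * F ^ i) * (mconst (?i j) * G ^ j))"
    by (intro msummable_prod msummable_mfps assms)
  have set: "{p. fst p + snd p = n} = (\<lambda>i. (i, n - i)) ` {..n}" for n :: nat
    by force
  have fin: "finite {p. fst p + snd p = n}" for n :: nat
    unfolding set by simp
  have "mexp F * mexp G = msum (\<lambda>(i, j). (mconst (?i i) * F ^ i) * (mconst (?i j) * G ^ j))"
    unfolding mexp_def by (intro msum_mult msummable_mfps assms)
  also have "\<dots> = msum (\<lambda>n. \<Sum>p | fst p + snd p = n.
      (mconst (?i (fst p)) * F ^ fst p) * (mconst (?i (snd p)) * G ^ snd p))"
    using msum_group(1) [OF sum fin] by (simp add: case_prod_unfold)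
  also have "\<dots> = msum (\<lambda>n. mconst (?i n) * (F + G) ^ n)"
  proof (rule msum_cong)
    fix n
    have "(\<Sum>p | fst p + snd p = n.
        (mconst (?i (fst p)) * F ^ fst p) * (mconst (?i (snd p)) * G ^ snd p))
      = (\<Sum>i\<le>n. (mconst (?i i) * F ^ i) * (mconst (?i (n - i)) * G ^ (n - i)))"
      unfolding set by (subst sum.reindex) (auto simp: inj_on_def)
    also have "\<dots> = (\<Sum>i\<le>n. mconst (?i n) * (of_nat (n choose i) * F ^ i * G ^ (n - i)))"
    proof (rule sum.cong [OF refl])
      fix i assume "i \<in> {..n}"
      then have "mconst (?i i) * mconst (?i (n - i))
          = mconst (?i n) * (of_nat (n choose i) :: ('v, 'a) mps)"
        using divide_fact_binomial [of i n, where 'a = 'a] by (simp flip: mconst_mult mconst_of_nat)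
      then show "(mconst (?i i) * F ^ i) * (mconst (?i (n - i)) * G ^ (n - i))
          = mconst (?i n) * (of_nat (n choose i) * F ^ i * G ^ (n - i))"
        by (metis (no_types, lifting) mult.assoc mult.commute mult.left_commute)
    qed
    also have "\<dots> = mconst (?i n) * (F + G) ^ n"
      by (simp add: binomial_ring sum_distrib_left)
    finally show "(\<Sum>p | fst p + snd p = n.
        (mconst (?i (fst p)) * F ^ fst p) * (mconst (?i (snd p)) * G ^ snd p))
      = mconst (?i n) * (F + G) ^ n" .
  qed
  finally show ?thesis by (simp add: mexp_def)
qed

lemma mexp_uminus: "mcoeff F {#} = 0 \<Longrightarrow> mexp F * mexp (- F) = 1"
  by (subst mexp_add [symmetric]) auto

section \<open>Univariate identities\<close>

text \<open>This is log (1 - X), not log (1 + X): up to sign it is the sum of X^k / k that occurs in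
  the exponential prefactor of the Hirota identity.\<close>

definition flog :: "'a :: rat_algebra fps" where
  "flog = Abs_fps (\<lambda>n. if n = 0 then 0 else - (1 / of_nat n))"

lemma flog_nth: "fps_nth flog n = (if n = 0 then 0 else - (1 / of_nat n))"
  by (simp add: flog_def)

lemma fexp_deriv: "fps_deriv fexp = (fexp :: 'a :: rat_algebra fps)"
proof (rule fps_ext)
  fix n
  have "of_nat (Suc n) * (1 / of_nat (fact (Suc n))) = (1 / of_nat (fact n) :: 'a)"
  proof (rule rat_cancel [of "fact n"])
    have "of_nat (fact n) * (of_nat (Suc n) * (1 / of_nat (fact (Suc n))))
        = of_nat (fact (Suc n)) * (1 / of_nat (fact (Suc n)) :: 'a)"
      by (simp only: fact_Suc of_nat_mult of_nat_id mult.assoc mult.left_commute)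
    then show "of_nat (fact n) * (of_nat (Suc n) * (1 / of_nat (fact (Suc n))))
        = of_nat (fact n) * (1 / of_nat (fact n) :: 'a)"
      by (simp only: rat_inverse [OF fact_gt_zero])
  qed simp
  then show "fps_nth (fps_deriv fexp) n = fps_nth (fexp :: 'a fps) n"
    by (simp add: fexp_nth del: fact_Suc of_nat_Suc)
qed

lemma flog_deriv: "(1 - fps_X) * fps_deriv flog = (- 1 :: 'a :: rat_algebra fps)"
proof (rule fps_ext)
  fix n
  have *: "fps_nth (fps_deriv flog) n = (- 1 :: 'a)" for n
    using rat_inverse [of "Suc n", where 'a = 'a] by (simp add: flog_nth del: of_nat_Suc)
  then show "fps_nth ((1 - fps_X) * fps_deriv flog) n = fps_nth (- 1 :: 'a fps) n"
    by (cases n) (simp_all add: left_diff_distrib * del: fps_deriv_nth)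
qed

text \<open>The composite f satisfies (1 - X) f' = -f, that is (n + 1) f_(n+1) = (n - 1) f_n. With
  f_0 = 1 this gives f_1 = -1, and the factor n - 1 kills everything from n = 1 on.\<close>

lemma fexp_flog: "fexp oo flog = (1 - fps_X :: 'a :: {idom, rat_algebra} fps)"
proof -
  let ?f = "fexp oo flog :: 'a fps"
  have "(1 - fps_X) * fps_deriv ?f = ?f * ((1 - fps_X) * fps_deriv flog)"
    by (subst fps_compose_deriv) (auto simp: flog_nth fexp_deriv ac_simps)
  then have ode: "(1 - fps_X) * fps_deriv ?f = - ?f"
    by (simp add: flog_deriv)
  have rec: "of_nat (Suc n) * fps_nth ?f (Suc n) = (of_nat n - 1) * fps_nth ?f n" for n
    using arg_cong [OF ode, of "\<lambda>g. fps_nth g n"]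
    by (cases n) (auto simp: left_diff_distrib algebra_simps)
  have f0: "fps_nth ?f 0 = 1"
    using one_divide_fact_0 [where 'a = 'a] by (simp add: fexp_nth)
  have f1: "fps_nth ?f 1 = -1"
    using rec [of 0] f0 by simp
  have f2: "fps_nth ?f (Suc (Suc n)) = 0" for n
  proof (induction n)
    case 0
    have "of_nat 2 * fps_nth ?f 2 = of_nat 2 * 0"
      using rec [of 1] f1 by (simp add: numeral_2_eq_2)
    then have "fps_nth ?f 2 = 0" by (rule rat_cancel [rotated]) simp
    then show ?case by (simp add: numeral_2_eq_2)
  next
    case (Suc n)
    have "of_nat (Suc (Suc (Suc n))) * fps_nth ?f (Suc (Suc (Suc n))) = of_nat (Suc (Suc (Suc n))) * 0"
      using rec [of "Suc (Suc n)"] Suc by simp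
    then show ?case by (rule rat_cancel [rotated]) simp
  qed
  show ?thesis
  proof (rule fps_ext)
    fix n
    show "fps_nth ?f n = fps_nth (1 - fps_X) n"
      using f0 f1 f2 by (cases n; cases "n - 1") auto
  qed
qed

definition mlog :: "('v, 'a :: rat_algebra) mps \<Rightarrow> ('v, 'a) mps" where
  "mlog G = mfps flog (1 - G)"

lemma mcoeff_mlog_empty: "mcoeff G {#} = 1 \<Longrightarrow> mcoeff (mlog G) {#} = 0"
  by (simp add: mlog_def mcoeff_one flog_nth)

lemma mlog_1 [simp]: "mlog 1 = 0"
  unfolding mlog_def mfps_def
  by (subst msum_single [of 0]) (auto simp: flog_nth power_0_left)

lemma mexp_mlog:
  fixes G :: "('v, 'a :: {idom, rat_algebra}) mps"
  assumes "mcoeff G {#} = 1"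
  shows "mexp (mlog G) = G"
proof -
  have 1: "mcoeff (1 - G) {#} = 0" using assms by (simp add: mcoeff_one)
  have "mexp (mlog G) = mfps (fexp oo flog) (1 - G)"
    unfolding mexp_eq_mfps mlog_def by (rule mfps_compose [symmetric, OF 1]) (simp add: flog_nth)
  also have "\<dots> = G"
    by (simp add: fexp_flog mfps_diff [OF 1])
  finally show ?thesis .
qed

lemma msubst_mlog: "madm s \<Longrightarrow> mcoeff G {#} = 1 \<Longrightarrow> msubst s (mlog G) = mlog (msubst s G)"
  unfolding mlog_def by (subst msubst_mfps) (auto simp: mcoeff_one msubst_diff)

section \<open>Units, injectivity of the exponential, compositional inverses\<close>

lemma fps_unit_ex: "c * fps_nth f 0 = (1 :: 'a :: comm_ring_1) \<Longrightarrow> \<exists>g. f * g = 1"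
  using fps_right_inverse [of f c] by (auto simp: mult.commute)

lemma fps_eq_const_add_X_shift:
  "f = fps_const (fps_nth f 0) + fps_X * fps_shift 1 (f :: 'a :: comm_ring_1 fps)"
  by (rule fps_ext) auto

text \<open>exp F - 1 equals F U(F), where U has constant term 1 and hence is a unit; no absence of
  zero divisors is needed.\<close>

lemma mexp_eq_1_imp:
  fixes F :: "('v, 'a :: rat_algebra) mps"
  assumes F: "mcoeff F {#} = 0" and "mexp F = 1"
  shows "F = 0"
proof -
  let ?U = "fps_shift 1 fexp :: 'a fps"
  have "1 * fps_nth ?U 0 = 1"
    using rat_inverse [of "fact 1", where 'a = 'a] by (simp add: fexp_nth)
  then obtain U' where U': "?U * U' = 1" using fps_unit_ex by blast
  have "fexp = 1 + fps_X * ?U"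
    using fps_eq_const_add_X_shift [of "fexp :: 'a fps"] one_divide_fact_0 [where 'a = 'a]
    by (simp add: fexp_nth)
  then have "mexp F = 1 + F * mfps ?U F"
    unfolding mexp_eq_mfps by (metis F mfps_1 mfps_X mfps_add mfps_mult)
  then have "F * mfps ?U F = 0" using assms(2) by simp
  then have "F * (mfps ?U F * mfps U' F) = 0" by (simp flip: mult.assoc)
  then show ?thesis by (simp only: mfps_mult [OF F, symmetric] U' mfps_1 mult_1_right)
qed

lemma mexp_inj:
  fixes F :: "('v, 'a :: rat_algebra) mps"
  assumes "mcoeff F {#} = 0" "mcoeff G {#} = 0" "mexp F = mexp G"
  shows "F = G"
proof -
  have "mexp (F - G) = mexp G * mexp (- G)"
    using mexp_add [of F "- G"] assms by simp
  then have "F - G = 0"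
    by (intro mexp_eq_1_imp) (simp_all add: mexp_uminus assms)
  then show ?thesis by simp
qed

text \<open>Solves the triangular system for y(x(z)) = z: the new unknown in degree n + 1 has
  coefficient x'(0)^(n+1), which \<open>d ^ Suc n\<close> inverts.\<close>

fun fps_left_inv_coeff :: "'a :: comm_ring_1 fps \<Rightarrow> 'a \<Rightarrow> nat \<Rightarrow> 'a" where
  "fps_left_inv_coeff x d 0 = 0"
| "fps_left_inv_coeff x d (Suc n) = (fps_nth fps_X (Suc n)
     - (\<Sum>i = 0..n. fps_left_inv_coeff x d i * fps_nth (x ^ i) (Suc n))) * d ^ Suc n"

lemma fps_left_compose_inverse:
  fixes x :: "'a :: comm_ring_1 fps"
  assumes x0: "fps_nth x 0 = 0" and d: "d * fps_nth x 1 = 1"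
  shows "\<exists>y. fps_nth y 0 = 0 \<and> y oo x = fps_X"
proof (intro exI conjI)
  let ?y = "Abs_fps (fps_left_inv_coeff x d)"
  show "fps_nth ?y 0 = 0" by simp
  show "?y oo x = fps_X"
  proof (rule fps_ext)
    fix n
    show "fps_nth (?y oo x) n = fps_nth fps_X n"
    proof (cases n)
      case (Suc m)
      have "d ^ Suc m * fps_nth x (Suc 0) ^ Suc m = 1"
        using d by (simp only: power_mult_distrib [symmetric] One_nat_def power_one)
      then have "fps_left_inv_coeff x d n * fps_nth (x ^ n) n
          = fps_nth fps_X n - (\<Sum>i = 0..m. fps_left_inv_coeff x d i * fps_nth (x ^ i) n)"
        unfolding Suc startsby_zero_power_nth_same [OF x0]
        by (simp only: fps_left_inv_coeff.simps mult.assoc One_nat_def mult_1_right)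
      then show ?thesis
        by (simp add: fps_compose_nth Suc)
    qed simp
  qed
qed

lemma fps_compose_inverse:
  fixes x :: "'a :: idom fps"
  assumes x0: "fps_nth x 0 = 0" and d: "d * fps_nth x 1 = 1"
  obtains y where "fps_nth y 0 = 0" "fps_nth y 1 * fps_nth x 1 = 1" "y oo x = fps_X" "x oo y = fps_X"
proof -
  have nth1: "fps_nth (y oo x) 1 = fps_nth y 1 * fps_nth x 1" for y x :: "'a fps"
    by (simp add: fps_compose_nth)
  obtain y where y: "fps_nth y 0 = 0" "y oo x = fps_X"
    using fps_left_compose_inverse [OF assms] by blast
  have y1: "fps_nth y 1 * fps_nth x 1 = 1"
    using nth1 [of y x] y by simp
  then have "fps_nth x 1 * fps_nth y 1 = 1" by (simp add: mult.commute)
  then obtain z where z: "fps_nth z 0 = 0" "z oo y = fps_X"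
    using fps_left_compose_inverse [OF y(1)] by blast
  \<comment> \<open>A left inverse of the left inverse y must be x itself, so y is a two-sided
    inverse.\<close>
  have "z = z oo fps_X" by simp
  also have "\<dots> = (z oo y) oo x" unfolding y(2) [symmetric] by (rule fps_compose_assoc [OF x0 y(1)])
  also have "\<dots> = x" using x0 by (simp add: z)
  finally show thesis using that y y1 z by blast
qed

text \<open>
  The residue of \<open>x\<^sup>n\<^sup>-\<^sup>b\<^sup>-\<^sup>1 dx\<close>. Negative powers of \<open>x\<close> are written with \<open>J = fps_X / x\<close>.
\<close>

lemma fps_residue_power:
  fixes x :: "'a :: {idom, rat_algebra} fps"
  assumes x0: "fps_nth x 0 = 0" and J: "J * x = fps_X"
  shows "fps_nth (J ^ Suc b * x ^ n * fps_deriv x) b = (if n = b then 1 else 0)"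
proof -
  have deriv: "J * fps_deriv x = 1 - fps_deriv J * x"
    using arg_cong [OF J, of fps_deriv] by (simp add: algebra_simps)
  consider "n = b" | "n > b" | "n < b" by linarith
  then show ?thesis
  proof cases
    case 1
    \<comment> \<open>The logarithmic case: dx / x has residue 1.\<close>
    have *: "J ^ Suc b * x ^ n * fps_deriv x = fps_X ^ b * (J * fps_deriv x)"
      unfolding 1 J [symmetric] power_mult_distrib by (simp add: ac_simps)
    have "fps_nth (J * fps_deriv x) 0 = 1"
      using x0 by (simp add: deriv)
    then show ?thesis using 1 unfolding * by (simp add: fps_X_power_mult_nth)
  next
    case 2
    then have "x ^ n = x ^ Suc b * x ^ (n - Suc b)"
      by (simp flip: power_add del: power_Suc)
    then have *: "J ^ Suc b * x ^ n * fps_deriv x = fps_X ^ Suc b * (x ^ (n - Suc b) * fps_deriv x)"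
      unfolding J [symmetric] power_mult_distrib by (simp add: ac_simps)
    show ?thesis using 2 unfolding * by (simp add: fps_X_power_mult_nth del: power_Suc)
  next
    \<comment> \<open>Here the form x^(-k-1) dx is, up to the factor -k, the derivative of x^(-k) =
      X^(-k) J^k, so it has no residue. Cleared of negative powers: coefficient k of k J^k - X
      (J^k)' is 0.\<close>
    case 3
    define k where "k = b - n"
    have k: "k > 0" "b = n + k" using 3 by (auto simp: k_def)
    have "J ^ Suc b * x ^ n * fps_deriv x = fps_X ^ n * (J ^ k * (J * fps_deriv x))"
      by (simp add: k ac_simps power_mult_distrib power_add flip: J)
    also have "J ^ k * (J * fps_deriv x) = J ^ k - fps_X * (J ^ (k - 1) * fps_deriv J)"
    proof -
      have "J ^ k = J * J ^ (k - 1)" using k(1) by (cases k) auto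
      then show ?thesis unfolding deriv by (simp add: algebra_simps flip: J)
    qed
    finally have *: "fps_nth (J ^ Suc b * x ^ n * fps_deriv x) b
        = fps_nth (J ^ k - fps_X * (J ^ (k - 1) * fps_deriv J)) k"
      by (simp add: k fps_X_power_mult_nth)
    have "of_nat k * (J ^ (k - 1) * fps_deriv J) = fps_deriv (J ^ k)"
      by (simp add: fps_deriv_power' ac_simps)
    then have "of_nat k * (J ^ k - fps_X * (J ^ (k - 1) * fps_deriv J))
        = of_nat k * J ^ k - fps_X * fps_deriv (J ^ k)"
      by (simp add: algebra_simps)
    then have "of_nat k * fps_nth (J ^ k - fps_X * (J ^ (k - 1) * fps_deriv J)) k
        = fps_nth (of_nat k * J ^ k - fps_X * fps_deriv (J ^ k)) k"
      by (metis fps_mult_of_nat_nth(1))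
    also have "\<dots> = of_nat k * 0"
      using k(1) by (simp add: fps_mult_of_nat_nth)
    finally show ?thesis
      using 3 rat_cancel [OF k(1)] unfolding * by (metis nat_neq_iff)
  qed
qed

lemma fps_nth_mult_compose:
  fixes x :: "'a :: comm_ring_1 fps"
  assumes "fps_nth x 0 = 0"
  shows "fps_nth (g * (f oo x)) b = (\<Sum>n = 0..b. fps_nth f n * fps_nth (g * x ^ n) b)"
proof -
  have nth: "fps_nth (f oo x) i = (\<Sum>n = 0..b. fps_nth f n * fps_nth (x ^ n) i)" if "i \<le> b" for i
    unfolding fps_compose_nth
    by (rule sum.mono_neutral_left)
      (use that startsby_zero_power_prefix [OF assms] in auto)
  have "fps_nth (g * (f oo x)) b
      = (\<Sum>i = 0..b. fps_nth g i * (\<Sum>n = 0..b. fps_nth f n * fps_nth (x ^ n) (b - i)))"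
    unfolding fps_mult_nth by (intro sum.cong refl) (simp add: nth)
  also have "\<dots> = (\<Sum>n = 0..b. \<Sum>i = 0..b. fps_nth f n * (fps_nth g i * fps_nth (x ^ n) (b - i)))"
    by (subst sum.swap) (simp add: sum_distrib_left ac_simps)
  finally show ?thesis by (simp add: fps_mult_nth sum_distrib_left)
qed

text \<open>Multiply (X / x)^(b+1) by 1 = y'(x) x' and expand y' in powers of x: by
  \<open>fps_residue_power\<close> only the b-th coefficient of y' contributes in degree b.\<close>

lemma fps_lagrange_inversion:
  fixes x :: "'a :: {idom, rat_algebra} fps"
  assumes x0: "fps_nth x 0 = 0" and J: "J * x = fps_X" and y: "y oo x = fps_X"
  shows "of_nat (Suc b) * fps_nth y (Suc b) = fps_nth (J ^ Suc b) b"
proof -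
  have "(fps_deriv y oo x) * fps_deriv x = 1"
    using arg_cong [OF y, of fps_deriv] by (simp add: fps_compose_deriv [OF x0])
  then have "J ^ Suc b = J ^ Suc b * ((fps_deriv y oo x) * fps_deriv x)"
    by (simp only: mult_1_right)
  then have "fps_nth (J ^ Suc b) b = fps_nth (J ^ Suc b * fps_deriv x * (fps_deriv y oo x)) b"
    by (simp only: mult.assoc mult.commute [of "fps_deriv x"])
  also have "\<dots> = (\<Sum>n = 0..b. fps_nth (fps_deriv y) n * fps_nth (J ^ Suc b * x ^ n * fps_deriv x) b)"
    unfolding fps_nth_mult_compose [OF x0] by (simp add: ac_simps)
  also have "\<dots> = of_nat (Suc b) * fps_nth y (Suc b)"
    unfolding fps_residue_power [OF x0 J] by (simp add: if_distrib sum.delta cong: if_cong)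
  finally show ?thesis ..
qed

section \<open>Divided differences\<close>

lemma msum_inj_range:
  assumes "inj h" "\<And>i. i \<notin> range h \<Longrightarrow> f i = 0"
  shows "msum f = msum (\<lambda>i. f (h i))"
proof (rule mps_eqI)
  fix m
  have "{i. mcoeff (f i) m \<noteq> 0} = h ` {j. mcoeff (f (h j)) m \<noteq> 0}"
  proof (intro set_eqI iffI)
    fix i assume i: "i \<in> {i. mcoeff (f i) m \<noteq> 0}"
    then have "i \<in> range h" using assms(2) [of i] by force
    with i show "i \<in> h ` {j. mcoeff (f (h j)) m \<noteq> 0}" by blast
  qed blast
  then show "mcoeff (msum f) m = mcoeff (msum (\<lambda>i. f (h i))) m"
    unfolding mcoeff_msum Sum_any.expand_set
    by (simp add: sum.reindex inj_on_subset [OF assms(1)])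
qed

lemma msum_Suc:
  assumes "f 0 = 0"
  shows "msum f = msum (\<lambda>n. f (Suc n))"
proof (rule msum_inj_range)
  show "f i = 0" if "i \<notin> range Suc" for i
    using that assms by (cases i) auto
qed simp

text \<open>Stands for (f(F) - f(G)) / (F - G). Written as a sum it needs no division and still
  makes sense on the diagonal F = G, where it is f'(F).\<close>

definition mdd :: "'a :: comm_ring_1 fps \<Rightarrow> ('v, 'a) mps \<Rightarrow> ('v, 'a) mps \<Rightarrow> ('v, 'a) mps" where
  "mdd f F G = msum (\<lambda>n. mconst (fps_nth f n) * (\<Sum>i<n. G ^ (n - Suc i) * F ^ i))"

lemma msummable_mdd:
  assumes "mcoeff F {#} = 0" "mcoeff G {#} = 0"
  shows "msummable (\<lambda>n. mconst (c n) * (\<Sum>i<n. G ^ (n - Suc i) * F ^ i))"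
proof (rule msummable_mult_family2)
  show "msummable (\<lambda>n. \<Sum>i<n. G ^ (n - Suc i) * F ^ i)"
    unfolding msummable_def
  proof
    fix m
    have "n \<le> Suc (size m)" if nz: "mcoeff (\<Sum>i<n. G ^ (n - Suc i) * F ^ i) m \<noteq> 0" for n
    proof -
      from nz obtain i where i: "i < n" "mcoeff (G ^ (n - Suc i) * F ^ i) m \<noteq> 0"
        unfolding mcoeff_sum by (auto elim: sum.not_neutral_contains_not_neutral)
      from mcoeff_mult_nonzero [OF i(2)] obtain a b where "a + b = m"
        "mcoeff (G ^ (n - Suc i)) a \<noteq> 0" "mcoeff (F ^ i) b \<noteq> 0" by auto
      then have "n - Suc i \<le> size a" "i \<le> size b" "size a + size b = size m"
        using mcoeff_power_nonzero_size assms by (auto simp flip: size_union)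
      then show ?thesis using i(1) by linarith
    qed
    then show "finite {n. mcoeff (\<Sum>i<n. G ^ (n - Suc i) * F ^ i) m \<noteq> 0}"
      by (auto intro: finite_subset [of _ "{..Suc (size m)}"])
  qed
qed

lemma diff_mult_mdd:
  assumes "mcoeff F {#} = 0" "mcoeff G {#} = 0"
  shows "(F - G) * mdd f F G = mfps f F - mfps f G"
proof -
  have "(F - G) * mdd f F G
      = msum (\<lambda>n. (F - G) * (mconst (fps_nth f n) * (\<Sum>i<n. G ^ (n - Suc i) * F ^ i)))"
    unfolding mdd_def by (intro msum_mult_left msummable_mdd assms)
  also have "\<dots> = msum (\<lambda>n. mconst (fps_nth f n) * F ^ n - mconst (fps_nth f n) * G ^ n)"
  proof (rule msum_cong)
    fix n
    have "(F - G) * (mconst (fps_nth f n) * (\<Sum>i<n. G ^ (n - Suc i) * F ^ i))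
        = mconst (fps_nth f n) * ((F - G) * (\<Sum>i<n. G ^ (n - Suc i) * F ^ i))"
      by (rule mult.left_commute)
    also have "\<dots> = mconst (fps_nth f n) * (F ^ n - G ^ n)"
      by (simp only: power_diff_sumr2)
    finally show "(F - G) * (mconst (fps_nth f n) * (\<Sum>i<n. G ^ (n - Suc i) * F ^ i))
        = mconst (fps_nth f n) * F ^ n - mconst (fps_nth f n) * G ^ n"
      by (simp add: right_diff_distrib)
  qed
  also have "\<dots> = mfps f F - mfps f G"
    unfolding mfps_def by (intro msum_diff msummable_mfps assms)
  finally show ?thesis .
qed

lemma mdd_commute: "mdd f F G = mdd f G F"
  unfolding mdd_def
proof (rule msum_cong)
  fix n
  have "(\<Sum>i<n. G ^ (n - Suc i) * F ^ i) = (\<Sum>i<n. G ^ (n - Suc (n - Suc i)) * F ^ (n - Suc i))"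
    by (rule sum.nat_diff_reindex [symmetric])
  also have "\<dots> = (\<Sum>i<n. F ^ (n - Suc i) * G ^ i)"
    by (intro sum.cong) (auto simp: mult.commute)
  finally show "mconst (fps_nth f n) * (\<Sum>i<n. G ^ (n - Suc i) * F ^ i)
      = mconst (fps_nth f n) * (\<Sum>i<n. F ^ (n - Suc i) * G ^ i)" by simp
qed

lemma mdd_self: "mdd f F F = mfps (fps_deriv f) F"
proof -
  have "mdd f F F = msum (\<lambda>n. mconst (fps_nth f (Suc n)) * (\<Sum>i<Suc n. F ^ (Suc n - Suc i) * F ^ i))"
    unfolding mdd_def by (rule msum_Suc) simp
  also have "\<dots> = mfps (fps_deriv f) F"
    unfolding mfps_def
  proof (rule msum_cong)
    fix n
    have "(\<Sum>i<Suc n. F ^ (Suc n - Suc i) * F ^ i) = (\<Sum>i<Suc n. F ^ n)"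
      by (intro sum.cong refl) (simp flip: power_add)
    then show "mconst (fps_nth f (Suc n)) * (\<Sum>i<Suc n. F ^ (Suc n - Suc i) * F ^ i)
        = mconst (fps_nth (fps_deriv f) n) * F ^ n"
      by (simp add: mconst_mult mconst_of_nat mconst_add ac_simps del: sum.lessThan_Suc)
  qed
  finally show ?thesis .
qed

lemma mdd_0: "mdd f 0 G = mfps (fps_shift 1 f) G"
proof -
  have "mdd f 0 G = msum (\<lambda>n. mconst (fps_nth f (Suc n)) * (\<Sum>i<Suc n. G ^ (Suc n - Suc i) * 0 ^ i))"
    unfolding mdd_def by (rule msum_Suc) simp
  also have "\<dots> = mfps (fps_shift 1 f) G"
    unfolding mfps_def
  proof (rule msum_cong)
    fix n
    have "(\<Sum>i<Suc n. G ^ (Suc n - Suc i) * 0 ^ i) = (\<Sum>i<Suc n. if i = 0 then G ^ n else 0)"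
      by (intro sum.cong refl) (simp add: power_0_left)
    then show "mconst (fps_nth f (Suc n)) * (\<Sum>i<Suc n. G ^ (Suc n - Suc i) * 0 ^ i)
        = mconst (fps_nth (fps_shift 1 f) n) * G ^ n"
      by simp
  qed
  finally show ?thesis .
qed

lemma msubst_mdd:
  assumes "madm s" "mcoeff F {#} = 0" "mcoeff G {#} = 0"
  shows "msubst s (mdd f F G) = mdd f (msubst s F) (msubst s G)"
proof -
  have *: "msubst s (sum g {..<n}) = (\<Sum>i<n. msubst s (g i))" for g and n :: nat
    by (induction n) (auto simp: msubst_add assms)
  show ?thesis
    unfolding mdd_def
    by (subst msubst_msum) (auto simp: assms msubst_mult msubst_power msummable_mdd *)
qed

lemma mcoeff_mdd_empty:
  assumes "mcoeff F {#} = 0" "mcoeff G {#} = 0"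
  shows "mcoeff (mdd f F G) {#} = fps_nth f 1"
proof -
  have nz: "n = 1" if "mcoeff (mconst (fps_nth f n) * (\<Sum>i<n. G ^ (n - Suc i) * F ^ i)) {#} \<noteq> 0" for n
  proof (rule ccontr)
    assume "n \<noteq> 1"
    then have "mcoeff (\<Sum>i<n. G ^ (n - Suc i) * F ^ i) {#} = 0"
      using assms by (auto simp: power_0_left intro!: sum.neutral)
    then show False using that by simp
  qed
  have "mcoeff (mdd f F G) {#} = mcoeff (mconst (fps_nth f 1) * (\<Sum>i<1. G ^ (1 - Suc i) * F ^ i)) {#}"
    unfolding mdd_def by (rule mcoeff_msum_single [OF nz])
  then show ?thesis by (simp add: mcoeff_mconst)
qed

section \<open>Bilinear series\<close>

definition mbil :: "(nat \<Rightarrow> nat \<Rightarrow> 'a) \<Rightarrow> (nat \<Rightarrow> ('v, 'a :: comm_ring_1) mps) \<Rightarrow> (nat \<Rightarrow> ('v, 'a) mps)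
    \<Rightarrow> ('v, 'a) mps" where
  "mbil c s t = msum (\<lambda>(i, j). mconst (c i j) * s i * t j)"

lemma msummable_mbil:
  assumes "msummable s" "msummable t"
  shows "msummable (\<lambda>(i, j). mconst (c i j) * s i * t j)"
proof -
  have "msummable (\<lambda>p. mconst (c (fst p) (snd p)) * (case p of (i, j) \<Rightarrow> s i * t j))"
    by (intro msummable_mult_family2 msummable_prod assms)
  then show ?thesis by (simp add: case_prod_unfold mult.assoc)
qed

lemma msubst_mbil:
  assumes "madm \<sigma>" "msummable s" "msummable t"
  shows "msubst \<sigma> (mbil c s t) = mbil c (\<lambda>i. msubst \<sigma> (s i)) (\<lambda>i. msubst \<sigma> (t i))"
  unfolding mbil_def
  by (subst msubst_msum(1) [OF assms(1) msummable_mbil [OF assms(2,3)]])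
    (auto simp: case_prod_unfold msubst_mult assms)

lemma mbil_add_left:
  assumes "msummable s" "msummable s'" "msummable t"
  shows "mbil c (\<lambda>i. s i + s' i) t = mbil c s t + mbil c s' t"
  unfolding mbil_def
  by (subst msum_add [symmetric, OF msummable_mbil msummable_mbil])
    (auto simp: assms case_prod_unfold algebra_simps)

lemma mbil_add_right:
  assumes "msummable s" "msummable t" "msummable t'"
  shows "mbil c s (\<lambda>i. t i + t' i) = mbil c s t + mbil c s t'"
  unfolding mbil_def
  by (subst msum_add [symmetric, OF msummable_mbil msummable_mbil])
    (auto simp: assms case_prod_unfold algebra_simps)

lemma mbil_uminus_left: "mbil c (\<lambda>i. - s i) t = - mbil c s t"
  unfolding mbil_def by (subst msum_uminus [symmetric]) (auto simp: case_prod_unfold)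

lemma mbil_uminus_right: "mbil c s (\<lambda>i. - t i) = - mbil c s t"
  unfolding mbil_def by (subst msum_uminus [symmetric]) (auto simp: case_prod_unfold)

lemma mbil_transpose: "mbil c s t = mbil (\<lambda>i j. c j i) t s"
proof -
  have "mbil c s t = msum (\<lambda>p. case prod.swap p of (i, j) \<Rightarrow> mconst (c i j) * s i * t j)"
    unfolding mbil_def by (rule msum_bij [symmetric]) simp
  then show ?thesis by (simp add: mbil_def case_prod_unfold ac_simps)
qed

lemma mbil_add_coeff:
  assumes "msummable s" "msummable t"
  shows "mbil (\<lambda>i j. c i j + d i j) s t = mbil c s t + mbil d s t"
  unfolding mbil_def
  by (subst msum_add [symmetric, OF msummable_mbil msummable_mbil])
    (auto simp: assms case_prod_unfold algebra_simps mconst_add)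

lemma msummable_power_Suc: "mcoeff F {#} = 0 \<Longrightarrow> msummable (\<lambda>n. F ^ Suc n)"
  using msummable_inj [OF msummable_power, of F Suc] by simp

text \<open>Polarizes the quadratic function with coefficients \<open>c\<close>, at the points \<open>p\<^sub>k = F\<^sup>k\<close> and \<open>p\<^sub>k = G\<^sup>k\<close>.\<close>

definition bil :: "(nat \<Rightarrow> nat \<Rightarrow> 'a) \<Rightarrow> ('v, 'a :: comm_ring_1) mps \<Rightarrow> ('v, 'a) mps \<Rightarrow> ('v, 'a) mps" where
  "bil c F G = mbil (\<lambda>i j. c i j + c j i) (\<lambda>i. F ^ Suc i) (\<lambda>i. G ^ Suc i)"

lemma msubst_bil:
  assumes "madm \<sigma>" "mcoeff F {#} = 0" "mcoeff G {#} = 0"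
  shows "msubst \<sigma> (bil c F G) = bil c (msubst \<sigma> F) (msubst \<sigma> G)"
  unfolding bil_def
  by (subst msubst_mbil)
    (simp_all add: assms msummable_power_Suc msubst_mult msubst_power del: power_Suc)

lemma mcoeff_mbil_empty:
  assumes "\<And>i. mcoeff (s i) {#} = 0"
  shows "mcoeff (mbil c s t) {#} = 0"
  unfolding mbil_def mcoeff_msum by (simp add: case_prod_unfold assms)

lemma mcoeff_bil_empty: "mcoeff F {#} = 0 \<Longrightarrow> mcoeff (bil c F G) {#} = 0"
  unfolding bil_def by (rule mcoeff_mbil_empty) simp

section \<open>Two variables\<close>

definition mon2 :: "nat \<Rightarrow> nat \<Rightarrow> bool multiset" where
  "mon2 i j = replicate_mset i False + replicate_mset j True"

lemma mon2_cases: obtains i j where "m = mon2 i j"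
proof
  show "m = mon2 (count m False) (count m True)"
    by (rule multiset_eqI) (case_tac x; simp add: mon2_def)
qed

lemma mon2_inject [simp]: "mon2 i j = mon2 k l \<longleftrightarrow> i = k \<and> j = l"
proof
  assume eq: "mon2 i j = mon2 k l"
  show "i = k \<and> j = l"
    using arg_cong [OF eq, of "\<lambda>m. count m False"] arg_cong [OF eq, of "\<lambda>m. count m True"]
    by (simp add: mon2_def)
qed simp

lemma mps2_eqI: "(\<And>i j. mcoeff F (mon2 i j) = mcoeff G (mon2 i j)) \<Longrightarrow> F = G"
  by (metis mon2_cases mps_eqI)

lemma mmono_mon2: "mmono (mon2 i j) = mvar False ^ i * mvar True ^ j"
  by (simp add: mon2_def mmono_add mvar_power_eq_mmono)

lemma mcoeff_mvar_mult:
  "mcoeff (mvar v * F) m = (if v \<in># m then mcoeff F (m - {#v#}) else 0)"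
  by (simp add: mvar_eq_mmono mcoeff_mmono_mult)

lemma mon2_Suc: "mon2 (Suc i) j = add_mset False (mon2 i j)" "mon2 i (Suc j) = add_mset True (mon2 i j)"
  by (simp_all add: mon2_def)

text \<open>The difference H satisfies v2 H = v1 H, so its coefficients are constant along
  antidiagonals, and they vanish on the edge where v1 is absent. This allows division by v2 -
  v1.\<close>

lemma diff_mvar_cancel:
  fixes F G :: "(bool, 'a :: comm_ring_1) mps"
  assumes "(mvar True - mvar False) * F = (mvar True - mvar False) * G"
  shows "F = G"
proof -
  define H where "H = F - G"
  have H: "mvar True * H = mvar False * H"
    using assms by (simp add: H_def algebra_simps)
  have "mcoeff H (mon2 i j) = 0" for i j
  proof (induction i arbitrary: j)
    case 0
    show ?case
      using arg_cong [OF H, of "\<lambda>F. mcoeff F (mon2 0 (Suc j))"]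
      by (simp add: mcoeff_mvar_mult mon2_Suc) (simp add: mon2_def)
  next
    case (Suc i)
    have "mcoeff H (mon2 (Suc i) j) = mcoeff H (mon2 i (Suc j))"
      using arg_cong [OF H, of "\<lambda>F. mcoeff F (mon2 (Suc i) (Suc j))"]
      by (simp add: mcoeff_mvar_mult mon2_Suc)
    then show ?case using Suc by simp
  qed
  then have "H = 0" by (intro mps2_eqI) simp
  then show ?thesis by (simp add: H_def)
qed

lemma prod_mset_mmono: "(\<Prod>v\<in>#M. mmono (\<mu> v)) = mmono (\<Sum>v\<in>#M. \<mu> v)"
  by (induction M) (auto simp: mmono_add)

text \<open>Injectivity on monomials means that no two terms of F collide after the
  substitution.\<close>

lemma mcoeff_msubst_mmono:
  assumes "inj (\<lambda>M. \<Sum>v\<in>#M. \<mu> v)"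
  shows "mcoeff (msubst (\<lambda>v. mmono (\<mu> v)) F) (\<Sum>v\<in>#M. \<mu> v) = mcoeff F M"
proof -
  have "mcoeff (msubst (\<lambda>v. mmono (\<mu> v)) F) (\<Sum>v\<in>#M. \<mu> v)
      = mcoeff (mconst (mcoeff F M) * (\<Prod>v\<in>#M. mmono (\<mu> v))) (\<Sum>v\<in>#M. \<mu> v)"
    unfolding msubst_def
    by (rule mcoeff_msum_single)
      (use injD [OF assms] in \<open>auto simp: prod_mset_mmono mcoeff_mmono split: if_splits\<close>)
  then show ?thesis by (simp add: prod_mset_mmono mcoeff_mmono)
qed

lemma mcoeff_msubst_mmono_notin:
  assumes "\<And>M. m \<noteq> (\<Sum>v\<in>#M. \<mu> v)"
  shows "mcoeff (msubst (\<lambda>v. mmono (\<mu> v)) F) m = 0"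
  unfolding msubst_def mcoeff_msum using assms by (simp add: prod_mset_mmono mcoeff_mmono)

text \<open>Pure terms must be absent because the variables p_k start at k = 1, so a bilinear form
  in the points p_k = u^k and p_k = v^k has none.\<close>

lemma mps2_eq_mbil:
  fixes S :: "(bool, 'a :: comm_ring_1) mps"
  assumes "\<And>i. mcoeff S (mon2 i 0) = 0" "\<And>j. mcoeff S (mon2 0 j) = 0"
  shows "S = mbil (\<lambda>i j. mcoeff S (mon2 (Suc i) (Suc j)))
    (\<lambda>i. mvar False ^ Suc i) (\<lambda>j. mvar True ^ Suc j)"
    (is "S = mbil ?c ?s ?t")
proof (rule mps2_eqI)
  fix i j
  have *: "mbil ?c ?s ?t = msum (\<lambda>(i, j). mconst (?c i j) * mmono (mon2 (Suc i) (Suc j)))"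
    unfolding mbil_def mmono_mon2 by (simp add: mult.assoc)
  show "mcoeff S (mon2 i j) = mcoeff (mbil ?c ?s ?t) (mon2 i j)"
  proof (cases "i = 0 \<or> j = 0")
    case True
    then have "mcoeff (mbil ?c ?s ?t) (mon2 i j) = 0"
      unfolding * mcoeff_msum by (auto simp: case_prod_unfold mcoeff_mmono)
    then show ?thesis using True assms by auto
  next
    case False
    then obtain k l where kl: "i = Suc k" "j = Suc l" by (metis not0_implies_Suc)
    have "mcoeff (mbil ?c ?s ?t) (mon2 i j)
        = mcoeff (case (k, l) of (i, j) \<Rightarrow> mconst (?c i j) * mmono (mon2 (Suc i) (Suc j))) (mon2 i j)"
      unfolding * by (rule mcoeff_msum_single) (auto simp: mcoeff_mmono kl split: if_splits)
    then show ?thesis by (simp add: mcoeff_mmono kl)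
  qed
qed

section \<open>Compatible quadratic functions\<close>

lemma fps_X_mult_shift: "fps_nth x 0 = 0 \<Longrightarrow> fps_X * fps_shift 1 x = (x :: 'a :: comm_ring_1 fps)"
  using fps_eq_const_add_X_shift [of x] by simp

lemma fps_X_mult_cancel: "fps_X * f = fps_X * g \<Longrightarrow> f = (g :: 'a :: comm_ring_1 fps)"
proof (rule fps_ext)
  fix n assume eq: "fps_X * f = fps_X * g"
  show "fps_nth f n = fps_nth g n"
    using arg_cong [OF eq, of "\<lambda>f. fps_nth f (Suc n)"] by simp
qed

lemma fps_shift_compose:
  fixes x y :: "'a :: idom fps"
  assumes "fps_nth x 0 = 0" "fps_nth y 0 = 0" "x oo y = fps_X"
  shows "(fps_shift 1 x oo y) * fps_shift 1 y = 1"
proof (rule fps_X_mult_cancel)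
  have "fps_X * ((fps_shift 1 x oo y) * fps_shift 1 y) = y * (fps_shift 1 x oo y)"
    using fps_X_mult_shift [OF assms(2)] by (metis mult.commute mult.left_commute)
  also have "\<dots> = (fps_X * fps_shift 1 x) oo y"
    using assms(2) by (simp add: fps_compose_mult_distrib)
  also have "\<dots> = fps_X"
    by (simp only: fps_X_mult_shift [OF assms(1)] assms(3))
  finally show "fps_X * ((fps_shift 1 x oo y) * fps_shift 1 y) = fps_X * 1" by simp
qed

text \<open>
  With \<open>u\<close>, \<open>v\<close> for the two variables, \<open>bil c (x u) (x v)\<close> is required to be the logarithm of
  \<open>x'(0) u v (x(v) - x(u)) / (x(u) x(v) (v - u))\<close>.
\<close>

definition compatible :: "'a :: {idom, rat_algebra} fps \<Rightarrow> (nat \<Rightarrow> nat \<Rightarrow> 'a) \<Rightarrow> bool" where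
  "compatible x c \<longleftrightarrow>
    mexp (bil c (mfps x (mvar False)) (mfps x (mvar True)))
      * (mfps (fps_shift 1 x) (mvar False) * mfps (fps_shift 1 x) (mvar True))
    = mconst (fps_nth x 1) * mdd x (mvar True) (mvar False)"

lemma mcoeff_mvar_empty [simp]: "mcoeff (mvar v) {#} = 0"
  by (simp add: mcoeff_mvar)

lemma madm_bool: "mcoeff F {#} = 0 \<Longrightarrow> mcoeff G {#} = 0 \<Longrightarrow> madm (\<lambda>v :: bool. if v then G else F)"
  by (rule madm_finite) auto

text \<open>Used at three pairs of points: at y(u) and y(v) for the inverse coordinate, at t u and u
  for the linear terms, and on the diagonal for the Jacobian.\<close>

lemma compatible_at:
  assumes c: "compatible x c" and x0: "fps_nth x 0 = 0"
    and F: "mcoeff F {#} = 0" and G: "mcoeff G {#} = 0"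
  shows "mexp (bil c (mfps x F) (mfps x G)) * (mfps (fps_shift 1 x) F * mfps (fps_shift 1 x) G)
    = mconst (fps_nth x 1) * mdd x G F"
proof -
  let ?s = "\<lambda>v :: bool. if v then G else F"
  have s: "madm ?s" by (rule madm_bool [OF F G])
  show ?thesis
    using arg_cong [OF c [unfolded compatible_def], of "msubst ?s"]
    by (simp add: s msubst_mult msubst_mexp msubst_bil msubst_mfps msubst_mdd mcoeff_bil_empty x0)
qed

text \<open>The chain rule for divided differences, applied to y(x(u)) = u.\<close>

lemma mdd_compose_inverse:
  assumes "fps_nth x 0 = 0" "y oo x = fps_X"
  shows "mdd x (mvar True) (mvar False)
    * mdd y (mfps x (mvar True)) (mfps x (mvar False)) = (1 :: (bool, 'a :: {idom, rat_algebra}) mps)"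
proof (rule diff_mvar_cancel)
  let ?a = "mvar False :: (bool, 'a) mps" and ?b = "mvar True :: (bool, 'a) mps"
  have "(?b - ?a) * (mdd x ?b ?a * mdd y (mfps x ?b) (mfps x ?a))
      = ((?b - ?a) * mdd x ?b ?a) * mdd y (mfps x ?b) (mfps x ?a)"
    by (simp only: mult.assoc)
  also have "\<dots> = mfps y (mfps x ?b) - mfps y (mfps x ?a)"
    using assms(1) by (simp add: diff_mult_mdd)
  also have "\<dots> = ?b - ?a"
    by (simp add: assms flip: mfps_compose)
  finally show "(?b - ?a) * (mdd x ?b ?a * mdd y (mfps x ?b) (mfps x ?a)) = (?b - ?a) * 1"
    by simp
qed

lemma unit_mult_cancel: "u * w = 1 \<Longrightarrow> u * f = u * g \<Longrightarrow> f = (g :: 'b :: comm_ring_1)"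
  by (metis mult.assoc mult.commute mult_1_right)

lemma mconst_unit: "a * b = 1 \<Longrightarrow> mconst a * mconst b = 1"
  by (metis mconst_1 mconst_mult)

text \<open>At the points y(u) and y(v) the divided difference of x and the factors x(u) / u turn
  into the reciprocals of those of y, so the required logarithm changes sign. The condition on c'
  says that its polar form is the transported negative of that of c.\<close>

lemma compatible_inverse:
  assumes x0: "fps_nth x 0 = 0" and y0: "fps_nth y 0 = 0"
    and xy: "x oo y = fps_X" and yx: "y oo x = fps_X" and y1: "fps_nth y 1 * fps_nth x 1 = 1"
    and c: "compatible x c"
    and c': "bil c' (mfps y (mvar False)) (mfps y (mvar True)) = - bil c (mvar False) (mvar True)"
  shows "compatible y c'"
proof -
  let ?a = "mvar False" and ?b = "mvar True"
  let ?X = "\<lambda>F :: (bool, 'a) mps. mfps (fps_shift 1 x) (mfps y F)"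
  let ?Y = "\<lambda>F :: (bool, 'a) mps. mfps (fps_shift 1 y) F"
  have XY: "?X F * ?Y F = 1" if "mcoeff F {#} = 0" for F
    using fps_shift_compose [OF x0 y0 xy] that y0
    by (simp flip: mfps_compose mfps_mult)
  have main: "mexp (bil c ?a ?b) * (?X ?a * ?X ?b)
      = mconst (fps_nth x 1) * mdd x (mfps y ?b) (mfps y ?a)"
  proof -
    have "mfps x (mfps y F) = F" if "mcoeff F {#} = 0" for F :: "(bool, 'a) mps"
      using that y0 by (simp add: xy flip: mfps_compose)
    then show ?thesis
      using compatible_at [OF c x0, of "mfps y ?a" "mfps y ?b"] y0 by simp
  qed
  let ?D = "mdd y ?b ?a" and ?D' = "mdd x (mfps y ?b) (mfps y ?a)"
  let ?E = "mexp (bil c ?a ?b)" and ?E' = "mexp (- bil c ?a ?b)"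
  have DD: "?D * ?D' = 1" by (rule mdd_compose_inverse [OF y0 xy])
  have EE: "?E * ?E' = 1" by (rule mexp_uminus) (simp add: mcoeff_bil_empty)
  have "?E * (mconst (fps_nth y 1) * ?D)
      = (?E * (?X ?a * ?X ?b)) * (?Y ?a * ?Y ?b) * (mconst (fps_nth y 1) * ?D)"
    using XY [of ?a] XY [of ?b] by (simp add: algebra_simps)
  also have "\<dots> = (mconst (fps_nth y 1) * mconst (fps_nth x 1)) * (?D * ?D') * (?Y ?a * ?Y ?b)"
    unfolding main by (simp only: ac_simps)
  also have "\<dots> = ?E * (?E' * (?Y ?a * ?Y ?b))"
    unfolding DD mconst_unit [OF y1] using EE by (simp flip: mult.assoc)
  finally have "mconst (fps_nth y 1) * ?D = ?E' * (?Y ?a * ?Y ?b)"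
    by (rule unit_mult_cancel [OF EE])
  then show ?thesis
    unfolding compatible_def c' by simp
qed

lemma mcoeff_mon2_swap: "mcoeff (msubst (\<lambda>v. mvar (\<not> v)) S) (mon2 j i) = mcoeff S (mon2 i j)"
proof -
  have sum: "(\<Sum>v\<in>#M. {# \<not> v #}) = image_mset Not M" for M
    by (induction M) auto
  have inj: "inj (\<lambda>M. \<Sum>v\<in>#M. {# \<not> v #})"
    unfolding sum
  proof (rule inj_on_inverseI)
    show "image_mset Not (image_mset Not M) = M" for M
      by (simp add: image_mset.compositionality comp_def)
  qed
  have "image_mset Not (mon2 i j) = mon2 j i"
    by (simp add: mon2_def add.commute)
  then show ?thesis
    using mcoeff_msubst_mmono [OF inj, of S "mon2 i j"] by (simp add: sum mvar_eq_mmono)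
qed

lemma mcoeff_mon2_left:
  fixes S :: "(bool, 'a :: comm_ring_1) mps"
  shows "mcoeff (msubst (\<lambda>v. if v then 0 else mvar False) S) (mon2 i 0) = mcoeff S (mon2 i 0)"
proof -
  let ?s = "\<lambda>v :: bool. if v then 0 else mvar False :: (bool, 'a) mps"
  have s: "(\<Prod>v\<in>#mon2 k l. ?s v) = (if l = 0 then mmono (mon2 k 0) else 0)" for k l
    by (simp add: mon2_def image_mset_union power_0_left flip: mvar_power_eq_mmono)
  have "mcoeff (msubst ?s S) (mon2 i 0)
      = mcoeff (mconst (mcoeff S (mon2 i 0)) * (\<Prod>v\<in>#mon2 i 0. ?s v)) (mon2 i 0)"
    unfolding msubst_def
  proof (rule mcoeff_msum_single)
    fix M :: "bool multiset"
    obtain k l where M: "M = mon2 k l" by (rule mon2_cases)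
    show "M = mon2 i 0" if "mcoeff (mconst (mcoeff S M) * (\<Prod>v\<in>#M. ?s v)) (mon2 i 0) \<noteq> 0"
      using that unfolding M by (auto simp: s mcoeff_mmono split: if_splits)
  qed
  then show ?thesis by (simp add: s mcoeff_mmono)
qed

lemma compatible_exists:
  fixes x :: "'a :: {idom, rat_algebra} fps"
  assumes x0: "fps_nth x 0 = 0" and d: "d * fps_nth x 1 = 1"
  shows "\<exists>c. compatible x c"
proof -
  obtain y where y0: "fps_nth y 0 = 0" and y1: "fps_nth y 1 * fps_nth x 1 = 1"
    and yx: "y oo x = fps_X" and xy: "x oo y = fps_X"
    using fps_compose_inverse [OF x0 d] by blast
  let ?a = "mvar False :: (bool, 'a) mps" and ?b = "mvar True :: (bool, 'a) mps"
  have "fps_nth x 1 * fps_nth (fps_shift 1 y) 0 = 1"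
    using y1 by (simp add: mult.commute)
  then obtain K where K: "fps_shift 1 y * K = 1" using fps_unit_ex by blast
  have K0: "fps_nth y 1 * fps_nth K 0 = 1"
    using arg_cong [OF K, of "\<lambda>f. fps_nth f 0"] by simp
  \<comment> \<open>The bilinear form is evaluated at x(u) and x(v), so the required exponential is
    rewritten in these as coordinates. W is its reciprocal: the divided difference of x becomes that
    of y, inverted, and x(u) / u becomes K.\<close>
  define W where "W = mconst (fps_nth y 1) * mdd y ?b ?a * (mfps K ?a * mfps K ?b)"
  have W1: "mcoeff W {#} = 1"
    unfolding W_def using K0
    by (simp add: mcoeff_mdd_empty mcoeff_mconst)
      (metis mult.assoc mult.commute mult_1_right)
  define S where "S = - mlog W"
  have S0: "mcoeff S {#} = 0" using W1 by (simp add: S_def mcoeff_mlog_empty)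
  have SW: "mexp S * W = 1"
    using mexp_uminus [of "mlog W"] W1 by (simp add: S_def mcoeff_mlog_empty mexp_mlog mult.commute)
  have sym: "msubst (\<lambda>v. mvar (\<not> v)) S = S"
  proof -
    have adm: "madm (\<lambda>v. mvar (\<not> v) :: (bool, 'a) mps)" by (rule madm_finite) auto
    have "msubst (\<lambda>v. mvar (\<not> v)) W = W"
      unfolding W_def
      by (simp add: adm msubst_mult msubst_mdd msubst_mfps mdd_commute [of y ?a ?b] mult.commute)
    then show ?thesis unfolding S_def by (simp add: msubst_uminus msubst_mlog adm W1)
  qed
  have S_sym: "mcoeff S (mon2 i j) = mcoeff S (mon2 j i)" for i j
    using mcoeff_mon2_swap [of S i j] sym by simp
  \<comment> \<open>Setting the second variable to 0 reduces the divided difference of y to y(a) /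
    a, which K(a) cancels; the constants y'(0) and K(0) cancel as well, so W becomes 1.\<close>
  have S_left: "mcoeff S (mon2 i 0) = 0" for i
  proof -
    let ?s = "\<lambda>v :: bool. if v then 0 else ?a"
    have adm: "madm ?s" by (rule madm_finite) auto
    have K': "mfps K 0 = mconst (fps_nth K 0)"
      unfolding mfps_def by (subst msum_single [of 0]) (auto simp: power_0_left)
    have "msubst ?s W = (mconst (fps_nth y 1) * mconst (fps_nth K 0))
        * (mfps (fps_shift 1 y) ?a * mfps K ?a)"
      unfolding W_def by (simp add: adm msubst_mult msubst_mdd msubst_mfps mdd_0 K' ac_simps)
    also have "\<dots> = 1"
      by (simp only: mconst_unit [OF K0] mfps_mult [OF mcoeff_mvar_empty, symmetric] K mfps_1 mult_1)
    finally have "msubst ?s S = 0"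
      by (simp add: S_def msubst_uminus msubst_mlog adm W1)
    then show ?thesis using mcoeff_mon2_left [of S i] by simp
  qed
  \<comment> \<open>The factor 1/2 compensates the symmetrization in \<open>bil\<close>.\<close>
  define c where "c i j = (1 / of_nat 2) * mcoeff S (mon2 (Suc i) (Suc j))" for i j
  have "c i j + c j i = mcoeff S (mon2 (Suc i) (Suc j))" for i j
  proof -
    have "c j i = c i j" unfolding c_def using S_sym [of "Suc j" "Suc i"] by (rule arg_cong)
    then have "c i j + c j i = of_nat 2 * c i j" by simp
    also have "\<dots> = (of_nat 2 * (1 / of_nat 2)) * mcoeff S (mon2 (Suc i) (Suc j))"
      unfolding c_def by (rule mult.assoc [symmetric])
    also have "\<dots> = 1 * mcoeff S (mon2 (Suc i) (Suc j))"
      by (rule arg_cong [OF rat_inverse]) simp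
    finally show ?thesis by (simp only: mult_1)
  qed
  then have S: "S = bil c ?a ?b"
    unfolding bil_def using mps2_eq_mbil [of S] S_left S_sym by simp
  have "compatible x c"
  proof -
    let ?xa = "mfps x ?a" and ?xb = "mfps x ?b"
    let ?s = "\<lambda>v :: bool. if v then ?xb else ?xa"
    let ?X = "\<lambda>F :: (bool, 'a) mps. mfps (fps_shift 1 x) F"
    have adm: "madm ?s" using x0 by (intro madm_bool) auto
    have Kx: "mfps K (mfps x F) = ?X F" if F: "mcoeff F {#} = 0" for F
    proof -
      have "(fps_shift 1 y oo x) * fps_shift 1 x = 1" by (rule fps_shift_compose [OF y0 x0 yx])
      moreover have "(fps_shift 1 y oo x) * (K oo x) = 1"
        using fps_compose_mult_distrib [OF x0, of "fps_shift 1 y" K] K by simp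
      ultimately have "K oo x = fps_shift 1 x"
        using unit_mult_cancel by metis
      then show ?thesis using F x0 by (metis mfps_compose)
    qed
    have "msubst ?s (mexp S * W) = mexp (bil c ?xa ?xb)
        * (mconst (fps_nth y 1) * mdd y ?xb ?xa * (?X ?a * ?X ?b))"
      unfolding S W_def
      using x0 by (simp add: adm msubst_mult msubst_mdd msubst_mfps msubst_mexp msubst_bil
          mcoeff_bil_empty Kx)
    then have 1: "mexp (bil c ?xa ?xb)
        * (mconst (fps_nth y 1) * mdd y ?xb ?xa * (?X ?a * ?X ?b)) = 1"
      by (simp add: SW)
    have "mexp (bil c ?xa ?xb) * (?X ?a * ?X ?b)
        = mexp (bil c ?xa ?xb) * (?X ?a * ?X ?b)
          * (mconst (fps_nth y 1) * mconst (fps_nth x 1)) * (mdd x ?b ?a * mdd y ?xb ?xa)"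
      by (simp only: mconst_unit [OF y1] mdd_compose_inverse [OF x0 yx] mult_1_right)
    also have "\<dots> = (mexp (bil c ?xa ?xb)
        * (mconst (fps_nth y 1) * mdd y ?xb ?xa * (?X ?a * ?X ?b)))
        * (mconst (fps_nth x 1) * mdd x ?b ?a)"
      by (simp only: ac_simps)
    finally show ?thesis unfolding compatible_def 1 by simp
  qed
  then show ?thesis by blast
qed

section \<open>The Hirota identity in rescaled variables\<close>

definition msupported :: "'v set \<Rightarrow> ('v, 'a :: zero) mps \<Rightarrow> bool" where
  "msupported S F \<longleftrightarrow> (\<forall>m. mcoeff F m \<noteq> 0 \<longrightarrow> set_mset m \<subseteq> S)"

lemma msupported_mult: "msupported S F \<Longrightarrow> msupported S G \<Longrightarrow> msupported S (F * G)"
  unfolding msupported_def by (fastforce dest!: mcoeff_mult_nonzero)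

lemma msupported_mconst [simp]: "msupported S (mconst c)"
  by (auto simp: msupported_def mcoeff_mconst)

lemma msupported_1 [simp]: "msupported S (1 :: ('v, 'a :: comm_ring_1) mps)"
  by (auto simp: msupported_def mcoeff_one)

lemma msupported_mvar: "v \<in> S \<Longrightarrow> msupported S (mvar v)"
  by (auto simp: msupported_def mcoeff_mvar)

lemma msupported_diff:
  fixes F G :: "('v, 'a :: comm_ring_1) mps"
  shows "msupported S F \<Longrightarrow> msupported S G \<Longrightarrow> msupported S (F - G)"
  unfolding msupported_def by (metis diff_self mcoeff_diff)

lemma msupported_add:
  fixes F G :: "('v, 'a :: comm_ring_1) mps"
  shows "msupported S F \<Longrightarrow> msupported S G \<Longrightarrow> msupported S (F + G)"
  unfolding msupported_def by (metis add_0 mcoeff_add)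

lemma msupported_power: "msupported S F \<Longrightarrow> msupported S (F ^ n)"
  by (induction n) (simp_all add: msupported_mult)

lemma msupported_msum: "(\<And>i. msupported S (f i)) \<Longrightarrow> msupported S (msum f)"
  unfolding msupported_def mcoeff_msum by (blast elim: Sum_any.not_neutral_obtains_not_neutral)

lemma msupported_mexp: "msupported S F \<Longrightarrow> msupported S (mexp F)"
  unfolding mexp_def by (intro msupported_msum msupported_mult msupported_mconst msupported_power)

lemma msupported_msubst:
  assumes "\<And>v. msupported S (s v)"
  shows "msupported S (msubst s F)"
proof -
  have "msupported S (\<Prod>v\<in>#M. s v)" for M
    by (induction M) (simp_all add: msupported_mult assms)
  then show ?thesis
    unfolding msubst_def by (intro msupported_msum msupported_mult msupported_mconst)
qed

fun kp_weight :: "kp_var \<Rightarrow> nat" where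
  "kp_weight (P i) = Suc i"
| "kp_weight (P' i) = Suc i"
| "kp_weight Z = 0"
| "kp_weight Zinv = 0"

text \<open>
  Chosen such that \<open>Zinv ^ Suc i * P i\<close> and \<open>Zinv ^ Suc i * P' i\<close> have degree 0.
\<close>

definition kp_degree :: "kp_var multiset \<Rightarrow> int" where
  "kp_degree m = int (count m Zinv) - int (\<Sum>v\<in>#m. kp_weight v)"

lemma kp_degree_add: "kp_degree (m + n) = kp_degree m + kp_degree n"
  by (simp add: kp_degree_def)

definition kp_linear :: "(kp_var, 'a :: rat_algebra) mps" where
  "kp_linear = msum (\<lambda>i. mconst (1 / of_nat (Suc i)) * (mvar (P i) - mvar (P' i)))"

definition hirota_rescaled :: "(nat, 'a :: rat_algebra) mps \<Rightarrow> (kp_var, 'a) mps" where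
  "hirota_rescaled \<tau> = mexp kp_linear
    * (msubst (\<lambda>i. mvar Zinv ^ Suc i * (mvar (P i) - 1)) \<tau>
      * msubst (\<lambda>i. mvar Zinv ^ Suc i * (mvar (P' i) + 1)) \<tau>)"

text \<open>Absence of a residue, the power of \<open>z\<^sup>-\<^sup>1\<close> being \<open>kp_degree\<close> after rescaling.\<close>

definition residue_free :: "(kp_var, 'a :: zero) mps \<Rightarrow> bool" where
  "residue_free G \<longleftrightarrow> (\<forall>m. Z \<notin># m \<longrightarrow> kp_degree m = 1 \<longrightarrow> mcoeff G m = 0)"

section \<open>Comparison of the original and the rescaled Hirota product\<close>

lemma inj_P: "inj P" and inj_P': "inj P'"
  by (auto simp: inj_def)

lemma msummable_P_diff:
  "msummable (\<lambda>i. mvar (P i) - mvar (P' i) :: (kp_var, 'a :: comm_ring_1) mps)"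
  by (intro msummable_diff msummable_mvar_inj inj_P inj_P')

lemma msummable_kp_linear:
  "msummable (\<lambda>i. mconst (c i) * (mvar (P i) - mvar (P' i)) :: (kp_var, 'a :: comm_ring_1) mps)"
  by (intro msummable_mult_family2 msummable_P_diff)

lemma madm_mult_left: "madm s \<Longrightarrow> madm (\<lambda>v. s v * f v)"
  by (auto simp: madm_def intro: msummable_mult_family)

lemma madm_power_Suc: "mcoeff F {#} = 0 \<Longrightarrow> madm (\<lambda>i. F ^ Suc i * f i)"
  by (intro madm_mult_left madmI msummable_power_Suc) auto

lemma mcoeff_msum_empty: "(\<And>i. mcoeff (f i) {#} = 0) \<Longrightarrow> mcoeff (msum f) {#} = 0"
  by (simp add: mcoeff_msum)

lemma mcoeff_kp_linear_empty: "mcoeff kp_linear {#} = 0"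
  unfolding kp_linear_def by (rule mcoeff_msum_empty) simp

text \<open>Attaches to each p_k the power u^k. With u = \<open>Zinv\<close> this is the rescaling;
  with u = \<open>Z\<close> it restores the powers of z in the prefactor. Both products thus arise
  from the same factors.\<close>

definition kp_scale :: "kp_var \<Rightarrow> kp_var \<Rightarrow> kp_var multiset" where
  "kp_scale u v = add_mset v (replicate_mset (kp_weight v) u)"

lemma replicate_mset_add: "replicate_mset (m + n) x = replicate_mset m x + replicate_mset n x"
  by (induction m) auto

lemma sum_kp_scale: "(\<Sum>v\<in>#M. kp_scale u v) = M + replicate_mset (\<Sum>v\<in>#M. kp_weight v) u"
  by (induction M) (auto simp: kp_scale_def replicate_mset_add ac_simps)

lemma weight_replicate: "kp_weight u = 0 \<Longrightarrow> (\<Sum>v\<in>#replicate_mset n u. kp_weight v) = 0"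
  by (induction n) auto

text \<open>As u has weight 0, the weight of the image is that of M; it tells which power of u has
  to be removed to recover M.\<close>

lemma inj_kp_scale:
  assumes "kp_weight u = 0"
  shows "inj (\<lambda>M. \<Sum>v\<in>#M. kp_scale u v)"
proof (rule injI)
  fix M N
  let ?W = "\<lambda>M. \<Sum>v\<in>#M. kp_weight v"
  assume eq: "(\<Sum>v\<in>#M. kp_scale u v) = (\<Sum>v\<in>#N. kp_scale u v)"
  have "?W (\<Sum>v\<in>#M. kp_scale u v) = ?W M" for M
    unfolding sum_kp_scale by (simp only: image_mset_union sum_mset.union weight_replicate [OF assms] add_0_right)
  then have "?W M = ?W N" using eq by metis
  then show "M = N" using eq by (simp add: sum_kp_scale)
qed

lemma mmono_kp_scale: "mmono (kp_scale u v) = mvar v * mvar u ^ kp_weight v"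
  unfolding kp_scale_def by (simp add: mvar_eq_mmono [of v] mvar_power_eq_mmono flip: mmono_add)

lemmas mmono_kp_scale_simps =
  mmono_kp_scale [of _ "P i" for i, unfolded kp_weight.simps]
  mmono_kp_scale [of _ "P' i" for i, unfolded kp_weight.simps]
  mmono_kp_scale [of _ Zinv, unfolded kp_weight.simps power_0 mult_1_right]

lemma madm_kp_scale: "madm (\<lambda>v. mmono (kp_scale u v))"
  unfolding mmono_kp_scale by (intro madm_mult_left madm_mvar)

lemma hirota_product_eq:
  fixes \<tau> :: "(nat, 'a :: rat_algebra) mps"
  shows "hirota_product \<tau> = msubst (\<lambda>v. mmono (kp_scale Z v)) (mexp kp_linear)
    * (msubst (\<lambda>i. mvar (P i) - mvar Zinv ^ Suc i) \<tau> * msubst (\<lambda>i. mvar (P' i) + mvar Zinv ^ Suc i) \<tau>)"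
proof -
  have "msubst (\<lambda>v. mmono (kp_scale Z v)) kp_linear
      = (msum (\<lambda>i. mconst (1 / of_nat (Suc i)) * (mvar (P i) - mvar (P' i)) * mvar Z ^ Suc i)
        :: (kp_var, 'a) mps)"
    unfolding kp_linear_def
    by (subst msubst_msum(1) [OF madm_kp_scale msummable_kp_linear], rule msum_cong)
      (simp add: msubst_mult msubst_diff madm_kp_scale mmono_kp_scale_simps algebra_simps
        del: of_nat_Suc power_Suc)
  then show ?thesis
    unfolding hirota_product_def
    by (subst msubst_mexp) (simp_all add: madm_kp_scale mcoeff_kp_linear_empty mult.assoc)
qed

lemma madm_shift_minus:
  "madm (\<lambda>i. mvar (P i) - mvar Zinv ^ Suc i :: (kp_var, 'a :: comm_ring_1) mps)"
  by (intro madmI msummable_diff msummable_mvar_inj inj_P msummable_power_Suc) auto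

lemma madm_shift_plus:
  "madm (\<lambda>i. mvar (P' i) + mvar Zinv ^ Suc i :: (kp_var, 'a :: comm_ring_1) mps)"
  by (intro madmI msummable_add msummable_mvar_inj inj_P' msummable_power_Suc) auto

lemma hirota_rescaled_eq:
  "hirota_rescaled \<tau> = mexp kp_linear * msubst (\<lambda>v. mmono (kp_scale Zinv v))
    (msubst (\<lambda>i. mvar (P i) - mvar Zinv ^ Suc i) \<tau> * msubst (\<lambda>i. mvar (P' i) + mvar Zinv ^ Suc i) \<tau>)"
  unfolding hirota_rescaled_def msubst_mult [OF madm_kp_scale]
    msubst_msubst [OF madm_kp_scale madm_shift_minus] msubst_msubst [OF madm_kp_scale madm_shift_plus]
  by (simp add: msubst_diff msubst_add msubst_power msubst_mult madm_kp_scale mmono_kp_scale_simps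
      algebra_simps)

definition kp_vars :: "kp_var set" where
  "kp_vars = range P \<union> range P'"

text \<open>No variable of r can come from F, so the whole of r goes to the second factor.\<close>

lemma mcoeff_mult_supported:
  assumes F: "msupported S F" and m: "set_mset m \<subseteq> S" and r: "set_mset r \<inter> S = {}"
  shows "mcoeff (F * G) (m + r) = (\<Sum>p\<in>{(a, b). a + b = m}. mcoeff F (fst p) * mcoeff G (snd p + r))"
proof -
  let ?h = "\<lambda>p. (fst p, snd p + r)"
  have sub: "?h ` {(a, b). a + b = m} \<subseteq> {(a, b). a + b = m + r}"
    by (auto simp: add.assoc)
  have out: "mcoeff F a * mcoeff G b = 0"
    if ab: "a + b = m + r" "(a, b) \<notin> ?h ` {(a, b). a + b = m}" for a b
  proof (rule ccontr)
    assume "mcoeff F a * mcoeff G b \<noteq> 0"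
    then have "mcoeff F a \<noteq> 0" by auto
    then have a: "set_mset a \<subseteq> S" using F by (auto simp: msupported_def)
    have am: "a \<subseteq># m"
    proof (rule mset_subset_eqI)
      fix v
      show "count a v \<le> count m v"
      proof (cases "v \<in># a")
        case True
        then have "v \<notin># r" using a r by auto
        then have "count a v + count b v = count m v"
          using arg_cong [OF ab(1), of "\<lambda>m. count m v"] by (simp add: not_in_iff)
        then show ?thesis by simp
      qed (simp add: not_in_iff)
    qed
    then obtain c where c: "m = a + c" by (auto simp: mset_subset_eq_exists_conv)
    with ab(1) have "b = c + r" by (simp add: add.assoc)
    with c ab(2) show False by (auto intro: image_eqI [of _ _ "(a, c)"])
  qed
  have "mcoeff (F * G) (m + r) = (\<Sum>(a, b)\<in>?h ` {(a, b). a + b = m}. mcoeff F a * mcoeff G b)"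
    unfolding mcoeff_mult
    by (rule sum.mono_neutral_right [OF finite_msplit sub]) (use out in auto)
  also have "\<dots> = (\<Sum>p\<in>{(a, b). a + b = m}. mcoeff F (fst p) * mcoeff G (snd p + r))"
    by (subst sum.reindex) (auto simp: inj_on_def)
  finally show ?thesis .
qed

lemma msupported_kp_linear: "msupported kp_vars (kp_linear :: (kp_var, 'a :: rat_algebra) mps)"
  unfolding kp_linear_def
  by (intro msupported_msum msupported_mult msupported_diff msupported_mvar msupported_mconst)
    (auto simp: kp_vars_def)

text \<open>A term c of the prefactor carries z^(W c); this fixes n = W c and demands
  \<open>Zinv\<close> to the power W c + 1 from the tau factors. The cofactor d gains W d more from
  the rescaling, so the exponent is W m + 1 for every splitting m = c + d, and the sum over n
  collapses.\<close>

lemma hirota_coeff_eq: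
  fixes \<tau> :: "(nat, 'a :: rat_algebra) mps"
  defines "W \<equiv> \<lambda>m. \<Sum>v\<in>#m. kp_weight v"
  assumes m: "m = image_mset P a + image_mset P' b"
  shows "hirota_coeff \<tau> a b = mcoeff (hirota_rescaled \<tau>) (m + replicate_mset (Suc (W m)) Zinv)"
proof -
  define E :: "(kp_var, 'a) mps" where "E = mexp kp_linear"
  define T where "T = msubst (\<lambda>i. mvar (P i) - mvar Zinv ^ Suc i) \<tau>
      * msubst (\<lambda>i. mvar (P' i) + mvar Zinv ^ Suc i) \<tau>"
  let ?EZ = "msubst (\<lambda>v. mmono (kp_scale Z v)) E"
  let ?TZ = "msubst (\<lambda>v. mmono (kp_scale Zinv v)) T"
  have mP: "set_mset m \<subseteq> kp_vars" by (auto simp: m kp_vars_def)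
  have sE: "msupported kp_vars E"
    unfolding E_def by (rule msupported_mexp [OF msupported_kp_linear])
  have sT: "msupported (- {Z}) T"
    unfolding T_def
    by (intro msupported_mult msupported_msubst msupported_diff msupported_add msupported_power
        msupported_mvar) auto
  have cEZ: "mcoeff ?EZ (M + replicate_mset (W M) Z) = mcoeff E M" for M
    using mcoeff_msubst_mmono [OF inj_kp_scale [of Z], of E M] by (simp add: sum_kp_scale W_def)
  have cTZ: "mcoeff ?TZ (M + replicate_mset (W M) Zinv) = mcoeff T M" for M
    using mcoeff_msubst_mmono [OF inj_kp_scale [of Zinv], of T M] by (simp add: sum_kp_scale W_def)
  have EZ_ex: "\<exists>M. c = M + replicate_mset (W M) Z" if "mcoeff ?EZ c \<noteq> 0" for c
    using mcoeff_msubst_mmono_notin [of c "kp_scale Z" E] that by (auto simp: sum_kp_scale W_def)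
  have W_add: "W (c + d) = W c + W d" for c d by (simp add: W_def)
  have W_rep: "W (replicate_mset k Zinv) = 0" for k
    unfolding W_def by (rule weight_replicate) simp
  let ?f = "\<lambda>p n. mcoeff E (fst p) * mcoeff T (snd p + replicate_mset (Suc n) Zinv)"
  let ?S = "{(c, d). c + d = m}"
  have prod_n: "mcoeff (?EZ * T) (m + replicate_mset n Z + replicate_mset (Suc n) Zinv)
      = (\<Sum>p\<in>?S. if W (fst p) = n then ?f p n else 0)" for n
  proof -
    let ?m = "m + replicate_mset n Z + replicate_mset (Suc n) Zinv"
    let ?A = "{p \<in> ?S. W (fst p) = n}"
    let ?h = "\<lambda>p. (fst p + replicate_mset n Z, snd p + replicate_mset (Suc n) Zinv)"
    have sub: "?h ` ?A \<subseteq> {(c, d). c + d = ?m}"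
      by (auto simp: ac_simps)
    have out: "mcoeff ?EZ c * mcoeff T d = 0"
      if cd: "c + d = ?m" "(c, d) \<notin> ?h ` ?A" for c d
    proof (rule ccontr)
      assume nz: "mcoeff ?EZ c * mcoeff T d \<noteq> 0"
      then have "mcoeff ?EZ c \<noteq> 0" by auto
      then obtain M where M: "c = M + replicate_mset (W M) Z" using EZ_ex by blast
      with nz have "mcoeff E M \<noteq> 0" using cEZ by auto
      then have MP: "set_mset M \<subseteq> kp_vars" using sE by (auto simp: msupported_def)
      have "mcoeff T d \<noteq> 0" using nz by auto
      then have d: "Z \<notin># d" using sT by (auto simp: msupported_def)
      have "count M Z = 0" "count m Z = 0"
        using MP mP by (auto simp: kp_vars_def not_in_iff [symmetric])
      then have n: "W M = n"
        using arg_cong [OF cd(1), of "\<lambda>m. count m Z"] d by (simp add: M not_in_iff)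
      then have "(M + d) + replicate_mset n Z = (m + replicate_mset (Suc n) Zinv) + replicate_mset n Z"
        using cd(1) M by (simp only: ac_simps)
      then have eq: "M + d = m + replicate_mset (Suc n) Zinv"
        by (simp only: add_right_cancel)
      have "M \<subseteq># m"
      proof (rule mset_subset_eqI)
        fix v
        show "count M v \<le> count m v"
        proof (cases "v \<in># M")
          case True
          then have "v \<noteq> Zinv" using MP by (auto simp: kp_vars_def)
          then have "count M v + count d v = count m v"
            using arg_cong [OF eq, of "\<lambda>m. count m v"] by simp
          then show ?thesis by simp
        qed (simp add: not_in_iff)
      qed
      then obtain q where q: "m = M + q" by (auto simp: mset_subset_eq_exists_conv)
      with eq have "d = q + replicate_mset (Suc n) Zinv"
        by (metis add_left_imp_eq union_assoc)
      with q n M cd(2) show False by (auto intro!: image_eqI [of _ _ "(M, q)"])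
    qed
    have "mcoeff (?EZ * T) ?m = (\<Sum>(c, d)\<in>?h ` ?A. mcoeff ?EZ c * mcoeff T d)"
      unfolding mcoeff_mult
      by (rule sum.mono_neutral_right [OF finite_msplit sub]) (use out in auto)
    also have "\<dots> = (\<Sum>p\<in>?A. ?f p n)"
      by (subst sum.reindex) (auto simp: inj_on_def simp flip: cEZ intro!: sum.cong)
    also have "\<dots> = (\<Sum>p\<in>?S. if W (fst p) = n then ?f p n else 0)"
      by (rule sum.inter_filter [OF finite_msplit])
    finally show ?thesis .
  qed
  have "hirota_product \<tau> = ?EZ * T"
    unfolding hirota_product_eq E_def T_def ..
  then have "hirota_coeff \<tau> a b = Sum_any (\<lambda>n. \<Sum>p\<in>?S. if W (fst p) = n then ?f p n else 0)"
    unfolding hirota_coeff_def m [symmetric] by (simp only: prod_n)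
  also have "\<dots> = (\<Sum>n\<in>(W \<circ> fst) ` ?S. \<Sum>p\<in>?S. if W (fst p) = n then ?f p n else 0)"
  proof (rule Sum_any.expand_superset)
    show "{n. (\<Sum>p\<in>?S. if W (fst p) = n then ?f p n else 0) \<noteq> 0} \<subseteq> (W \<circ> fst) ` ?S"
    proof
      fix n assume "n \<in> {n. (\<Sum>p\<in>?S. if W (fst p) = n then ?f p n else 0) \<noteq> 0}"
      then have "(\<Sum>p\<in>?S. if W (fst p) = n then ?f p n else 0) \<noteq> 0" by (rule CollectD)
      then obtain p where "p \<in> ?S" "(if W (fst p) = n then ?f p n else 0) \<noteq> 0"
        by (rule sum.not_neutral_contains_not_neutral)
      then show "n \<in> (W \<circ> fst) ` ?S"
        by (intro image_eqI [of _ _ p]) (auto split: if_splits)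
    qed
  qed (intro finite_imageI finite_msplit)
  also have "\<dots> = (\<Sum>p\<in>?S. \<Sum>n\<in>(W \<circ> fst) ` ?S. if W (fst p) = n then ?f p n else 0)"
    by (rule sum.swap)
  also have "\<dots> = (\<Sum>p\<in>?S. ?f p (W (fst p)))"
  proof (rule sum.cong [OF refl])
    fix p assume "p \<in> ?S"
    then have "W (fst p) \<in> (W \<circ> fst) ` ?S" by (metis comp_apply imageI)
    then show "(\<Sum>n\<in>(W \<circ> fst) ` ?S. if W (fst p) = n then ?f p n else 0) = ?f p (W (fst p))"
      using sum.delta' [OF finite_imageI [OF finite_msplit [of m], of "W \<circ> fst"], of "W (fst p)" "?f p"]
      by (simp only: if_True)
  qed
  also have "\<dots> = (\<Sum>p\<in>?S. mcoeff E (fst p) * mcoeff ?TZ (snd p + replicate_mset (Suc (W m)) Zinv))"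
  proof (rule sum.cong [OF refl])
    fix p assume "p \<in> ?S"
    then have p: "m = fst p + snd p" by auto
    let ?M = "snd p + replicate_mset (Suc (W (fst p))) Zinv"
    have "?M + replicate_mset (W ?M) Zinv = snd p + replicate_mset (Suc (W m)) Zinv"
      unfolding p W_add W_rep by (simp add: replicate_mset_add ac_simps)
    then show "?f p (W (fst p)) = mcoeff E (fst p) * mcoeff ?TZ (snd p + replicate_mset (Suc (W m)) Zinv)"
      using cTZ [of ?M] by (simp only:)
  qed
  also have "\<dots> = mcoeff (E * ?TZ) (m + replicate_mset (Suc (W m)) Zinv)"
    by (rule mcoeff_mult_supported [OF sE mP, symmetric]) (auto simp: kp_vars_def)
  finally show ?thesis unfolding hirota_rescaled_eq E_def T_def .
qed

lemma kp_multiset_cases: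
  "Z \<notin># m \<Longrightarrow> \<exists>a b k. m = image_mset P a + image_mset P' b + replicate_mset k Zinv"
proof (induction m)
  case empty
  show ?case by (intro exI [of _ "{#}"] exI [of _ 0]) simp
next
  case (add v m)
  then obtain a b k where m: "m = image_mset P a + image_mset P' b + replicate_mset k Zinv"
    by auto
  show ?case
  proof (cases v)
    case (P i)
    then show ?thesis by (intro exI [of _ "add_mset i a"] exI [of _ b] exI [of _ k]) (simp add: m)
  next
    case (P' i)
    then show ?thesis by (intro exI [of _ a] exI [of _ "add_mset i b"] exI [of _ k]) (simp add: m)
  next
    case Z
    then show ?thesis using add.prems by simp
  next
    case Zinv
    then show ?thesis by (intro exI [of _ a] exI [of _ b] exI [of _ "Suc k"]) (simp add: m)
  qed
qed

lemma kp_degree_P: "kp_degree (image_mset P a + image_mset P' b + replicate_mset k Zinv)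
    = int k - int (\<Sum>v\<in>#image_mset P a + image_mset P' b. kp_weight v)"
proof -
  have "count (image_mset P a) Zinv = 0" "count (image_mset P' b) Zinv = 0"
    by (auto simp: count_eq_zero_iff)
  then show ?thesis by (simp add: kp_degree_def)
qed

text \<open>The monomials of degree 1 without \<open>Z\<close> are precisely those in p and p' times
  \<open>Zinv\<close> to their weight plus one.\<close>

lemma hirota_iff_residue_free:
  "(\<forall>a b. hirota_coeff \<tau> a b = 0) \<longleftrightarrow> residue_free (hirota_rescaled \<tau>)"
proof
  assume L: "\<forall>a b. hirota_coeff \<tau> a b = 0"
  show "residue_free (hirota_rescaled \<tau>)"
    unfolding residue_free_def
  proof (intro allI impI)
    fix m assume "Z \<notin># m" and deg: "kp_degree m = 1"
    then obtain a b k where m: "m = image_mset P a + image_mset P' b + replicate_mset k Zinv"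
      using kp_multiset_cases by blast
    then have "k = Suc (\<Sum>v\<in>#image_mset P a + image_mset P' b. kp_weight v)"
      using deg [unfolded m kp_degree_P] by linarith
    then show "mcoeff (hirota_rescaled \<tau>) m = 0"
      using L hirota_coeff_eq [OF refl, of \<tau> a b] m by metis
  qed
next
  assume R: "residue_free (hirota_rescaled \<tau>)"
  show "\<forall>a b. hirota_coeff \<tau> a b = 0"
  proof (intro allI)
    fix a b
    show "hirota_coeff \<tau> a b = 0"
      unfolding hirota_coeff_eq [OF refl]
    proof (rule R [unfolded residue_free_def, rule_format])
      show "kp_degree (image_mset P a + image_mset P' b + replicate_mset
          (Suc (\<Sum>v\<in>#image_mset P a + image_mset P' b. kp_weight v)) Zinv) = 1"
        unfolding kp_degree_P by linarith
    qed auto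
  qed
qed

section \<open>Homogeneous series\<close>

definition kp_homog :: "int \<Rightarrow> (kp_var, 'a :: zero) mps \<Rightarrow> bool" where
  "kp_homog d F \<longleftrightarrow> (\<forall>m. mcoeff F m \<noteq> 0 \<longrightarrow> kp_degree m = d)"

lemma kp_homog_mult: "kp_homog d F \<Longrightarrow> kp_homog e G \<Longrightarrow> kp_homog (d + e) (F * G)"
  unfolding kp_homog_def by (fastforce dest!: mcoeff_mult_nonzero simp: kp_degree_add)

lemma kp_homog_mult_0: "kp_homog 0 F \<Longrightarrow> kp_homog 0 G \<Longrightarrow> kp_homog 0 (F * G)"
  using kp_homog_mult [of 0 F 0 G] by simp

lemma kp_homog_add:
  fixes F G :: "(kp_var, 'a :: comm_ring_1) mps"
  shows "kp_homog d F \<Longrightarrow> kp_homog d G \<Longrightarrow> kp_homog d (F + G)"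
  unfolding kp_homog_def by (metis add_0 mcoeff_add)

lemma kp_homog_diff:
  fixes F G :: "(kp_var, 'a :: comm_ring_1) mps"
  shows "kp_homog d F \<Longrightarrow> kp_homog d G \<Longrightarrow> kp_homog d (F - G)"
  unfolding kp_homog_def by (metis diff_self mcoeff_diff)

lemma kp_homog_msum: "(\<And>i. kp_homog d (f i)) \<Longrightarrow> kp_homog d (msum f)"
  unfolding kp_homog_def mcoeff_msum by (blast elim: Sum_any.not_neutral_obtains_not_neutral)

lemma kp_homog_mconst: "kp_homog 0 (mconst c)"
  by (auto simp: kp_homog_def mcoeff_mconst kp_degree_def)

lemma kp_homog_mmono: "kp_homog (kp_degree m) (mmono m)"
  by (simp add: kp_homog_def mcoeff_mmono)

lemma kp_homog_1: "kp_homog 0 (1 :: (kp_var, 'a :: comm_ring_1) mps)"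
  using kp_homog_mconst [of "1 :: 'a"] by simp

lemma kp_homog_power: "kp_homog 0 F \<Longrightarrow> kp_homog 0 (F ^ n)"
  by (induction n) (simp_all add: kp_homog_mult_0 kp_homog_1)

lemma kp_homog_mexp: "kp_homog 0 F \<Longrightarrow> kp_homog 0 (mexp F)"
  unfolding mexp_def by (intro kp_homog_msum kp_homog_mult_0 kp_homog_mconst kp_homog_power)

text \<open>In the unscaled variables a series of degree 0 contains no power of z, so it multiplies
  the coefficient of each power of z separately.\<close>

lemma residue_free_mult:
  fixes F G :: "(kp_var, 'a :: comm_ring_1) mps"
  assumes "kp_homog 0 F" "residue_free G"
  shows "residue_free (F * G)"
  unfolding residue_free_def
proof (intro allI impI, rule ccontr)
  fix m assume m: "Z \<notin># m" "kp_degree m = 1" "mcoeff (F * G) m \<noteq> 0"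
  from mcoeff_mult_nonzero [OF m(3)] obtain a b
    where "a + b = m" "mcoeff F a \<noteq> 0" "mcoeff G b \<noteq> 0" by auto
  then show False
    using m(1,2) assms kp_degree_add [of a b] by (auto simp: kp_homog_def residue_free_def)
qed

lemma mcoeff_mfps_mvar_nonzero:
  assumes "mcoeff (mfps f (mvar v)) m \<noteq> 0"
  shows "\<exists>k. m = replicate_mset k v \<and> fps_nth f k \<noteq> 0"
proof -
  from assms have "Sum_any (\<lambda>n. mcoeff (mconst (fps_nth f n) * mvar v ^ n) m) \<noteq> 0"
    unfolding mfps_def mcoeff_msum .
  then obtain k where "mcoeff (mconst (fps_nth f k) * mvar v ^ k) m \<noteq> 0"
    by (rule Sum_any.not_neutral_obtains_not_neutral)
  then show ?thesis
    by (intro exI [of _ k]) (auto simp: mvar_power_eq_mmono mcoeff_mmono split: if_splits)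
qed

lemma kp_degree_replicate_Zinv: "kp_degree (replicate_mset k Zinv) = int k"
  unfolding kp_degree_def weight_replicate [of Zinv k, simplified] by simp

section \<open>Linear parts\<close>

text \<open>In the unscaled variables, where p_k absorbs the k-th power of \<open>Zinv\<close>, this
  is the linear form with coefficients f_k, free of the spectral parameter.\<close>

definition kp_lin :: "'a :: comm_ring_1 fps \<Rightarrow> (nat \<Rightarrow> kp_var) \<Rightarrow> (kp_var, 'a) mps" where
  "kp_lin f \<phi> = msum (\<lambda>k. mconst (fps_nth f (Suc k)) * (mvar (\<phi> k) * mvar Zinv ^ Suc k))"

text \<open>
  On series in \<open>t\<close> and \<open>u\<close>, the variables \<open>False\<close> and \<open>True\<close>: picks the terms with a positive
  power of \<open>t\<close> and replaces \<open>t ^ Suc k\<close> by \<open>\<phi> k\<close> and \<open>u\<close> by \<open>Zinv\<close>.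
\<close>

definition kp_row :: "(nat \<Rightarrow> kp_var) \<Rightarrow> bool multiset \<Rightarrow> (kp_var, 'a :: comm_ring_1) mps" where
  "kp_row \<phi> M = (if count M False = 0 then 0
     else mvar (\<phi> (count M False - 1)) * mvar Zinv ^ count M True)"

lemma kp_row_mon2:
  "kp_row \<phi> (mon2 0 n) = 0"
  "kp_row \<phi> (mon2 (Suc k) n) = mvar (\<phi> k) * mvar Zinv ^ n"
  by (simp_all add: kp_row_def mon2_def)

lemma msummable_kp_row:
  assumes "inj \<phi>"
  shows "msummable (kp_row \<phi> :: _ \<Rightarrow> (kp_var, 'a :: comm_ring_1) mps)"
  unfolding msummable_def
proof
  fix m
  have "{M. mcoeff (kp_row \<phi> M :: (kp_var, 'a) mps) m \<noteq> 0}
      \<subseteq> (\<lambda>v. mon2 (Suc (inv \<phi> v)) (size m - 1)) ` set_mset m"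
  proof
    fix M assume M: "M \<in> {M. mcoeff (kp_row \<phi> M :: (kp_var, 'a) mps) m \<noteq> 0}"
    obtain i n where Mi: "M = mon2 i n" by (rule mon2_cases)
    with M obtain k where k: "i = Suc k" by (cases i) (auto simp: kp_row_mon2)
    have "mvar (\<phi> k) * mvar Zinv ^ n = (mmono ({#\<phi> k#} + replicate_mset n Zinv) :: (kp_var, 'a) mps)"
      by (simp only: mmono_add mvar_power_eq_mmono mvar_eq_mmono [of "\<phi> k"])
    then have "m = {#\<phi> k#} + replicate_mset n Zinv"
      using M by (simp add: Mi k kp_row_mon2 mcoeff_mmono split: if_splits)
    then show "M \<in> (\<lambda>v. mon2 (Suc (inv \<phi> v)) (size m - 1)) ` set_mset m"
      by (intro image_eqI [of _ _ "\<phi> k"]) (auto simp: Mi k inv_f_f [OF assms])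
  qed
  then show "finite {M. mcoeff (kp_row \<phi> M :: (kp_var, 'a) mps) m \<noteq> 0}"
    by (rule finite_subset) simp
qed

context
  fixes \<phi> :: "nat \<Rightarrow> kp_var"
  assumes inj: "inj \<phi>"
begin

text \<open>Although \<open>kp_row\<close> is not multiplicative, it treats series in u as scalars;
  only the power of t is interpreted as an index.\<close>

lemma mlin_kp_row_mult_mfps:
  "mlin (kp_row \<phi>) (F * mfps f (mvar True)) = mlin (kp_row \<phi>) F * mfps f (mvar Zinv)"
proof -
  note row = msummable_kp_row [OF inj]
  have power: "mlin (kp_row \<phi>) (F * mvar True ^ n) = mlin (kp_row \<phi>) F * mvar Zinv ^ n" for n
    unfolding mvar_power_eq_mmono [of True]
  proof (rule mlin_mult_mmono [OF row])
    fix M :: "bool multiset"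
    have "count (M + replicate_mset n True) False = count M False"
      "count (M + replicate_mset n True) True = count M True + n" by simp_all
    then show "kp_row \<phi> (M + replicate_mset n True) = kp_row \<phi> M * mvar Zinv ^ n"
      unfolding kp_row_def
      by (cases "count M False = 0") (simp_all only: power_add mult.assoc mult_zero_left simp_thms if_True if_False)
  qed
  have sum: "msummable (\<lambda>n. mconst (fps_nth f n) * (F * mvar True ^ n))"
    by (intro msummable_mult_family2 msummable_power) simp
  have "F * mfps f (mvar True) = msum (\<lambda>n. mconst (fps_nth f n) * (F * mvar True ^ n))"
    unfolding mfps_def
    by (subst msum_mult_left) (auto simp: mult.left_commute intro: msummable_mfps)
  then have "mlin (kp_row \<phi>) (F * mfps f (mvar True))
      = msum (\<lambda>n. mconst (fps_nth f n) * (mlin (kp_row \<phi>) F * mvar Zinv ^ n))"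
    by (simp only: mlin_msum [OF row sum] mlin_mconst_mult [OF row] power)
  also have "\<dots> = msum (\<lambda>n. mlin (kp_row \<phi>) F * (mconst (fps_nth f n) * mvar Zinv ^ n))"
    by (intro msum_cong mult.left_commute)
  also have "\<dots> = mlin (kp_row \<phi>) F * mfps f (mvar Zinv)"
    unfolding mfps_def by (intro msum_mult_left [symmetric] msummable_mfps) simp
  finally show ?thesis .
qed

lemma mlin_kp_row_mfps: "mlin (kp_row \<phi>) (mfps f (mvar False * mvar True)) = kp_lin f \<phi>"
proof -
  note row = msummable_kp_row [OF inj]
  have power: "mlin (kp_row \<phi>) ((mvar False * mvar True) ^ n)
      = (if n = 0 then 0 else mvar (\<phi> (n - 1)) * mvar Zinv ^ n :: (kp_var, 'a :: comm_ring_1) mps)" for n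
    unfolding power_mult_distrib mmono_mon2 [symmetric] mlin_mmono
    by (cases n) (simp_all add: kp_row_mon2)
  have sum: "msummable (\<lambda>n. mconst (fps_nth f n) * (mvar False * mvar True) ^ n :: (bool, 'a :: comm_ring_1) mps)" for f
    by (intro msummable_mfps) simp
  have "mlin (kp_row \<phi>) (mfps f (mvar False * mvar True))
      = msum (\<lambda>n. mconst (fps_nth f n) * (if n = 0 then 0 else mvar (\<phi> (n - 1)) * mvar Zinv ^ n))"
    unfolding mfps_def by (simp add: mlin_msum [OF row sum] mlin_mconst_mult [OF row] power)
  also have "\<dots> = kp_lin f \<phi>"
    unfolding kp_lin_def by (subst msum_Suc) (simp_all del: power_Suc)
  finally show ?thesis .
qed

lemma mlin_kp_row_mfps_False:
  "mlin (kp_row \<phi>) (mfps f (mvar False)) = msum (\<lambda>k. mconst (fps_nth f (Suc k)) * mvar (\<phi> k))"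
proof -
  note row = msummable_kp_row [OF inj]
  have power: "mlin (kp_row \<phi>) (mvar False ^ n)
      = (if n = 0 then 0 else mvar (\<phi> (n - 1)) :: (kp_var, 'a :: comm_ring_1) mps)" for n
    using mlin_mmono [of "kp_row \<phi> :: _ \<Rightarrow> (kp_var, 'a) mps" "mon2 n 0"]
    by (cases n) (simp_all add: kp_row_mon2 mmono_mon2)
  have sum: "msummable (\<lambda>n. mconst (fps_nth f n) * mvar False ^ n :: (bool, 'a :: comm_ring_1) mps)" for f
    by (intro msummable_mfps) simp
  have "mlin (kp_row \<phi>) (mfps f (mvar False))
      = msum (\<lambda>n. mconst (fps_nth f n) * (if n = 0 then 0 else mvar (\<phi> (n - 1))))"
    unfolding mfps_def by (simp add: mlin_msum [OF row sum] mlin_mconst_mult [OF row] power)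
  also have "\<dots> = msum (\<lambda>k. mconst (fps_nth f (Suc k)) * mvar (\<phi> k))"
    by (subst msum_Suc) simp_all
  finally show ?thesis .
qed

lemma msummable_kp_lin: "msummable (\<lambda>k. mconst (c k) * (mvar (\<phi> k) * mvar Zinv ^ Suc k) :: (kp_var, 'a :: comm_ring_1) mps)"
  by (intro msummable_mult_family2 msummable_mult_family msummable_mvar_inj inj)

end

lemma kp_homog_kp_lin:
  assumes "\<And>k. kp_weight (\<phi> k) = Suc k"
  shows "kp_homog 0 (kp_lin f \<phi>)"
  unfolding kp_lin_def
proof (rule kp_homog_msum, rule kp_homog_mult_0 [OF kp_homog_mconst])
  fix k
  have "\<phi> k \<noteq> Zinv" using assms [of k] by auto
  then have "kp_degree ({#\<phi> k#} + replicate_mset (Suc k) Zinv) = 0"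
    unfolding kp_degree_add kp_degree_replicate_Zinv by (simp add: kp_degree_def assms)
  then show "kp_homog 0 (mvar (\<phi> k) * mvar Zinv ^ Suc k)"
    using kp_homog_mmono [of "{#\<phi> k#} + replicate_mset (Suc k) Zinv"]
    by (simp only: mmono_add mvar_power_eq_mmono mvar_eq_mmono [of "\<phi> k"])
qed

section \<open>The change of the spectral parameter\<close>

text \<open>J is u / x(u). Negative powers of x are expressed through J and negative powers of u,
  and the latter are always moved to the other side.\<close>

locale coordinate =
  fixes x J :: "'a :: {idom, rat_algebra} fps"
  assumes x0: "fps_nth x 0 = 0" and shift_J: "fps_shift 1 x * J = 1"
begin

text \<open>
  With \<open>t\<close>, \<open>u\<close> for the variables \<open>False\<close> and \<open>True\<close>, \<open>ratio\<close> is \<open>x(t u) / x(u)\<close>. The coefficient of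
  \<open>t\<^sup>k\<close> in its \<open>b\<close>-th power is \<open>c\<^sub>k\<^sup>b u\<^sup>k / x(u)\<^sup>b\<close>, as is needed for the change of
  variables between the two rescalings.
\<close>

definition ratio :: "(bool, 'a) mps" where
  "ratio = mvar False * (mfps (fps_shift 1 x) (mvar False * mvar True) * mfps J (mvar True))"

text \<open>The old rescaled variables in terms of the new ones, with spectral parameter v = x(u).
  \<open>Z\<close> is sent to 0 since \<open>residue_free\<close> says nothing about monomials
  containing it.\<close>

fun \<theta> :: "kp_var \<Rightarrow> (kp_var, 'a) mps" where
  "\<theta> (P b) = mlin (kp_row P) (ratio ^ Suc b)"
| "\<theta> (P' b) = mlin (kp_row P') (ratio ^ Suc b)"
| "\<theta> Zinv = mfps x (mvar Zinv)"
| "\<theta> Z = 0"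

lemma J_x: "J * x = fps_X"
proof -
  have "J * x = J * (fps_X * fps_shift 1 x)"
    by (simp only: fps_X_mult_shift [OF x0])
  also have "\<dots> = fps_X * (fps_shift 1 x * J)"
    by (simp only: ac_simps)
  finally show ?thesis by (simp only: shift_J mult_1_right)
qed

lemma ratio_empty [simp]: "mcoeff ratio {#} = 0"
  by (simp add: ratio_def)

text \<open>Since u times \<open>ratio\<close> is x(t u) J(u), multiplication by u^(b+1) splits the
  image of a variable into a factor of degree 0 and a power of J.\<close>

lemma mvar_power_mlin_ratio:
  assumes "inj \<phi>"
  shows "mvar Zinv ^ Suc b * mlin (kp_row \<phi>) (ratio ^ Suc b)
    = kp_lin (x ^ Suc b) \<phi> * mfps J (mvar Zinv) ^ Suc b"
proof -
  let ?t = "mvar False :: (bool, 'a) mps" and ?u = "mvar True :: (bool, 'a) mps"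
  have "?u * ratio = mfps x (?t * ?u) * mfps J ?u"
  proof -
    have "mfps x (?t * ?u) = (?t * ?u) * mfps (fps_shift 1 x) (?t * ?u)"
      by (subst fps_X_mult_shift [OF x0, symmetric], subst mfps_mult) simp_all
    then show ?thesis by (simp add: ratio_def ac_simps)
  qed
  then have "ratio ^ Suc b * ?u ^ Suc b = (mfps x (?t * ?u) * mfps J ?u) ^ Suc b"
    by (simp only: power_mult_distrib [symmetric] mult.commute)
  also have "\<dots> = mfps (x ^ Suc b) (?t * ?u) * mfps (J ^ Suc b) ?u"
    by (simp add: mfps_power power_mult_distrib del: power_Suc)
  finally have "ratio ^ Suc b * mfps (fps_X ^ Suc b) ?u = mfps (x ^ Suc b) (?t * ?u) * mfps (J ^ Suc b) ?u"
    by (simp add: mfps_power del: power_Suc)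
  then have "mlin (kp_row \<phi>) (ratio ^ Suc b) * mfps (fps_X ^ Suc b) (mvar Zinv)
      = kp_lin (x ^ Suc b) \<phi> * mfps (J ^ Suc b) (mvar Zinv)"
    using mlin_kp_row_mult_mfps [OF assms] mlin_kp_row_mfps [OF assms] by metis
  then show ?thesis
    by (simp add: mfps_power mult.commute del: power_Suc)
qed

lemma mcoeff_mlin_kp_row_empty: "mcoeff (mlin (kp_row \<phi>) F) {#} = 0"
  unfolding mlin_def by (rule mcoeff_msum_empty) (simp add: kp_row_def)

lemma msummable_mlin_ratio: "inj \<phi> \<Longrightarrow> msummable (\<lambda>b. mlin (kp_row \<phi>) (ratio ^ Suc b))"
  by (intro mlin_msum(2) msummable_kp_row msummable_power_Suc) simp_all

lemma madm_\<theta>: "madm \<theta>"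
proof (rule madmI)
  show "mcoeff (\<theta> v) {#} = 0" for v
    by (cases v) (simp_all add: mcoeff_mlin_kp_row_empty x0 del: power_Suc)
  show "msummable \<theta>"
    unfolding msummable_def
  proof
    fix m
    let ?S = "\<lambda>\<phi>. {b. mcoeff (mlin (kp_row \<phi>) (ratio ^ Suc b)) m \<noteq> 0}"
    have "{v. mcoeff (\<theta> v) m \<noteq> 0} \<subseteq> P ` ?S P \<union> P' ` ?S P' \<union> {Z, Zinv}"
    proof
      fix v assume "v \<in> {v. mcoeff (\<theta> v) m \<noteq> 0}"
      then show "v \<in> P ` ?S P \<union> P' ` ?S P' \<union> {Z, Zinv}"
        by (cases v) (auto simp del: power_Suc)
    qed
    moreover have "finite (P ` ?S P \<union> P' ` ?S P' \<union> {Z, Zinv})"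
      using msummableD [OF msummable_mlin_ratio [OF inj_P]] msummableD [OF msummable_mlin_ratio [OF inj_P']]
      by simp
    ultimately show "finite {v. mcoeff (\<theta> v) m \<noteq> 0}" by (rule finite_subset)
  qed
qed

lemma kp_homog_lin: "kp_homog 0 (kp_lin f P)" "kp_homog 0 (kp_lin f P')"
  by (intro kp_homog_kp_lin; simp)+

text \<open>Here n counts the \<open>Zinv\<close> in M and w is the weight of M: the image is a
  factor of degree 0 times x^n (J / u)^w = x^(n-w). The power of u is kept on the left instead of
  being divided out.\<close>

lemma \<theta>_monomial:
  assumes "Z \<notin># M"
  shows "\<exists>A w n. kp_homog 0 A \<and> kp_degree M = int n - int w
    \<and> mvar Zinv ^ w * (\<Prod>v\<in>#M. \<theta> v) = A * (mfps J (mvar Zinv) ^ w * mfps x (mvar Zinv) ^ n)"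
  using assms
proof (induction M)
  case empty
  show ?case
    by (intro exI [of _ 1] exI [of _ 0]) (simp add: kp_degree_def kp_homog_1)
next
  case (add v M)
  let ?J = "mfps J (mvar Zinv) :: (kp_var, 'a) mps" and ?x = "mfps x (mvar Zinv) :: (kp_var, 'a) mps"
  let ?V = "mvar Zinv :: (kp_var, 'a) mps" and ?M = "\<Prod>v\<in>#M. \<theta> v"
  from add obtain A w n where IH: "kp_homog 0 A" "kp_degree M = int n - int w"
    "?V ^ w * ?M = A * (?J ^ w * ?x ^ n)" by auto
  have deg: "kp_degree (add_mset v M) = kp_degree {#v#} + kp_degree M"
    using kp_degree_add [of "{#v#}" M] by simp
  have step: ?case
    if L: "?V ^ Suc b * \<theta> v = L * ?J ^ Suc b" "kp_homog 0 L" and wt: "kp_degree {#v#} = - int (Suc b)" for b L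
  proof -
    have "?V ^ (w + Suc b) * (\<theta> v * ?M) = (?V ^ Suc b * \<theta> v) * (?V ^ w * ?M)"
      by (simp only: power_add ac_simps)
    also have "\<dots> = (L * A) * (?J ^ (w + Suc b) * ?x ^ n)"
      unfolding L(1) IH(3) by (simp only: power_add ac_simps)
    finally show ?thesis
      using IH L(2) wt deg
      by (intro exI [of _ "L * A"] exI [of _ "w + Suc b"] exI [of _ n] conjI kp_homog_mult_0) auto
  qed
  show ?case
  proof (cases v)
    case (P b)
    show ?thesis
      by (rule step [of b "kp_lin (x ^ Suc b) P"])
        (simp_all add: P mvar_power_mlin_ratio inj_P kp_homog_lin kp_degree_def del: power_Suc)
  next
    case (P' b)
    show ?thesis
      by (rule step [of b "kp_lin (x ^ Suc b) P'"])
        (simp_all add: P' mvar_power_mlin_ratio inj_P' kp_homog_lin kp_degree_def del: power_Suc)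
  next
    case Z
    then show ?thesis using add.prems by simp
  next
    case Zinv
    have "?V ^ w * (?x * ?M) = ?x * (?V ^ w * ?M)" by (simp only: ac_simps)
    also have "\<dots> = A * (?J ^ w * ?x ^ Suc n)"
      unfolding IH(3) power_Suc by (simp only: ac_simps)
    finally show ?thesis
      using IH deg
      by (intro exI [of _ A] exI [of _ w] exI [of _ "Suc n"]) (simp add: Zinv kp_degree_def)
  qed
qed

text \<open>The factor \<open>fps_deriv x * J\<^sup>2\<close> is dz/dw for z = 1 / x(u) and w = 1 /
  u. A monomial of degree d goes to a factor of degree 0 times x^d, and the residue in question is
  that of x^(d-2) dx. It vanishes unless d = 1, and there G has no coefficients.\<close>

lemma residue_free_\<theta>:
  assumes G: "residue_free G"
  shows "residue_free (msubst \<theta> G * mfps (fps_deriv x * J\<^sup>2) (mvar Zinv))"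
  unfolding residue_free_def
proof (intro allI impI)
  fix m assume "Z \<notin># m" and deg: "kp_degree m = 1"
  let ?Y = "mfps (fps_deriv x * J\<^sup>2) (mvar Zinv) :: (kp_var, 'a) mps"
  let ?J = "mfps J (mvar Zinv) :: (kp_var, 'a) mps" and ?x = "mfps x (mvar Zinv) :: (kp_var, 'a) mps"
  have zero: "mcoeff G M * mcoeff ((\<Prod>v\<in>#M. \<theta> v) * ?Y) m = 0" for M
  proof (cases "Z \<in># M")
    case True
    then obtain M' where "M = add_mset Z M'" by (metis insert_DiffM)
    then show ?thesis by simp
  next
    case False
    then obtain A w n where A: "kp_homog 0 A" and d: "kp_degree M = int n - int w"
      and eq: "mvar Zinv ^ w * (\<Prod>v\<in>#M. \<theta> v) = A * (?J ^ w * ?x ^ n)"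
      using \<theta>_monomial by blast
    show ?thesis
    proof (cases "n = Suc w")
      case True
      then have "mcoeff G M = 0" using G False d by (simp add: residue_free_def)
      then show ?thesis by simp
    next
      case n: False
      let ?f = "J ^ Suc (Suc w) * x ^ n * fps_deriv x"
      have "mvar Zinv ^ w * ((\<Prod>v\<in>#M. \<theta> v) * ?Y) = A * (?J ^ w * ?x ^ n * ?Y)"
        using eq by (simp only: mult.assoc [symmetric])
      also have "?J ^ w * ?x ^ n * ?Y = mfps (J ^ w * x ^ n * (fps_deriv x * J\<^sup>2)) (mvar Zinv)"
        by (simp add: mfps_mult mfps_power)
      also have "J ^ w * x ^ n * (fps_deriv x * J\<^sup>2) = ?f"
        by (simp add: power2_eq_square ac_simps)
      finally have "mcoeff ((\<Prod>v\<in>#M. \<theta> v) * ?Y) m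
          = mcoeff (A * mfps ?f (mvar Zinv)) (replicate_mset w Zinv + m)"
        by (metis mcoeff_mmono_mult_add mvar_power_eq_mmono)
      also have "\<dots> = 0"
      proof (rule ccontr)
        assume "mcoeff (A * mfps ?f (mvar Zinv)) (replicate_mset w Zinv + m) \<noteq> 0"
        from mcoeff_mult_nonzero [OF this] obtain a b where ab: "a + b = replicate_mset w Zinv + m"
          "mcoeff A a \<noteq> 0" "mcoeff (mfps ?f (mvar Zinv)) b \<noteq> 0" by auto
        from mcoeff_mfps_mvar_nonzero [OF ab(3)] obtain k
          where k: "b = replicate_mset k Zinv" "fps_nth ?f k \<noteq> 0" by blast
        have "kp_degree a = 0" using A ab(2) by (simp add: kp_homog_def)
        \<comment> \<open>m has degree 1 and A has degree 0, so the power of \<open>Zinv\<close>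
          takes the whole degree w + 1; there \<open>fps_residue_power\<close> gives 0 because n
          differs from w + 1.\<close>
        then have "k = Suc w"
          using arg_cong [OF ab(1), of kp_degree] deg
          by (simp add: kp_degree_add k(1) kp_degree_replicate_Zinv)
        then show False
          using k(2) n fps_residue_power [OF x0 J_x, of "Suc w" n] by (simp del: power_Suc)
      qed
      finally show ?thesis by simp
    qed
  qed
  have "msubst \<theta> G * ?Y = msum (\<lambda>M. mconst (mcoeff G M) * ((\<Prod>v\<in>#M. \<theta> v) * ?Y))"
    unfolding msubst_def
    by (subst msum_mult_right [OF msummable_msubst [OF madm_\<theta>]]) (simp add: mult.assoc)
  then show "mcoeff (msubst \<theta> G * ?Y) m = 0"
    by (simp add: mcoeff_msum zero)
qed

end

lemma msum_power_eq_mfps: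
  assumes "mcoeff F {#} = 0" "fps_nth f 0 = 0"
  shows "msum (\<lambda>k. mconst (fps_nth f (Suc k)) * F ^ Suc k) = mfps f F"
  unfolding mfps_def by (subst msum_Suc) (simp_all add: assms)

context coordinate
begin

lemma msubst_\<theta>_shift:
  "msubst \<theta> (mvar Zinv ^ Suc b * (mvar (P b) - 1)) = kp_lin (x ^ Suc b) P - mfps x (mvar Zinv) ^ Suc b"
  "msubst \<theta> (mvar Zinv ^ Suc b * (mvar (P' b) + 1)) = kp_lin (x ^ Suc b) P' + mfps x (mvar Zinv) ^ Suc b"
proof -
  let ?J = "mfps J (mvar Zinv) :: (kp_var, 'a) mps" and ?x = "mfps x (mvar Zinv) :: (kp_var, 'a) mps"
  let ?X = "mfps (fps_shift 1 x) (mvar Zinv) :: (kp_var, 'a) mps" and ?V = "mvar Zinv :: (kp_var, 'a) mps"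
  have "?X * ?J = 1" by (simp add: shift_J [simplified] flip: mfps_mult)
  then have XJ: "(?X * ?J) ^ Suc b = 1" by (simp del: power_Suc)
  have "?x = ?V * ?X"
    by (subst fps_X_mult_shift [OF x0, symmetric], subst mfps_mult) simp_all
  then have xb: "?x ^ Suc b * F = ?X ^ Suc b * (?V ^ Suc b * F)" for F
    by (simp only: power_mult_distrib ac_simps)
  have lin: "?x ^ Suc b * mlin (kp_row \<phi>) (ratio ^ Suc b) = kp_lin (x ^ Suc b) \<phi>" if "inj \<phi>" for \<phi>
  proof -
    have "?x ^ Suc b * mlin (kp_row \<phi>) (ratio ^ Suc b) = kp_lin (x ^ Suc b) \<phi> * (?X * ?J) ^ Suc b"
      unfolding xb mvar_power_mlin_ratio [OF that] power_mult_distrib by (simp only: ac_simps)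
    then show ?thesis by (simp only: XJ mult_1_right)
  qed
  show "msubst \<theta> (?V ^ Suc b * (mvar (P b) - 1)) = kp_lin (x ^ Suc b) P - ?x ^ Suc b"
    using lin [OF inj_P]
    by (simp add: msubst_mult msubst_diff msubst_power madm_\<theta> right_diff_distrib del: power_Suc)
  show "msubst \<theta> (?V ^ Suc b * (mvar (P' b) + 1)) = kp_lin (x ^ Suc b) P' + ?x ^ Suc b"
    using lin [OF inj_P']
    by (simp add: msubst_mult msubst_add msubst_power madm_\<theta> distrib_left del: power_Suc)
qed

lemma madm_change: "madm (\<lambda>i. msum (\<lambda>j. mconst (fps_nth (x ^ Suc i) (Suc j)) * mvar j :: (nat, 'a) mps))"
proof (rule madmI)
  let ?f = "\<lambda>(i, j). mconst (fps_nth (x ^ Suc i) (Suc j)) * (mvar j :: (nat, 'a) mps)"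
  have "msummable ?f"
    unfolding msummable_def
  proof
    fix m :: "nat multiset"
    have "{p. mcoeff (?f p) m \<noteq> 0} \<subseteq> (SIGMA i : {..Max (set_mset m)}. set_mset m)"
    proof
      fix p assume "p \<in> {p. mcoeff (?f p) m \<noteq> 0}"
      then have p: "fps_nth (x ^ Suc (fst p)) (Suc (snd p)) \<noteq> 0" "m = {#snd p#}"
        by (auto simp: case_prod_unfold mcoeff_mvar split: if_splits)
      then have "fst p \<le> snd p"
        using startsby_zero_power_prefix [OF x0, of "Suc (fst p)"] by (meson Suc_le_mono not_less)
      then show "p \<in> (SIGMA i : {..Max (set_mset m)}. set_mset m)"
        using p(2) by (cases p) auto
    qed
    then show "finite {p. mcoeff (?f p) m \<noteq> 0}"
      by (rule finite_subset) (intro finite_SigmaI finite_atMost finite_set_mset)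
  qed
  then show "msummable (\<lambda>i. msum (\<lambda>j. mconst (fps_nth (x ^ Suc i) (Suc j)) * mvar j :: (nat, 'a) mps))"
    by (rule msum_pair(2))
qed (rule mcoeff_msum_empty, simp)

lemma msummable_scaled_mvar: "msummable (\<lambda>j. mconst (c j) * mvar j :: (nat, 'a) mps)"
  by (intro msummable_mult_family2 madm_summable madm_mvar)

text \<open>The shift by u^k in the new variables becomes the shift by x(u)^b in the old ones, since
  c_k^b u^k sums to x(u)^b. Hence the tau factors get the same arguments here as under
  \<open>\<theta>\<close>.\<close>

lemma msubst_shift_change:
  shows "msubst (\<lambda>i. mvar Zinv ^ Suc i * (mvar (P i) - 1)) (change_vars x F)
      = msubst (\<lambda>b. kp_lin (x ^ Suc b) P - mfps x (mvar Zinv) ^ Suc b) F"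
    and "msubst (\<lambda>i. mvar Zinv ^ Suc i * (mvar (P' i) + 1)) (change_vars x F)
      = msubst (\<lambda>b. kp_lin (x ^ Suc b) P' + mfps x (mvar Zinv) ^ Suc b) F"
proof -
  let ?V = "mvar Zinv :: (kp_var, 'a) mps"
  have f0: "fps_nth (x ^ Suc b) 0 = 0" for b by (simp add: x0)
  have x: "mfps x ?V ^ Suc b = msum (\<lambda>k. mconst (fps_nth (x ^ Suc b) (Suc k)) * ?V ^ Suc k)" for b
    using msum_power_eq_mfps [OF _ f0, of ?V b] by (simp add: mfps_power del: power_Suc)
  have V: "msummable (\<lambda>k. mconst (c k) * ?V ^ Suc k)" for c
    by (intro msummable_mult_family2 msummable_power_Suc) simp
  let ?s = "\<lambda>i. ?V ^ Suc i * (mvar (P i) - 1)" and ?s' = "\<lambda>i. ?V ^ Suc i * (mvar (P' i) + 1)"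
  have s: "madm ?s" "madm ?s'" by (intro madm_power_Suc; simp)+
  have *: "msubst ?s (msum (\<lambda>j. mconst (fps_nth (x ^ Suc i) (Suc j)) * mvar j))
      = kp_lin (x ^ Suc i) P - mfps x ?V ^ Suc i" for i
    unfolding x kp_lin_def
    by (subst msum_diff [symmetric, OF msummable_kp_lin [OF inj_P] V],
        subst msubst_msum(1) [OF s(1) msummable_scaled_mvar])
      (simp only: msubst_mult [OF s(1)] msubst_mconst msubst_mvar,
        simp only: right_diff_distrib mult_1_right mult.commute [of "?V ^ _"])
  show "msubst ?s (change_vars x F) = msubst (\<lambda>b. kp_lin (x ^ Suc b) P - mfps x ?V ^ Suc b) F"
    unfolding change_vars_def by (subst msubst_msubst [OF s(1) madm_change]) (simp only: *)
  have *: "msubst ?s' (msum (\<lambda>j. mconst (fps_nth (x ^ Suc i) (Suc j)) * mvar j))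
      = kp_lin (x ^ Suc i) P' + mfps x ?V ^ Suc i" for i
    unfolding x kp_lin_def
    by (subst msum_add [symmetric, OF msummable_kp_lin [OF inj_P'] V],
        subst msubst_msum(1) [OF s(2) msummable_scaled_mvar])
      (simp only: msubst_mult [OF s(2)] msubst_mconst msubst_mvar,
        simp only: distrib_left mult_1_right mult.commute [of "?V ^ _"])
  show "msubst ?s' (change_vars x F) = msubst (\<lambda>b. kp_lin (x ^ Suc b) P' + mfps x ?V ^ Suc b) F"
    unfolding change_vars_def by (subst msubst_msubst [OF s(2) madm_change]) (simp only: *)
qed

lemma msubst_\<theta>_shift_msubst:
  "msubst \<theta> (msubst (\<lambda>i. mvar Zinv ^ Suc i * (mvar (P i) - 1)) F)
    = msubst (\<lambda>b. kp_lin (x ^ Suc b) P - mfps x (mvar Zinv) ^ Suc b) F"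
  "msubst \<theta> (msubst (\<lambda>i. mvar Zinv ^ Suc i * (mvar (P' i) + 1)) F)
    = msubst (\<lambda>b. kp_lin (x ^ Suc b) P' + mfps x (mvar Zinv) ^ Suc b) F"
  by (simp_all only: msubst_msubst [OF madm_\<theta> madm_power_Suc] mcoeff_mvar_empty msubst_\<theta>_shift)

text \<open>
  The condition \<open>compatible\<close> at the points \<open>t u\<close> and \<open>u\<close>. The coefficient of \<open>t\<^sup>k\<close> expands
  \<open>u\<^sup>-\<^sup>k / k\<close> in powers of \<open>x(u)\<close>, \<open>g\<close> giving the constant term.
\<close>

lemma compatible_log:
  assumes c: "compatible x c"
  shows "\<exists>g. fps_nth g 0 = 0 \<and> mfps flog (mvar False)
      + bil c (mfps x (mvar False * mvar True)) (mfps x (mvar True))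
    = mfps g (mvar False * mvar True) + mfps flog ratio"
proof -
  let ?t = "mvar False :: (bool, 'a) mps" and ?u = "mvar True :: (bool, 'a) mps"
  let ?X = "mfps (fps_shift 1 x) :: (bool, 'a) mps \<Rightarrow> _"
  let ?J = "mfps J :: (bool, 'a) mps \<Rightarrow> _"
  let ?B = "bil c (mfps x (?t * ?u)) (mfps x ?u)" and ?k = "mconst (fps_nth x 1) :: (bool, 'a) mps"
  \<comment> \<open>Chosen so that 1 - h is x'(0) J; then \<open>flog oo h\<close> is log (x'(0) u /
    x(u)).\<close>
  define h where "h = 1 - fps_const (fps_nth x 1) * J"
  have J0: "fps_nth x 1 * fps_nth J 0 = 1"
    using arg_cong [OF shift_J, of "\<lambda>f. fps_nth f 0"] by simp
  then have h0: "fps_nth h 0 = 0" by (simp add: h_def)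
  let ?g = "flog oo h"
  have XJ: "?X F * ?J F = 1" if "mcoeff F {#} = 0" for F
    using that by (simp only: shift_J mfps_1 flip: mfps_mult)
  have g: "mexp (mfps ?g (?t * ?u)) = ?k * ?J (?t * ?u)"
  proof -
    have "mexp (mfps ?g (?t * ?u)) = mfps (fexp oo flog) (mfps h (?t * ?u))"
      unfolding mexp_eq_mfps using h0 by (simp add: mfps_compose flog_nth)
    also have "\<dots> = 1 - mfps h (?t * ?u)"
      using h0 by (simp add: fexp_flog mfps_diff)
    also have "mfps h (?t * ?u) = 1 - ?k * ?J (?t * ?u)"
      by (simp add: h_def mfps_diff mfps_mult)
    finally show ?thesis by simp
  qed
  have flog: "mexp (mfps flog F) = 1 - F" if "mcoeff F {#} = 0" for F :: "(bool, 'a) mps"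
    unfolding mexp_eq_mfps using that by (simp add: fexp_flog mfps_diff flog_nth flip: mfps_compose)
  \<comment> \<open>The defining identity of the divided difference at the points u and t u has the
    common factor u, which is cancelled as a monomial.\<close>
  have mdd: "(1 - ?t) * mdd x ?u (?t * ?u) = ?X ?u - ?t * ?X (?t * ?u)"
  proof (rule mmono_mult_cancel [of "{#True#}"])
    have x: "mfps x F = F * ?X F" if "mcoeff F {#} = 0" for F
      using that by (subst fps_X_mult_shift [OF x0, symmetric], subst mfps_mult) simp_all
    have "mmono {#True#} * ((1 - ?t) * mdd x ?u (?t * ?u)) = (?u - ?t * ?u) * mdd x ?u (?t * ?u)"
      by (simp add: mvar_eq_mmono algebra_simps)
    also have "\<dots> = mfps x ?u - mfps x (?t * ?u)"
      by (rule diff_mult_mdd) simp_all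
    also have "\<dots> = mmono {#True#} * (?X ?u - ?t * ?X (?t * ?u))"
      by (simp add: x algebra_simps flip: mvar_eq_mmono)
    finally show "mmono {#True#} * ((1 - ?t) * mdd x ?u (?t * ?u))
        = mmono {#True#} * (?X ?u - ?t * ?X (?t * ?u))" .
  qed
  \<comment> \<open>Both sides of the claim exponentiate to x'(0) J(t u) (1 - x(t u) /
    x(u)).\<close>
  have "mexp (mfps flog ?t + ?B) = (1 - ?t) * mexp ?B"
    by (simp add: mexp_add flog mcoeff_bil_empty flog_nth x0)
  also have "\<dots> = (1 - ?t) * (mexp ?B * (?X (?t * ?u) * ?X ?u)) * (?J (?t * ?u) * ?J ?u)"
  proof -
    have "(1 - ?t) * mexp ?B = (1 - ?t) * mexp ?B * ((?X (?t * ?u) * ?J (?t * ?u)) * (?X ?u * ?J ?u))"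
      using XJ [of ?u] XJ [of "?t * ?u"] by simp
    then show ?thesis by (simp only: ac_simps)
  qed
  also have "\<dots> = ?k * ((1 - ?t) * mdd x ?u (?t * ?u)) * (?J (?t * ?u) * ?J ?u)"
    by (subst compatible_at [OF c x0]) (simp_all add: ac_simps)
  also have "\<dots> = ?k * ?J (?t * ?u) * (1 - ratio)"
  proof -
    have "(?X ?u - ?t * ?X (?t * ?u)) * ?J ?u = 1 - ratio"
      using XJ [of ?u] by (simp add: ratio_def left_diff_distrib mult.assoc)
    then show ?thesis unfolding mdd by (simp only: mult.assoc mult.left_commute)
  qed
  also have "\<dots> = mexp (mfps ?g (?t * ?u) + mfps flog ratio)"
    by (simp add: mexp_add flog g flog_nth)
  finally have "mfps flog ?t + ?B = mfps ?g (?t * ?u) + mfps flog ratio"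
    by (rule mexp_inj [rotated 2]) (simp_all add: mcoeff_bil_empty flog_nth x0)
  then show ?thesis by (intro exI [of _ ?g]) (simp add: flog_nth)
qed

end

section \<open>Transformation of the exponential prefactor and of solutions\<close>

lemma mbil_polarize:
  fixes A A' \<xi> :: "nat \<Rightarrow> ('v, 'a :: comm_ring_1) mps"
  assumes A: "msummable A" and A': "msummable A'" and \<xi>: "msummable \<xi>"
  shows "mbil c (\<lambda>i. A i - \<xi> i) (\<lambda>i. A i - \<xi> i) + mbil c (\<lambda>i. A' i + \<xi> i) (\<lambda>i. A' i + \<xi> i)
    = mbil c A A + mbil c A' A' + mbil (\<lambda>i j. c i j + c j i) \<xi> \<xi>
      + mbil (\<lambda>i j. c i j + c j i) A' \<xi> - mbil (\<lambda>i j. c i j + c j i) A \<xi>"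
proof -
  have n: "msummable (\<lambda>i. - \<xi> i)" using \<xi> by (rule msummable_uminus)
  have "mbil c (\<lambda>i. A i - \<xi> i) (\<lambda>i. A i - \<xi> i)
      = mbil c A A - mbil c A \<xi> - mbil c \<xi> A + mbil c \<xi> \<xi>"
    using mbil_add_left [OF A n msummable_add [OF A n], of c] mbil_add_right [OF A A n, of c]
      mbil_add_right [OF n A n, of c]
    by (simp add: mbil_uminus_left mbil_uminus_right algebra_simps)
  moreover have "mbil c (\<lambda>i. A' i + \<xi> i) (\<lambda>i. A' i + \<xi> i)
      = mbil c A' A' + mbil c A' \<xi> + mbil c \<xi> A' + mbil c \<xi> \<xi>"
    using mbil_add_left [OF A' \<xi> msummable_add [OF A' \<xi>], of c] mbil_add_right [OF A' A' \<xi>, of c]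
      mbil_add_right [OF \<xi> A' \<xi>, of c]
    by (simp add: algebra_simps)
  moreover have "mbil (\<lambda>i j. c i j + c j i) F G = mbil c F G + mbil c G F"
    if "msummable F" "msummable G" for F G :: "nat \<Rightarrow> ('v, 'a) mps"
    using mbil_add_coeff [OF that, of c "\<lambda>i j. c j i"] mbil_transpose [of c G F] by simp
  ultimately show ?thesis using A A' \<xi> by (simp add: algebra_simps)
qed

context coordinate
begin

lemma msummable_kp_lin_x:
  assumes "inj \<phi>"
  shows "msummable (\<lambda>b. kp_lin (x ^ Suc b) \<phi>)"
proof -
  have "msummable (\<lambda>b. mfps x (mvar False * mvar True) ^ Suc b :: (bool, 'a) mps)"
    by (rule msummable_power_Suc) (simp add: x0)
  then have "msummable (\<lambda>b. mlin (kp_row \<phi>) (mfps x (mvar False * mvar True) ^ Suc b) :: (kp_var, 'a) mps)"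
    by (intro mlin_msum(2) msummable_kp_row assms)
  then show ?thesis
    by (simp add: mlin_kp_row_mfps [OF assms] flip: mfps_power del: power_Suc)
qed

text \<open>The image of \<open>compatible_log\<close> under \<open>kp_row\<close>: log (1 - t)
  gives the negative of the sum of p_k / k, log (1 - \<open>ratio\<close>) the negative of its image
  under \<open>\<theta>\<close>, and g at t u gives a linear form free of the spectral
  parameter.\<close>

lemma kp_linear_defect:
  assumes c: "compatible x c"
  shows "\<exists>g. \<forall>\<phi>. inj \<phi> \<longrightarrow>
    msum (\<lambda>b. mconst (1 / of_nat (Suc b)) * mvar (\<phi> b))
      - msum (\<lambda>b. mconst (1 / of_nat (Suc b)) * mlin (kp_row \<phi>) (ratio ^ Suc b))
    = mbil (\<lambda>i j. c i j + c j i) (\<lambda>b. kp_lin (x ^ Suc b) \<phi>) (\<lambda>b. mfps x (mvar Zinv) ^ Suc b)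
      - kp_lin g \<phi>"
proof -
  let ?t = "mvar False :: (bool, 'a) mps" and ?u = "mvar True :: (bool, 'a) mps"
  let ?c = "\<lambda>i j. c i j + c j i" and ?x = "mfps x (mvar Zinv) :: (kp_var, 'a) mps"
  obtain g where g: "mfps flog ?t + bil c (mfps x (?t * ?u)) (mfps x ?u)
      = mfps g (?t * ?u) + mfps flog ratio"
    using compatible_log [OF c] by blast
  show ?thesis
  proof (intro exI [of _ g] allI impI)
    fix \<phi> :: "nat \<Rightarrow> kp_var" assume inj: "inj \<phi>"
    let ?L = "mlin (kp_row \<phi>) :: (bool, 'a) mps \<Rightarrow> (kp_var, 'a) mps"
    note row = msummable_kp_row [OF inj]
    have 1: "?L (mfps flog ?t) = - msum (\<lambda>b. mconst (1 / of_nat (Suc b)) * mvar (\<phi> b))"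
      unfolding mlin_kp_row_mfps_False [OF inj]
      by (subst msum_uminus [symmetric]) (simp add: flog_nth mconst_uminus del: of_nat_Suc)
    have 2: "?L (bil c (mfps x (?t * ?u)) (mfps x ?u))
        = mbil ?c (\<lambda>b. kp_lin (x ^ Suc b) \<phi>) (\<lambda>b. ?x ^ Suc b)"
    proof -
      have sum: "msummable (\<lambda>(i, j). mconst (?c i j) * mfps x (?t * ?u) ^ Suc i * mfps x ?u ^ Suc j)"
        by (intro msummable_mbil msummable_power_Suc) (simp_all add: x0)
      have entry: "?L (mconst a * mfps x (?t * ?u) ^ Suc i * mfps x ?u ^ Suc j)
          = mconst a * kp_lin (x ^ Suc i) \<phi> * ?x ^ Suc j" for a i j
      proof -
        have eq: "mconst a * mfps x (?t * ?u) ^ Suc i * mfps x ?u ^ Suc j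
            = mconst a * (mfps (x ^ Suc i) (?t * ?u) * mfps (x ^ Suc j) ?u)"
          by (simp add: mfps_power mult.assoc del: power_Suc)
        show ?thesis
          unfolding eq mlin_mconst_mult [OF row] mlin_kp_row_mult_mfps [OF inj] mlin_kp_row_mfps [OF inj]
          by (simp add: mfps_power mult.assoc del: power_Suc)
      qed
      show ?thesis
        unfolding bil_def mbil_def mlin_msum(1) [OF row sum]
        by (rule msum_cong) (simp add: case_prod_unfold entry del: power_Suc)
    qed
    have 3: "?L (mfps g (?t * ?u)) = kp_lin g \<phi>"
      by (rule mlin_kp_row_mfps [OF inj])
    have 4: "?L (mfps flog ratio) = - msum (\<lambda>b. mconst (1 / of_nat (Suc b)) * ?L (ratio ^ Suc b))"
    proof -
      have sum: "msummable (\<lambda>b. mconst (fps_nth flog (Suc b)) * ratio ^ Suc b)"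
        by (intro msummable_mult_family2 msummable_power_Suc) simp
      have "?L (mfps flog ratio) = msum (\<lambda>b. ?L (mconst (fps_nth flog (Suc b)) * ratio ^ Suc b))"
        unfolding mlin_msum(1) [OF row sum, symmetric] by (subst msum_power_eq_mfps) (simp_all add: flog_nth)
      also have "\<dots> = msum (\<lambda>b. - (mconst (1 / of_nat (Suc b)) * ?L (ratio ^ Suc b)))"
        unfolding mlin_mconst_mult [OF row]
        by (rule msum_cong) (simp add: flog_nth mconst_uminus del: power_Suc of_nat_Suc)
      finally show ?thesis by (simp only: msum_uminus)
    qed
    show "msum (\<lambda>b. mconst (1 / of_nat (Suc b)) * mvar (\<phi> b))
        - msum (\<lambda>b. mconst (1 / of_nat (Suc b)) * ?L (ratio ^ Suc b))
      = mbil ?c (\<lambda>b. kp_lin (x ^ Suc b) \<phi>) (\<lambda>b. ?x ^ Suc b) - kp_lin g \<phi>"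
      using arg_cong [OF g, of ?L] unfolding mlin_add [OF row] 1 2 3 4
      by (simp add: algebra_simps)
  qed
qed

text \<open>H gathers what is free of the spectral parameter: Q(p), Q(p') and the linear form from
  g. The remaining self-pairing of the shift will be the Jacobian.\<close>

lemma kp_linear_transform:
  assumes c: "compatible x c"
  shows "\<exists>H. kp_homog 0 H \<and> mcoeff H {#} = 0 \<and> kp_linear
      + (msubst (\<lambda>b. kp_lin (x ^ Suc b) P - mfps x (mvar Zinv) ^ Suc b) (mbil c mvar mvar)
      + msubst (\<lambda>b. kp_lin (x ^ Suc b) P' + mfps x (mvar Zinv) ^ Suc b) (mbil c mvar mvar))
    = msubst \<theta> kp_linear + H + bil c (mfps x (mvar Zinv)) (mfps x (mvar Zinv))"
proof -
  let ?x = "mfps x (mvar Zinv) :: (kp_var, 'a) mps" and ?c = "\<lambda>i j. c i j + c j i"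
  let ?A = "\<lambda>b. kp_lin (x ^ Suc b) P" and ?A' = "\<lambda>b. kp_lin (x ^ Suc b) P'" and ?\<xi> = "\<lambda>b. ?x ^ Suc b"
  have sA: "msummable ?A" and sA': "msummable ?A'"
    by (intro msummable_kp_lin_x inj_P inj_P')+
  have s\<xi>: "msummable ?\<xi>" by (rule msummable_power_Suc) (simp add: x0)
  have A0: "mcoeff (kp_lin f \<phi>) {#} = 0" for f :: "'a fps" and \<phi>
    unfolding kp_lin_def by (rule mcoeff_msum_empty) simp
  have adm: "madm (\<lambda>b. ?A b - ?\<xi> b)" "madm (\<lambda>b. ?A' b + ?\<xi> b)"
    by (intro madmI msummable_diff msummable_add sA sA' s\<xi>; simp add: A0 x0)+
  have mvar: "msummable (mvar :: nat \<Rightarrow> (nat, 'a) mps)" by (intro madm_summable madm_mvar)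
  obtain g where g: "\<And>\<phi>. inj \<phi> \<Longrightarrow>
      msum (\<lambda>b. mconst (1 / of_nat (Suc b)) * mvar (\<phi> b))
        - msum (\<lambda>b. mconst (1 / of_nat (Suc b)) * mlin (kp_row \<phi>) (ratio ^ Suc b))
      = mbil ?c (\<lambda>b. kp_lin (x ^ Suc b) \<phi>) ?\<xi> - kp_lin g \<phi>"
    using kp_linear_defect [OF c] by blast
  have lin: "kp_linear = msum (\<lambda>b. mconst (1 / of_nat (Suc b)) * mvar (P b))
      - msum (\<lambda>b. mconst (1 / of_nat (Suc b)) * mvar (P' b))"
    unfolding kp_linear_def
    by (subst msum_diff [symmetric])
      (auto intro!: msummable_mult_family2 msummable_mvar_inj inj_P inj_P'
        simp: right_diff_distrib simp del: of_nat_Suc)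
  have "msubst \<theta> (msum (\<lambda>b. mconst (1 / of_nat (Suc b)) * mvar (\<phi> b)))
      = msum (\<lambda>b. mconst (1 / of_nat (Suc b)) * \<theta> (\<phi> b))" if "inj \<phi>" for \<phi>
    by (subst msubst_msum(1) [OF madm_\<theta>])
      (auto intro!: msummable_mult_family2 msummable_mvar_inj that
        simp: msubst_mult madm_\<theta> simp del: of_nat_Suc)
  from this [OF inj_P] this [OF inj_P']
  have lin': "msubst \<theta> kp_linear
      = msum (\<lambda>b. mconst (1 / of_nat (Suc b)) * mlin (kp_row P) (ratio ^ Suc b))
        - msum (\<lambda>b. mconst (1 / of_nat (Suc b)) * mlin (kp_row P') (ratio ^ Suc b))"
    unfolding lin by (simp add: msubst_diff madm_\<theta> del: power_Suc of_nat_Suc)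
  \<comment> \<open>The two tau factors are shifted in opposite directions: the cross terms get
    opposite signs, as in p - p', while the two values of Q on the shift add up to the polar form on
    the diagonal.\<close>
  have Q: "msubst (\<lambda>b. ?A b - ?\<xi> b) (mbil c mvar mvar) + msubst (\<lambda>b. ?A' b + ?\<xi> b) (mbil c mvar mvar)
      = mbil c ?A ?A + mbil c ?A' ?A' + bil c ?x ?x + mbil ?c ?A' ?\<xi> - mbil ?c ?A ?\<xi>"
    unfolding msubst_mbil [OF adm(1) mvar mvar] msubst_mbil [OF adm(2) mvar mvar] msubst_mvar
      mbil_polarize [OF sA sA' s\<xi>] bil_def ..
  let ?H = "mbil c ?A ?A + mbil c ?A' ?A' - (kp_lin g P - kp_lin g P')"
  have "kp_homog 0 ?H"
    unfolding mbil_def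
    by (intro kp_homog_add kp_homog_diff kp_homog_msum kp_homog_lin)
      (auto simp: case_prod_unfold intro!: kp_homog_mult_0 kp_homog_lin kp_homog_mconst)
  moreover have "mcoeff ?H {#} = 0"
    by (simp add: mcoeff_mbil_empty A0)
  moreover have "kp_linear + (msubst (\<lambda>b. ?A b - ?\<xi> b) (mbil c mvar mvar)
      + msubst (\<lambda>b. ?A' b + ?\<xi> b) (mbil c mvar mvar)) = msubst \<theta> kp_linear + ?H + bil c ?x ?x"
  proof -
    have arith: "a - a' + (h + e + m' - m) = b - b' + (h - (l - l')) + e"
      if "a - b = m - l" "a' - b' = m' - l'" for a b m l a' b' m' l' h e :: "(kp_var, 'a) mps"
    proof -
      from that have "a = b + m - l" "a' = b' + m' - l'" by (simp_all add: algebra_simps)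
      then show ?thesis by simp
    qed
    show ?thesis
      unfolding Q lin' unfolding lin by (rule arith [OF g [OF inj_P] g [OF inj_P']])
  qed
  ultimately show ?thesis by blast
qed

text \<open>After \<open>\<theta>\<close> the old product and the new one share their tau factors.
  Their prefactors differ by exp H, of degree 0, by the constant x'(0), and by the Jacobian that
  \<open>residue_free_\<theta>\<close> requires.\<close>

theorem KP_transform_solution:
  assumes c: "compatible x c" and \<Phi>: "KP_solution \<Phi>"
  shows "KP_solution (KP_transform x (mbil c mvar mvar) \<Phi>)"
proof -
  let ?Q = "mbil c mvar mvar :: (nat, 'a) mps"
  let ?x = "mfps x (mvar Zinv) :: (kp_var, 'a) mps"
  let ?\<Phi> = "\<Phi> - mconst (mcoeff \<Phi> {#})" and ?\<Psi> = "KP_transform x ?Q \<Phi>"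
  let ?\<tau> = "mexp ?\<Phi>"
  let ?s = "\<lambda>i. mvar Zinv ^ Suc i * (mvar (P i) - 1) :: (kp_var, 'a) mps"
  let ?s' = "\<lambda>i. mvar Zinv ^ Suc i * (mvar (P' i) + 1) :: (kp_var, 'a) mps"
  let ?r = "\<lambda>b. kp_lin (x ^ Suc b) P - ?x ^ Suc b"
  let ?r' = "\<lambda>b. kp_lin (x ^ Suc b) P' + ?x ^ Suc b"
  have s: "madm ?s" "madm ?s'" by (intro madm_power_Suc; simp)+
  have \<Phi>0: "mcoeff ?\<Phi> {#} = 0" by (simp add: mcoeff_mconst)
  have Q0: "mcoeff ?Q {#} = 0" by (rule mcoeff_mbil_empty) simp
  have adm: "madm ?r" "madm ?r'"
    using madm_msubst [OF madm_\<theta> s(1)] madm_msubst [OF madm_\<theta> s(2)]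
    by (simp_all only: msubst_\<theta>_shift)
  have "?\<Psi> - mconst (mcoeff ?\<Psi> {#}) = change_vars x (?\<Phi> + ?Q)"
    using Q0 unfolding KP_transform_def change_vars_def
    by (simp add: madm_change msubst_add msubst_diff mcoeff_mconst del: power_Suc)
  then have \<tau>: "mexp (?\<Psi> - mconst (mcoeff ?\<Psi> {#})) = change_vars x (?\<tau> * mexp ?Q)"
    unfolding change_vars_def
    by (simp only: mexp_add [OF \<Phi>0 Q0, symmetric])
      (subst msubst_mexp, simp_all add: madm_change Q0 mcoeff_mconst del: power_Suc)
  obtain H where H: "kp_homog 0 H" "mcoeff H {#} = 0"
    and eq: "kp_linear + (msubst ?r ?Q + msubst ?r' ?Q) = msubst \<theta> kp_linear + H + bil c ?x ?x"
    using kp_linear_transform [OF c] by blast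
  \<comment> \<open>On the diagonal the divided difference in \<open>compatible\<close> becomes x',
    which leaves x'(0) dz/dw.\<close>
  have bil: "mexp (bil c ?x ?x) = mconst (fps_nth x 1) * mfps (fps_deriv x * J\<^sup>2) (mvar Zinv)"
  proof -
    let ?X = "mfps (fps_shift 1 x) (mvar Zinv) :: (kp_var, 'a) mps"
    let ?J = "mfps J (mvar Zinv) :: (kp_var, 'a) mps"
    have XJ: "?X * ?J = 1" by (simp only: shift_J mfps_1 mcoeff_mvar_empty flip: mfps_mult)
    have "mexp (bil c ?x ?x) = mexp (bil c ?x ?x) * (?X * ?X) * (?J * ?J)"
    proof -
      have "mexp (bil c ?x ?x) = mexp (bil c ?x ?x) * ((?X * ?J) * (?X * ?J))" using XJ by simp
      then show ?thesis by (simp only: ac_simps)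
    qed
    also have "\<dots> = mconst (fps_nth x 1) * mfps (fps_deriv x) (mvar Zinv) * (?J * ?J)"
      by (subst compatible_at [OF c x0]) (simp_all add: mdd_self)
    finally show ?thesis by (simp add: mfps_mult power2_eq_square mult.assoc)
  qed
  have "mexp kp_linear * (mexp (msubst ?r ?Q) * mexp (msubst ?r' ?Q))
      = mexp (kp_linear + (msubst ?r ?Q + msubst ?r' ?Q))"
    using Q0 by (simp add: mexp_add mcoeff_kp_linear_empty adm del: power_Suc)
  also have "\<dots> = mexp (msubst \<theta> kp_linear) * mexp H * mexp (bil c ?x ?x)"
    unfolding eq using H(2)
    by (simp add: mexp_add mcoeff_kp_linear_empty madm_\<theta> mcoeff_bil_empty x0)
  finally have exp: "mexp kp_linear * (mexp (msubst ?r ?Q) * mexp (msubst ?r' ?Q))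
      = mexp (msubst \<theta> kp_linear) * mexp H * mexp (bil c ?x ?x)" .
  have "hirota_rescaled (change_vars x (?\<tau> * mexp ?Q))
      = mexp kp_linear * (msubst ?r (?\<tau> * mexp ?Q) * msubst ?r' (?\<tau> * mexp ?Q))"
    unfolding hirota_rescaled_def msubst_shift_change ..
  also have "\<dots> = (msubst ?r ?\<tau> * msubst ?r' ?\<tau>)
      * (mexp kp_linear * (mexp (msubst ?r ?Q) * mexp (msubst ?r' ?Q)))"
    unfolding msubst_mult [OF adm(1)] msubst_mult [OF adm(2)] msubst_mexp [OF adm(1) Q0] msubst_mexp [OF adm(2) Q0]
    by (simp only: ac_simps)
  also have "\<dots> = (mexp H * mconst (fps_nth x 1))
      * (mexp (msubst \<theta> kp_linear) * (msubst ?r ?\<tau> * msubst ?r' ?\<tau>) * mfps (fps_deriv x * J\<^sup>2) (mvar Zinv))"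
    unfolding exp bil by (simp only: ac_simps)
  also have "mexp (msubst \<theta> kp_linear) * (msubst ?r ?\<tau> * msubst ?r' ?\<tau>) = msubst \<theta> (hirota_rescaled ?\<tau>)"
    unfolding hirota_rescaled_def
    by (simp only: msubst_mult [OF madm_\<theta>] msubst_mexp [OF madm_\<theta> mcoeff_kp_linear_empty] msubst_\<theta>_shift_msubst)
  finally have rescaled: "hirota_rescaled (change_vars x (?\<tau> * mexp ?Q)) = (mexp H * mconst (fps_nth x 1))
      * (msubst \<theta> (hirota_rescaled ?\<tau>) * mfps (fps_deriv x * J\<^sup>2) (mvar Zinv))" .
  have "residue_free (hirota_rescaled ?\<tau>)"
    using \<Phi> by (simp add: KP_solution_def flip: hirota_iff_residue_free)
  then have "residue_free (hirota_rescaled (change_vars x (?\<tau> * mexp ?Q)))"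
    unfolding rescaled
    by (intro residue_free_mult residue_free_\<theta> kp_homog_mult_0 kp_homog_mexp kp_homog_mconst H)
  then show ?thesis
    by (simp add: KP_solution_def \<tau> flip: hirota_iff_residue_free)
qed

end

section \<open>Invertibility\<close>

lemma coordinate_exists:
  fixes x :: "'a :: {idom, rat_algebra} fps"
  assumes "fps_nth x 0 = 0" "d * fps_nth x 1 = 1"
  obtains J where "coordinate x J"
proof -
  have "d * fps_nth (fps_shift 1 x) 0 = 1" using assms(2) by simp
  then obtain J where "fps_shift 1 x * J = 1" using fps_unit_ex by blast
  then show thesis using assms(1) that by (auto simp: coordinate_def)
qed

text \<open>On the linear form with coefficients f, the substitution by y acts as f to
  \<open>f oo y\<close>. Changes of variables therefore compose contravariantly: first x and then y
  amounts to \<open>x oo y\<close>.\<close>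

lemma (in coordinate) change_vars_compose:
  assumes y: "coordinate y J'" and xy: "x oo y = fps_X"
  shows "change_vars y (change_vars x F) = F"
proof -
  interpret y: coordinate y J' by (rule y)
  let ?l = "\<lambda>f. msum (\<lambda>j. mconst (fps_nth f (Suc j)) * mvar j) :: (nat, 'a) mps"
  let ?s = "\<lambda>i. ?l (x ^ Suc i)" and ?t = "\<lambda>i. ?l (y ^ Suc i)"
  have t: "msubst ?t (?l f) = ?l (f oo y)" for f
  proof (rule mps_eqI)
    fix m
    have sum: "msummable (\<lambda>j. mconst (fps_nth f (Suc j)) * ?t j)"
      by (intro msummable_mult_family2 madm_summable y.madm_change)
    have lin: "mcoeff (?l g) {#k#} = fps_nth g (Suc k)" for g k
    proof -
      have "mcoeff (?l g) {#k#} = mcoeff (mconst (fps_nth g (Suc k)) * mvar k) {#k#}"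
        by (rule mcoeff_msum_single) (auto simp: mcoeff_mvar split: if_splits)
      then show ?thesis by (simp add: mcoeff_mvar)
    qed
    have lin_0: "mcoeff (?l g) m = 0" if "\<nexists>k. m = {#k#}" for g
      unfolding mcoeff_msum using that by (simp add: mcoeff_mvar)
    have "mcoeff (msubst ?t (?l f)) m = mcoeff (msum (\<lambda>j. mconst (fps_nth f (Suc j)) * ?t j)) m"
      by (simp add: msubst_msum(1) [OF y.madm_change msummable_scaled_mvar] msubst_mult y.madm_change
          del: power_Suc)
    also have "\<dots> = mcoeff (?l (f oo y)) m"
    proof (cases "\<exists>k. m = {#k#}")
      case True
      then obtain k where k: "m = {#k#}" by blast
      have nz: "j \<le> k" if "fps_nth (y ^ Suc j) (Suc k) \<noteq> 0" for j
        using that startsby_zero_power_prefix [OF y.x0, of "Suc j"] by (meson Suc_le_mono not_less)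
      have "mcoeff (msum (\<lambda>j. mconst (fps_nth f (Suc j)) * ?t j)) m
          = (\<Sum>j\<in>{..k}. mcoeff (mconst (fps_nth f (Suc j)) * ?t j) m)"
      proof (rule mcoeff_msum_superset)
        fix j assume "mcoeff (mconst (fps_nth f (Suc j)) * ?t j) m \<noteq> 0"
        then show "j \<in> {..k}" using nz [of j] by (simp add: lin k del: power_Suc)
      qed simp
      also have "\<dots> = (\<Sum>j\<in>{..k}. fps_nth f (Suc j) * fps_nth (y ^ Suc j) (Suc k))"
        by (simp add: lin k del: power_Suc)
      also have "\<dots> = fps_nth (f oo y) (Suc k)"
        unfolding fps_compose_nth atMost_atLeast0
        by (subst sum.atLeast0_atMost_Suc_shift) (simp del: power_Suc)
      finally show ?thesis by (simp add: lin k)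
    next
      case False
      then show ?thesis
        unfolding mcoeff_msum [of "\<lambda>j. mconst (fps_nth f (Suc j)) * ?t j"] by (simp add: lin_0)
    qed
    finally show "mcoeff (msubst ?t (?l f)) m = mcoeff (?l (f oo y)) m" .
  qed
  have "msubst ?t (?s i) = mvar i" for i
  proof -
    have "(x ^ Suc i) oo y = fps_X ^ Suc i"
      using fps_compose_power [OF y.x0, of x "Suc i"] xy by simp
    then have "msubst ?t (?s i) = ?l (fps_X ^ Suc i)" unfolding t by simp
    also have "\<dots> = mconst 1 * mvar i"
      by (subst msum_single [of i]) (auto simp: fps_X_power_iff simp del: power_Suc)
    finally show ?thesis by simp
  qed
  then have "(\<lambda>i. msubst ?t (?s i)) = mvar" by (rule ext)
  then show ?thesis
    unfolding change_vars_def msubst_msubst [OF y.madm_change madm_change] by simp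
qed

text \<open>The matrix of the transformed quadratic form. For x without constant term the ranges up
  to k and l are complete, because x^(i+1) has no term of degree k + 1 when i > k.\<close>

definition change_coeff :: "'a :: comm_ring_1 fps \<Rightarrow> (nat \<Rightarrow> nat \<Rightarrow> 'a) \<Rightarrow> nat \<Rightarrow> nat \<Rightarrow> 'a" where
  "change_coeff x c k l = (\<Sum>p\<in>{..k} \<times> {..l}.
     c (fst p) (snd p) * fps_nth (x ^ Suc (fst p)) (Suc k) * fps_nth (x ^ Suc (snd p)) (Suc l))"

text \<open>Kept general in r and r': variables give the change of variables of a quadratic
  function, powers of a series give that of its polar form. The sums may be exchanged since c_k^b =
  0 for k < b.\<close>

lemma (in coordinate) mbil_change:
  fixes r r' :: "nat \<Rightarrow> ('v, 'a) mps"
  assumes r: "msummable r" and r': "msummable r'"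
  shows "mbil c (\<lambda>i. msum (\<lambda>k. mconst (fps_nth (x ^ Suc i) (Suc k)) * r k))
      (\<lambda>j. msum (\<lambda>l. mconst (fps_nth (x ^ Suc j) (Suc l)) * r' l))
    = mbil (change_coeff x c) r r'"
proof -
  let ?X = "\<lambda>i k. fps_nth (x ^ Suc i) (Suc k)"
  have X: "i \<le> k" if "?X i k \<noteq> 0" for i k
    using that startsby_zero_power_prefix [OF x0, of "Suc i"] by (meson Suc_le_mono not_less)
  let ?d = "\<lambda>p q. c (fst p) (snd p) * ?X (fst p) (fst q) * ?X (snd p) (snd q)"
  have d: "p \<in> {..fst q} \<times> {..snd q}" if "?d p q \<noteq> 0" for p q
    using that X [of "fst p" "fst q"] X [of "snd p" "snd q"] by (cases p) auto
  let ?f = "\<lambda>p q. mconst (?d p q) * (case q of (k, l) \<Rightarrow> r k * r' l)"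
  have rr: "msummable (\<lambda>(k, l). r k * r' l)" by (rule msummable_prod [OF r r'])
  have sum: "msummable (\<lambda>(p, q). ?f p q)"
    unfolding msummable_def
  proof
    fix m
    let ?S = "{q. mcoeff (case q of (k, l) \<Rightarrow> r k * r' l) m \<noteq> 0}"
    have "{z. mcoeff (case z of (p, q) \<Rightarrow> ?f p q) m \<noteq> 0}
        \<subseteq> prod.swap ` (SIGMA q : ?S. {..fst q} \<times> {..snd q})"
    proof
      fix z assume z: "z \<in> {z. mcoeff (case z of (p, q) \<Rightarrow> ?f p q) m \<noteq> 0}"
      obtain p q where pq: "z = (p, q)" by (cases z)
      have nz: "?d p q * mcoeff (case q of (k, l) \<Rightarrow> r k * r' l) m \<noteq> 0"
        using z by (simp add: pq)
      then have "?d p q \<noteq> 0" "q \<in> ?S" by auto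
      then have "(q, p) \<in> (SIGMA q : ?S. {..fst q} \<times> {..snd q})" using d [of p q] by blast
      then show "z \<in> prod.swap ` (SIGMA q : ?S. {..fst q} \<times> {..snd q})"
        by (intro image_eqI [of _ _ "(q, p)"]) (simp_all add: pq)
    qed
    moreover have "finite (prod.swap ` (SIGMA q : ?S. {..fst q} \<times> {..snd q}))"
      using msummableD [OF rr, of m] by auto
    ultimately show "finite {z. mcoeff (case z of (p, q) \<Rightarrow> ?f p q) m \<noteq> 0}"
      by (rule finite_subset)
  qed
  have "mconst (c i j) * msum (\<lambda>k. mconst (?X i k) * r k) * msum (\<lambda>l. mconst (?X j l) * r' l)
      = msum (?f (i, j))" for i j
  proof -
    have "msum (\<lambda>k. mconst (?X i k) * r k) * msum (\<lambda>l. mconst (?X j l) * r' l)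
        = msum (\<lambda>(k, l). (mconst (?X i k) * r k) * (mconst (?X j l) * r' l))"
      by (intro msum_mult msummable_mult_family2 r r')
    then have "mconst (c i j) * (msum (\<lambda>k. mconst (?X i k) * r k) * msum (\<lambda>l. mconst (?X j l) * r' l))
        = msum (\<lambda>q. mconst (c i j) * (case q of (k, l) \<Rightarrow> (mconst (?X i k) * r k) * (mconst (?X j l) * r' l)))"
      by (simp only:) (intro msum_mult_left msummable_prod msummable_mult_family2 r r')
    also have "\<dots> = msum (?f (i, j))"
      by (rule msum_cong) (simp add: case_prod_unfold mconst_mult ac_simps del: power_Suc)
    finally show ?thesis by (simp only: mult.assoc)
  qed
  then have "mbil c (\<lambda>i. msum (\<lambda>k. mconst (?X i k) * r k)) (\<lambda>j. msum (\<lambda>l. mconst (?X j l) * r' l))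
      = msum (\<lambda>p. msum (?f p))"
    unfolding mbil_def by (intro msum_cong) (simp add: case_prod_unfold)
  also have "\<dots> = msum (\<lambda>q. msum (\<lambda>p. ?f p q))"
    by (rule msum_swap [OF sum])
  also have "\<dots> = mbil (change_coeff x c) r r'"
    unfolding mbil_def
  proof (rule msum_cong, rule mps_eqI)
    fix q m
    have "mcoeff (msum (\<lambda>p. ?f p q)) m = (\<Sum>p\<in>{..fst q} \<times> {..snd q}. mcoeff (?f p q) m)"
    proof (rule mcoeff_msum_superset)
      fix p assume "mcoeff (?f p q) m \<noteq> 0"
      then have "?d p q \<noteq> 0" by auto
      then show "p \<in> {..fst q} \<times> {..snd q}" by (rule d)
    qed simp
    then show "mcoeff (msum (\<lambda>p. ?f p q)) m
        = mcoeff (case q of (k, l) \<Rightarrow> mconst (change_coeff x c k l) * r k * r' l) m"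
      by (cases q) (simp add: change_coeff_def mult.assoc [of "mconst _"] sum_distrib_right del: power_Suc)
  qed
  finally show ?thesis .
qed

lemma (in coordinate) change_vars_mbil:
  "change_vars x (mbil c mvar mvar) = mbil (change_coeff x c) mvar mvar"
proof -
  have mvar: "msummable (mvar :: nat \<Rightarrow> (nat, 'a) mps)" by (intro madm_summable madm_mvar)
  show ?thesis
    unfolding change_vars_def msubst_mbil [OF madm_change mvar mvar] msubst_mvar
    by (rule mbil_change [OF mvar mvar])
qed

lemma (in coordinate) bil_change_coeff:
  fixes F G :: "('v, 'a) mps"
  assumes "mcoeff F {#} = 0" "mcoeff G {#} = 0"
  shows "bil (change_coeff x c) F G = bil c (mfps x F) (mfps x G)"
proof -
  have sym: "change_coeff x (\<lambda>i j. c i j + c j i) k l = change_coeff x c k l + change_coeff x c l k" for k l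
  proof -
    have "change_coeff x (\<lambda>i j. c j i) k l = change_coeff x c l k"
      unfolding change_coeff_def
      by (rule sum.reindex_bij_witness [of _ prod.swap prod.swap]) (auto simp: ac_simps simp del: power_Suc)
    then show ?thesis
      by (simp add: change_coeff_def distrib_right sum.distrib del: power_Suc)
  qed
  have pow: "mfps x F ^ Suc i = msum (\<lambda>k. mconst (fps_nth (x ^ Suc i) (Suc k)) * F ^ Suc k)"
    if "mcoeff F {#} = 0" for F :: "('v, 'a) mps" and i
    using msum_power_eq_mfps [OF that, of "x ^ Suc i"] that x0 by (simp add: mfps_power del: power_Suc)
  have "bil c (mfps x F) (mfps x G)
      = mbil (change_coeff x (\<lambda>i j. c i j + c j i)) (\<lambda>i. F ^ Suc i) (\<lambda>j. G ^ Suc j)"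
    unfolding bil_def pow [OF assms(1)] pow [OF assms(2)]
    by (intro mbil_change msummable_power_Suc assms)
  also have "change_coeff x (\<lambda>i j. c i j + c j i) = (\<lambda>k l. change_coeff x c k l + change_coeff x c l k)"
    by (intro ext sym)
  finally show ?thesis by (simp only: bil_def)
qed

theorem KP_automorphism_compatible:
  fixes x :: "'a :: {idom, rat_algebra} fps"
  assumes x0: "fps_nth x 0 = 0" and d: "d * fps_nth x 1 = 1" and c: "compatible x c"
  shows "KP_automorphism (KP_transform x (mbil c mvar mvar))"
proof -
  obtain J where J: "coordinate x J" using coordinate_exists [OF x0 d] .
  obtain y where y0: "fps_nth y 0 = 0" and y1: "fps_nth y 1 * fps_nth x 1 = 1"
    and yx: "y oo x = fps_X" and xy: "x oo y = fps_X"
    using fps_compose_inverse [OF x0 d] by blast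
  have "fps_nth x 1 * fps_nth y 1 = 1" using y1 by (simp add: mult.commute)
  then obtain J' where J': "coordinate y J'" using coordinate_exists [OF y0] by blast
  interpret x: coordinate x J by (rule J)
  interpret y: coordinate y J' by (rule J')
  \<comment> \<open>The coefficients of -Q carried over by x: adding this function after the first
    transformation removes Q, and the substitution by y then undoes that by x. Its polar form at
    y(u), y(v) is minus that of c at u, v, as \<open>compatible_inverse\<close> asks.\<close>
  let ?c' = "\<lambda>i j. - change_coeff x c i j"
  let ?Q = "mbil c mvar mvar :: (nat, 'a) mps" and ?Q' = "mbil ?c' mvar mvar :: (nat, 'a) mps"
  have Q': "?Q' = - change_vars x ?Q"
    unfolding x.change_vars_mbil unfolding mbil_def
    by (subst msum_uminus [symmetric]) (simp add: case_prod_unfold mconst_uminus)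
  have "bil ?c' (mfps y (mvar False)) (mfps y (mvar True)) = - bil c (mvar False) (mvar True :: (bool, 'a) mps)"
  proof -
    have neg: "bil ?c' F G = - bil (change_coeff x c) F G" for F G :: "(bool, 'a) mps"
      unfolding bil_def mbil_def
      by (subst msum_uminus [symmetric])
        (simp add: case_prod_unfold mconst_uminus mconst_add mconst_diff algebra_simps del: power_Suc)
    show ?thesis
      unfolding neg using y0 by (simp add: x.bil_change_coeff xy flip: mfps_compose)
  qed
  then have c': "compatible y ?c'"
    by (rule compatible_inverse [OF x0 y0 xy yx y1 c])
  have add: "change_vars x (F + G) = change_vars x F + change_vars x G" for F G
    unfolding change_vars_def by (rule msubst_add [OF x.madm_change])
  have inv: "KP_transform y ?Q' (KP_transform x ?Q F) = F" "KP_transform x ?Q (KP_transform y ?Q' F) = F" for F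
    unfolding KP_transform_def Q' add
    by (simp_all add: x.change_vars_compose [OF J' xy] y.change_vars_compose [OF J yx])
  show ?thesis
    unfolding KP_automorphism_def
  proof (rule bij_betw_byWitness [of _ "KP_transform y ?Q'"])
    show "KP_transform x ?Q ` {F. KP_solution F} \<subseteq> {F. KP_solution F}"
      using x.KP_transform_solution [OF c] by blast
    show "KP_transform y ?Q' ` {F. KP_solution F} \<subseteq> {F. KP_solution F}"
      using y.KP_transform_solution [OF c'] by blast
  qed (simp_all add: inv)
qed

section \<open>The Euler derivation\<close>

text \<open>Total degree in all variables together, so that the term of H_{0,2} with indices b1, b2
  is multiplied by its denominator b1 + b2.\<close>

definition meuler :: "('v, 'a :: comm_ring_1) mps \<Rightarrow> ('v, 'a) mps" where
  "meuler F = Abs_mps (\<lambda>m. of_nat (size m) * mcoeff F m)"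

lemma mcoeff_meuler [simp]: "mcoeff (meuler F) m = of_nat (size m) * mcoeff F m"
  by (simp add: meuler_def Abs_mps_inverse)

lemma meuler_diff: "meuler (F - G) = meuler F - meuler G"
  by (rule mps_eqI) (simp add: right_diff_distrib)

lemma meuler_uminus: "meuler (- F) = - meuler F"
  by (rule mps_eqI) simp

lemma meuler_mconst [simp]: "meuler (mconst c) = 0"
  by (rule mps_eqI) (simp add: mcoeff_mconst)

lemma meuler_mmono: "meuler (mmono m) = mconst (of_nat (size m)) * mmono m"
  by (rule mps_eqI) (simp add: mcoeff_mmono)

lemma meuler_mult: "meuler (F * G) = meuler F * G + F * meuler G"
proof (rule mps_eqI)
  fix m
  have "mcoeff (meuler (F * G)) m
      = (\<Sum>p\<in>{(a, b). a + b = m}. of_nat (size m) * (mcoeff F (fst p) * mcoeff G (snd p)))"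
    by (simp add: mcoeff_mult case_prod_unfold sum_distrib_left)
  also have "\<dots> = (\<Sum>p\<in>{(a, b). a + b = m}. of_nat (size (fst p)) * mcoeff F (fst p) * mcoeff G (snd p)
      + mcoeff F (fst p) * (of_nat (size (snd p)) * mcoeff G (snd p)))"
    by (rule sum.cong) (auto simp: algebra_simps)
  also have "\<dots> = mcoeff (meuler F * G + F * meuler G) m"
    by (simp add: mcoeff_mult case_prod_unfold sum.distrib)
  finally show "mcoeff (meuler (F * G)) m = mcoeff (meuler F * G + F * meuler G) m" .
qed

lemma meuler_power: "meuler (F ^ Suc n) = of_nat (Suc n) * (F ^ n * meuler F)"
proof (induction n)
  case (Suc n)
  have "meuler (F ^ Suc (Suc n)) = meuler F * F ^ Suc n + F * meuler (F ^ Suc n)"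
    by (simp only: power_Suc [of F "Suc n"] meuler_mult)
  then show ?case unfolding Suc by (simp add: algebra_simps)
qed simp

lemma meuler_msum:
  assumes "msummable f"
  shows "meuler (msum f) = msum (\<lambda>i. meuler (f i))"
  by (rule mps_eqI) (simp add: mcoeff_msum Sum_any_right_distrib [OF msummableD [OF assms]])

lemma meuler_mfps:
  fixes F :: "('v, 'a :: comm_ring_1) mps"
  assumes F: "mcoeff F {#} = 0"
  shows "meuler (mfps f F) = mfps (fps_deriv f) F * meuler F"
proof -
  have meuler_1: "meuler (1 :: ('v, 'a) mps) = 0"
    by (rule mps_eqI) (simp add: mcoeff_one)
  have "meuler (mfps f F) = msum (\<lambda>n. mconst (fps_nth f n) * meuler (F ^ n))"
    unfolding mfps_def meuler_msum [OF msummable_mfps [OF F]] by (simp add: meuler_mult)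
  also have "\<dots> = msum (\<lambda>n. mconst (fps_nth f (Suc n)) * meuler (F ^ Suc n))"
    using meuler_1 by (subst msum_Suc) simp_all
  also have "\<dots> = msum (\<lambda>n. mconst (fps_nth (fps_deriv f) n) * F ^ n * meuler F)"
    unfolding meuler_power
    by (rule msum_cong) (simp add: mconst_mult mconst_of_nat mconst_add algebra_simps)
  also have "\<dots> = mfps (fps_deriv f) F * meuler F"
    unfolding mfps_def by (intro msum_mult_right [symmetric] msummable_mfps F)
  finally show ?thesis .
qed

lemma meuler_mvar: "meuler (mvar v) = mvar v"
  by (simp add: mvar_eq_mmono meuler_mmono)

lemma meuler_mexp:
  fixes F :: "('v, 'a :: rat_algebra) mps"
  shows "mcoeff F {#} = 0 \<Longrightarrow> meuler (mexp F) = mexp F * meuler F"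
  unfolding mexp_eq_mfps by (simp add: meuler_mfps fexp_deriv)

text \<open>K has constant term 1, so in degree n the difference of two solutions satisfies (n - 1)
  H_m = terms from lower degrees. Degree 1 stays undetermined, hence the initial data up to size
  1.\<close>

lemma meuler_ode_unique:
  fixes F G :: "('v, 'a :: rat_algebra) mps"
  assumes F: "meuler F = K * F" and G: "meuler G = K * G" and K: "mcoeff K {#} = 1"
    and init: "\<And>m. size m \<le> 1 \<Longrightarrow> mcoeff F m = mcoeff G m"
  shows "F = G"
proof -
  define H where "H = F - G"
  have H: "meuler H = K * H"
    by (simp add: H_def meuler_diff F G right_diff_distrib)
  have "mcoeff H m = 0" for m
  proof (induction m rule: measure_induct_rule [of size])
    case (less m)
    show ?case
    proof (cases "size m \<le> 1")
      case True
      then show ?thesis by (simp add: H_def init)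
    next
      case False
      have "(\<Sum>(a, b)\<in>{(a, b). a + b = m}. mcoeff K a * mcoeff H b)
          = (\<Sum>(a, b)\<in>{({#} :: 'v multiset, m)}. mcoeff K a * mcoeff H b)"
      proof (rule sum.mono_neutral_right [OF finite_msplit])
        show "\<forall>p\<in>{(a, b). a + b = m} - {({#}, m)}. (case p of (a, b) \<Rightarrow> mcoeff K a * mcoeff H b) = 0"
        proof
          fix p assume p: "p \<in> {(a, b). a + b = m} - {({#}, m)}"
          then have m: "m = fst p + snd p" "fst p \<noteq> {#}" by (cases p; auto)+
          then have "size (snd p) < size m" by (simp add: nonempty_has_size)
          then show "(case p of (a, b) \<Rightarrow> mcoeff K a * mcoeff H b) = 0"
            using less by (simp add: case_prod_unfold)
        qed
      qed auto
      then have "mcoeff (K * H) m = mcoeff H m" by (simp add: mcoeff_mult K)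
      then have "of_nat (size m) * mcoeff H m = mcoeff H m" using arg_cong [OF H, of "\<lambda>F. mcoeff F m"] by simp
      moreover have "of_nat (size m) = of_nat (size m - 1) + (1 :: 'a)"
        using False by (simp add: of_nat_diff)
      ultimately have "of_nat (size m - 1) * mcoeff H m = of_nat (size m - 1) * 0"
        by (simp add: algebra_simps)
      then show ?thesis by (rule rat_cancel [rotated]) (use False in simp)
    qed
  qed
  then have "H = 0" by (simp add: mps_eqI)
  then show ?thesis by (simp add: H_def)
qed

lemma mcoeff_mult_single:
  "mcoeff (F * G) {#v#} = mcoeff F {#v#} * mcoeff G {#} + mcoeff F {#} * mcoeff G {#v#}"
proof -
  have "{(a, b). a + b = {#v#}} = {({#v#}, {#}), ({#}, {#v#})}"
    by (auto simp: union_is_single)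
  then show ?thesis by (simp add: mcoeff_mult)
qed

section \<open>The tree function\<close>

definition fexp_lin :: "'a :: rat_algebra \<Rightarrow> 'a fps" where
  "fexp_lin c = Abs_fps (\<lambda>n. c ^ n * (1 / of_nat (fact n)))"

lemma fexp_lin_nth: "fps_nth (fexp_lin c) n = c ^ n * (1 / of_nat (fact n))"
  by (simp add: fexp_lin_def)

lemma fexp_lin_nth_0: "fps_nth (fexp_lin c) 0 = 1"
  using one_divide_fact_0 [where 'a = 'a] by (simp add: fexp_lin_nth)

lemma fexp_lin_add: "fexp_lin (c + d) = fexp_lin c * fexp_lin d"
proof (rule fps_ext)
  fix n
  have "fps_nth (fexp_lin c * fexp_lin d) n
      = (\<Sum>i\<le>n. (c ^ i * d ^ (n - i)) * ((1 / of_nat (fact i)) * (1 / of_nat (fact (n - i)))))"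
    by (simp add: fps_mult_nth fexp_lin_nth ac_simps atLeast0AtMost)
  also have "\<dots> = (\<Sum>i\<le>n. (c ^ i * d ^ (n - i)) * ((1 / of_nat (fact n)) * of_nat (n choose i)))"
    by (intro sum.cong refl) (simp add: divide_fact_binomial)
  also have "\<dots> = (1 / of_nat (fact n)) * (c + d) ^ n"
    by (simp add: binomial_ring sum_distrib_left ac_simps)
  finally show "fps_nth (fexp_lin (c + d)) n = fps_nth (fexp_lin c * fexp_lin d) n"
    by (simp add: fexp_lin_nth mult.commute)
qed

lemma fexp_lin_0: "fexp_lin 0 = 1"
  by (rule fps_ext) (use fexp_lin_nth_0 [of 0] in \<open>auto simp: fexp_lin_nth power_0_left\<close>)

lemma fexp_lin_power: "fexp_lin c ^ n = fexp_lin (of_nat n * c)"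
  by (induction n) (simp_all add: fexp_lin_0 distrib_right flip: fexp_lin_add)

lemma fexp_lin_deriv: "fps_deriv (fexp_lin c) = fps_const c * fexp_lin c"
proof (rule fps_ext)
  fix n
  have "of_nat (Suc n) * (1 / of_nat (fact (Suc n))) = (1 / of_nat (fact n) :: 'a)"
    using arg_cong [OF fexp_deriv [where 'a = 'a], of "\<lambda>f. fps_nth f n"]
    by (simp add: fexp_nth del: of_nat_Suc fact_Suc)
  then have "of_nat (Suc n) * (c ^ Suc n * (1 / of_nat (fact (Suc n)))) = c ^ Suc n * (1 / of_nat (fact n))"
    by (metis mult.left_commute)
  then show "fps_nth (fps_deriv (fexp_lin c)) n = fps_nth (fps_const c * fexp_lin c) n"
    by (simp add: fexp_lin_nth mult.assoc del: of_nat_Suc fact_Suc)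
qed

lemma fexp_lin_eq_compose: "fexp oo (fps_const c * fps_X) = fexp_lin c"
proof (rule fps_ext)
  fix n
  have *: "fps_nth ((fps_const c * fps_X) ^ i) n = (if i = n then c ^ n else 0)" for i
    by (simp add: power_mult_distrib fps_const_power fps_X_power_iff)
  have "fps_nth (fexp oo (fps_const c * fps_X)) n
      = (\<Sum>i = 0..n. if i = n then (1 / of_nat (fact n)) * c ^ n else 0)"
    unfolding fps_compose_nth * fexp_nth by (intro sum.cong refl) simp
  then show "fps_nth (fexp oo (fps_const c * fps_X)) n = fps_nth (fexp_lin c) n"
    by (simp add: fexp_lin_nth mult.commute)
qed

text \<open>T solves T = v exp (beta T); it is the Cayley tree series with coefficients b^(b-1)
  beta^(b-1) / b!.\<close>

locale tree_function =
  fixes \<beta> :: "'a :: {idom, rat_algebra}" and T :: "'a fps"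
  assumes T0: "fps_nth T 0 = 0" and T_left: "T oo (fps_X * fexp_lin (- \<beta>)) = fps_X"
    and T_right: "(fps_X * fexp_lin (- \<beta>)) oo T = fps_X"
begin

lemma fexp_lin_inverse: "fexp_lin \<beta> * fexp_lin (- \<beta>) = 1"
  by (simp add: fexp_lin_0 flip: fexp_lin_add)

text \<open>Lagrange inversion of X exp (- beta X), whose J is exp (beta X).\<close>

lemma nth_T: "of_nat (Suc b) * fps_nth T (Suc b) = of_nat (Suc b) ^ b * \<beta> ^ b * (1 / of_nat (fact b))"
proof -
  have "fexp_lin \<beta> * (fps_X * fexp_lin (- \<beta>)) = fps_X"
    using fexp_lin_inverse by (simp add: mult.left_commute)
  from fps_lagrange_inversion [OF _ this T_left, of b] show ?thesis
    by (simp add: fexp_lin_power fexp_lin_nth power_mult_distrib del: of_nat_Suc power_Suc)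
qed

definition weight :: "nat \<Rightarrow> 'a" where
  "weight b = of_nat (b ^ b) * (1 / of_nat (fact b))"

lemma weight_eq: "\<beta> * (of_nat (Suc b) * fps_nth T (Suc b)) = weight (Suc b) * \<beta> ^ Suc b"
proof -
  have "of_nat (Suc b) * (1 / of_nat (fact (Suc b))) = (1 / of_nat (fact b) :: 'a)"
    using arg_cong [OF fexp_deriv [where 'a = 'a], of "\<lambda>f. fps_nth f b"]
    by (simp add: fexp_nth del: of_nat_Suc fact_Suc)
  then have "weight (Suc b) = of_nat (Suc b) ^ b * (1 / of_nat (fact b))"
    unfolding weight_def power_Suc2 of_nat_mult of_nat_power by (simp only: mult.assoc)
  then show ?thesis
    unfolding nth_T by (simp only: power_Suc ac_simps)
qed

text \<open>This is 1 / (1 - beta T). Then gamma - 1 = beta X T', which has exactly the coefficients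
  b^b beta^b / b! found in H_{0,2}.\<close>

definition \<gamma> :: "'a fps" where
  "\<gamma> = fps_right_inverse (1 - fps_const \<beta> * T) 1"

lemma \<gamma>: "(1 - fps_const \<beta> * T) * \<gamma> = 1"
  unfolding \<gamma>_def by (rule fps_right_inverse) (simp add: T0)

text \<open>Differentiate T exp (- beta T) = X and multiply by X = T exp (- beta T) to remove the
  exponential.\<close>

lemma X_deriv_T: "fps_X * fps_deriv T = \<gamma> * T"
proof -
  let ?e = "fexp_lin (- \<beta>) oo T"
  have "fps_deriv (fps_X * fexp_lin (- \<beta>)) = (1 - fps_const \<beta> * fps_X) * fexp_lin (- \<beta>)"
    by (simp add: fexp_lin_deriv algebra_simps flip: fps_const_neg)
  then have "(((1 - fps_const \<beta> * fps_X) * fexp_lin (- \<beta>)) oo T) * fps_deriv T = 1"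
    using arg_cong [OF T_right, of fps_deriv] unfolding fps_compose_deriv [OF T0] by simp
  then have "((1 - fps_const \<beta> * T) * ?e) * fps_deriv T = 1"
    using T0 by (simp add: fps_compose_mult_distrib fps_compose_sub_distrib)
  moreover have "T * ?e = fps_X"
    using T_right T0 by (simp add: fps_compose_mult_distrib)
  ultimately have "(1 - fps_const \<beta> * T) * (fps_X * fps_deriv T) = T"
    by (metis (no_types, lifting) mult.assoc mult.commute mult_1_right)
  then have "\<gamma> * T = ((1 - fps_const \<beta> * T) * \<gamma>) * (fps_X * fps_deriv T)"
    by (simp only: ac_simps)
  then show ?thesis by (simp add: \<gamma>)
qed

text \<open>
  Divided by the exponential, both sides solve the same first-order equation for the Euler
  derivation and have the same linear part.
\<close>

lemma tree_exp_identity: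
  fixes c :: "nat \<Rightarrow> nat \<Rightarrow> 'a"
  assumes c: "\<And>i j. of_nat (Suc i + Suc j) * (c i j + c j i)
    = - (weight (Suc i) * weight (Suc j) * \<beta> ^ (Suc i + Suc j))"
  shows "(mfps T (mvar True) - mfps T (mvar False)) * mexp (bil c (mvar False) (mvar True))
    = mfps T (mvar True) * mfps (fexp_lin \<beta> oo T) (mvar False)
      - mfps T (mvar False) * mfps (fexp_lin \<beta> oo T) (mvar True)"
proof -
  let ?t = "\<lambda>v. mfps T (mvar v) :: (bool, 'a) mps"
  let ?e = "\<lambda>v. mfps (fexp_lin \<beta> oo T) (mvar v) :: (bool, 'a) mps"
  let ?g = "\<lambda>v. mfps \<gamma> (mvar v) :: (bool, 'a) mps"
  let ?B = "bil c (mvar False) (mvar True) :: (bool, 'a) mps" and ?b = "mconst \<beta> :: (bool, 'a) mps"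
  \<comment> \<open>As exp (beta T(v)) = T(v) / v, N is T1 T2 (1/v1 - 1/v2), and the claim reads exp
    B = (1/v1 - 1/v2) / (1/T1 - 1/T2) with denominators cleared.\<close>
  let ?N = "?t True * ?e False - ?t False * ?e True"
  have g: "?b * (?g v * ?t v) = ?g v - 1" for v
  proof -
    have "fps_const \<beta> * (\<gamma> * T) = \<gamma> - 1" using \<gamma> by (simp add: algebra_simps)
    then have "mfps (fps_const \<beta> * (\<gamma> * T)) (mvar v) = (mfps (\<gamma> - 1) (mvar v) :: (bool, 'a) mps)" by simp
    then show ?thesis by (simp add: mfps_mult mfps_diff)
  qed
  have dt: "meuler (?t v) = ?g v * ?t v" for v
  proof -
    have "meuler (?t v) = mfps (fps_X * fps_deriv T) (mvar v)"
      by (simp add: meuler_mfps meuler_mvar mfps_mult mult.commute)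
    then show ?thesis by (simp add: X_deriv_T mfps_mult)
  qed
  have de: "meuler (?e v) = ?e v * (?g v - 1)" for v
  proof -
    have e: "?e v = mfps (fexp_lin \<beta>) (?t v)" using T0 by (simp add: mfps_compose)
    have "meuler (?e v) = ?b * ?e v * (?g v * ?t v)"
      unfolding e using T0 by (simp add: meuler_mfps fexp_lin_deriv mfps_mult dt [symmetric])
    then show ?thesis by (simp only: g [symmetric] ac_simps)
  qed
  \<comment> \<open>T has logarithmic derivative g and exp (beta T) has g - 1, so both products in N
    have g1 + g2 - 1.\<close>
  have dN: "meuler ?N = (?g True + ?g False - 1) * ?N"
    by (simp add: meuler_diff meuler_mult dt de algebra_simps)
  \<comment> \<open>The factor b1 + b2 clears the denominators of the coefficients, and the double
    series splits into a product of two univariate ones.\<close>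
  have dB: "meuler ?B = - ((?g False - 1) * (?g True - 1))"
  proof -
    have f: "?g v - 1 = msum (\<lambda>i. mconst (weight (Suc i) * \<beta> ^ Suc i) * mvar v ^ Suc i)" for v
    proof -
      have "?g v - 1 = mfps (fps_const \<beta> * (fps_X * fps_deriv T)) (mvar v)"
        unfolding g [symmetric] X_deriv_T by (simp add: mfps_mult)
      also have "\<dots> = msum (\<lambda>i. mconst (fps_nth (fps_const \<beta> * (fps_X * fps_deriv T)) (Suc i)) * mvar v ^ Suc i)"
        by (rule msum_power_eq_mfps [symmetric]) simp_all
      finally show ?thesis by (simp add: weight_eq del: of_nat_Suc power_Suc)
    qed
    have s: "msummable (\<lambda>i. mconst (d i) * mvar v ^ Suc i :: (bool, 'a) mps)" for d v
      by (intro msummable_mult_family2 msummable_power_Suc) simp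
    have B: "msummable (\<lambda>(i, j). mconst (c i j + c j i) * mvar False ^ Suc i * mvar True ^ Suc j :: (bool, 'a) mps)"
      by (intro msummable_mbil msummable_power_Suc) simp_all
    have m: "meuler (mconst a * mvar False ^ Suc i * mvar True ^ Suc j)
        = mconst (of_nat (Suc i + Suc j) * a) * (mvar False ^ Suc i * mvar True ^ Suc j :: (bool, 'a) mps)" for a i j
      unfolding mult.assoc mmono_mon2 [symmetric]
      by (simp only: meuler_mult meuler_mconst meuler_mmono mult_zero_left add_0 mconst_mult)
        (simp add: mon2_def mult.left_commute mult.commute)
    have "meuler ?B = msum (\<lambda>(i, j). meuler (mconst (c i j + c j i) * mvar False ^ Suc i * mvar True ^ Suc j))"
      unfolding bil_def mbil_def meuler_msum [OF B] by (simp add: case_prod_unfold)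
    also have "\<dots> = msum (\<lambda>(i, j). - ((mconst (weight (Suc i) * \<beta> ^ Suc i) * mvar False ^ Suc i)
        * (mconst (weight (Suc j) * \<beta> ^ Suc j) * mvar True ^ Suc j)))"
      unfolding m c
      by (rule msum_cong)
        (simp only: case_prod_unfold power_add mconst_uminus mconst_mult mult_minus_left, simp only: ac_simps)
    also have "\<dots> = - ((?g False - 1) * (?g True - 1))"
      unfolding f msum_mult [OF s s] by (subst msum_uminus [symmetric]) (simp add: case_prod_unfold)
    finally show ?thesis .
  qed
  have B0: "mcoeff ?B {#} = 0" by (simp add: mcoeff_bil_empty)
  have g0: "fps_nth \<gamma> 0 = 1" using arg_cong [OF \<gamma>, of "\<lambda>f. fps_nth f 0"] T0 by simp
  have e0: "mcoeff (?e v) {#} = 1" for v by (simp add: fexp_lin_nth_0)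
  have t0: "mcoeff (?t v) {#} = 0" for v by (simp add: T0)
  \<comment> \<open>Both sides have logarithmic derivative g1 g2. On the right it is g1 + g2 - 1 +
    (g1 - 1) (g2 - 1); on the left g1 T1 (g2 - 1) = beta g1 T1 g2 T2 is symmetric in the two
    variables, so these terms cancel.\<close>
  have eq: "?t True - ?t False = ?N * mexp (- ?B)"
  proof (rule meuler_ode_unique)
    show "meuler (?t True - ?t False) = (?g True * ?g False) * (?t True - ?t False)"
    proof -
      have "(?g True * ?g False) * (?t True - ?t False)
          = ?g True * ?t True * (?g False - 1) - ?g False * ?t False * (?g True - 1)
            + (?g True * ?t True - ?g False * ?t False)"
        by (simp add: algebra_simps)
      also have "?g True * ?t True * (?g False - 1) = ?g False * ?t False * (?g True - 1)"
        unfolding g [symmetric] by (simp only: ac_simps)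
      finally show ?thesis by (simp add: meuler_diff dt)
    qed
    have "meuler (mexp (- ?B)) = mexp (- ?B) * ((?g False - 1) * (?g True - 1))"
      using B0 dB by (simp add: meuler_mexp meuler_uminus)
    then have "meuler (?N * mexp (- ?B)) = ((?g True + ?g False - 1) * ?N) * mexp (- ?B)
        + ?N * (mexp (- ?B) * ((?g False - 1) * (?g True - 1)))"
      by (simp only: meuler_mult dN)
    also have "\<dots> = (?g True + ?g False - 1 + (?g False - 1) * (?g True - 1)) * (?N * mexp (- ?B))"
    proof -
      have "(k * n) * e + n * (e * l) = (k + l) * (n * e)" for k l n e :: "(bool, 'a) mps"
        by (simp add: algebra_simps)
      then show ?thesis .
    qed
    also have "?g True + ?g False - 1 + (?g False - 1) * (?g True - 1) = ?g True * ?g False"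
      by (simp add: algebra_simps)
    finally show "meuler (?N * mexp (- ?B)) = (?g True * ?g False) * (?N * mexp (- ?B))" .
    show "mcoeff (?g True * ?g False) {#} = 1" by (simp add: g0)
    fix m :: "bool multiset" assume "size m \<le> 1"
    then consider "m = {#}" | v where "m = {#v#}"
      by (metis le_Suc_eq One_nat_def le_zero_eq size_eq_0_iff_empty size_1_singleton_mset)
    then show "mcoeff (?t True - ?t False) m = mcoeff (?N * mexp (- ?B)) m"
    proof cases
      case 1
      then show ?thesis by (simp add: t0 T0)
    next
      case 2
      have "mcoeff (mexp (- ?B)) {#} = 1" using B0 by (simp add: mcoeff_mexp_empty)
      then show ?thesis
        unfolding 2 mcoeff_mult_single mcoeff_diff by (simp only: e0 t0 mcoeff_mult_single mcoeff_mult_empty) simp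
    qed
  qed
  show ?thesis
    unfolding eq mult.assoc using mexp_uminus [OF B0] by (simp add: mult.commute [of "mexp (- ?B)"])
qed

end

section \<open>Compatibility of H_{0,2} with the Hodge coordinate\<close>

lemma (in tree_function) compatible_tree:
  fixes \<tau> :: "'a fps"
  defines "x \<equiv> \<tau> * (fexp_lin (- \<beta>) oo \<tau>)"
  assumes \<tau>: "\<tau> * (1 + fps_const \<beta> * fps_X) = fps_X"
    and c: "\<And>i j. of_nat (Suc i + Suc j) * (c i j + c j i)
      = - (weight (Suc i) * weight (Suc j) * \<beta> ^ (Suc i + Suc j))"
  shows "fps_nth x 0 = 0" "fps_nth x 1 = 1" "compatible x c"
proof -
  define D where "D = 1 + fps_const \<beta> * fps_X"
  define E where "E = fexp_lin \<beta> oo \<tau>"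
  let ?X = "fps_shift 1 x"
  have \<tau>0: "fps_nth \<tau> 0 = 0" using arg_cong [OF \<tau>, of "\<lambda>f. fps_nth f 0"] by simp
  show x0: "fps_nth x 0 = 0" by (simp add: x_def \<tau>0)
  have w: "x = (fps_X * fexp_lin (- \<beta>)) oo \<tau>"
    by (simp add: x_def fps_compose_mult_distrib \<tau>0)
  \<comment> \<open>In the coordinate u the tree function becomes tau itself, as T inverts X exp (-
    beta X).\<close>
  have Tx: "T oo x = \<tau>"
    unfolding w using \<tau>0 by (simp add: fps_compose_assoc T_left)
  have EE: "(fexp_lin (- \<beta>) oo \<tau>) * E = 1"
    unfolding E_def using fexp_lin_inverse \<tau>0
    by (simp add: mult.commute flip: fps_compose_mult_distrib)
  have xE: "x * E = \<tau>" unfolding x_def mult.assoc EE by simp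
  \<comment> \<open>Records x / u = exp (- beta tau) / (1 + beta u) without quotients.\<close>
  have XED: "?X * E * D = 1"
  proof (rule fps_X_mult_cancel)
    have "fps_X * (?X * E * D) = (fps_X * ?X) * E * D" by (simp only: mult.assoc)
    then show "fps_X * (?X * E * D) = fps_X * 1"
      unfolding fps_X_mult_shift [OF x0] xE using \<tau> by (simp add: D_def)
  qed
  show x1: "fps_nth x 1 = 1"
    using arg_cong [OF XED, of "\<lambda>f. fps_nth f 0"] by (simp add: E_def D_def fexp_lin_nth_0)
  let ?a = "mvar False :: (bool, 'a) mps" and ?b = "mvar True :: (bool, 'a) mps"
  let ?xa = "mfps x ?a" and ?xb = "mfps x ?b"
  let ?B = "bil c ?xa ?xb"
  let ?Da = "mfps D ?a" and ?Db = "mfps D ?b" and ?Ea = "mfps E ?a" and ?Eb = "mfps E ?b"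
  let ?Xa = "mfps ?X ?a" and ?Xb = "mfps ?X ?b" and ?\<tau>a = "mfps \<tau> ?a" and ?\<tau>b = "mfps \<tau> ?b"
  have s: "madm (\<lambda>v. if v then ?xb else ?xa)" using x0 by (intro madm_bool) auto
  have Tx': "mfps T (mfps x F) = mfps \<tau> F" if "mcoeff F {#} = 0" for F :: "(bool, 'a) mps"
    using that x0 by (simp add: Tx flip: mfps_compose)
  have ETx': "mfps (fexp_lin \<beta> oo T) (mfps x F) = mfps E F" if "mcoeff F {#} = 0" for F :: "(bool, 'a) mps"
  proof -
    have "(fexp_lin \<beta> oo T) oo x = E"
      unfolding E_def using x0 T0 by (simp add: Tx flip: fps_compose_assoc)
    then show ?thesis using that x0 by (simp flip: mfps_compose)
  qed
  have identity: "(?\<tau>b - ?\<tau>a) * mexp ?B = ?\<tau>b * ?Ea - ?\<tau>a * ?Eb"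
    using arg_cong [OF tree_exp_identity [OF c], of "msubst (\<lambda>v. if v then ?xb else ?xa)"]
    by (simp add: msubst_mult msubst_diff msubst_mfps msubst_mexp msubst_bil s x0 mcoeff_bil_empty Tx' ETx')
  \<comment> \<open>The identity 1/u1 - 1/u2 = 1/tau1 - 1/tau2 with denominators cleared; it comes
    from 1/tau = 1/u + beta.\<close>
  have ba: "?b - ?a = (?\<tau>b - ?\<tau>a) * (?Da * ?Db)"
  proof -
    have \<tau>D: "mfps \<tau> (mvar v) * mfps D (mvar v) = (mvar v :: (bool, 'a) mps)" for v
      using \<tau> by (simp add: D_def flip: mfps_mult)
    have "(?\<tau>b - ?\<tau>a) * (?Da * ?Db) = (?\<tau>b * ?Db) * ?Da - (?\<tau>a * ?Da) * ?Db"
      by (simp add: algebra_simps)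
    also have "\<dots> = ?b * ?Da - ?a * ?Db" by (simp only: \<tau>D)
    also have "\<dots> = ?b - ?a"
      by (simp add: D_def mfps_add mfps_mult algebra_simps)
    finally show ?thesis ..
  qed
  have \<tau>xE: "mfps \<tau> (mvar v) = mfps x (mvar v) * (mfps E (mvar v) :: (bool, 'a) mps)" for v
    by (simp add: xE flip: mfps_mult)
  have one: "mfps ?X (mvar v) * mfps E (mvar v) * mfps D (mvar v) = (1 :: (bool, 'a) mps)" for v
    using XED by (simp only: mfps_mult [OF mcoeff_mvar_empty, symmetric] mfps_1)
  have "mexp ?B * (?Xa * ?Xb) = mdd x ?b ?a"
  proof (rule diff_mvar_cancel)
    have "(?b - ?a) * (mexp ?B * (?Xa * ?Xb)) = ((?\<tau>b - ?\<tau>a) * mexp ?B) * (?Da * ?Db * (?Xa * ?Xb))"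
      unfolding ba by (simp only: ac_simps)
    also have "\<dots> = (?xb - ?xa) * (?Ea * ?Eb) * (?Da * ?Db * (?Xa * ?Xb))"
      unfolding identity unfolding \<tau>xE by (simp add: algebra_simps)
    also have "\<dots> = (?xb - ?xa) * ((?Xa * ?Ea * ?Da) * (?Xb * ?Eb * ?Db))"
      by (simp only: ac_simps)
    also have "\<dots> = ?xb - ?xa" by (simp only: one mult_1_right)
    also have "\<dots> = (?b - ?a) * mdd x ?b ?a" by (simp add: diff_mult_mdd)
    finally show "(?b - ?a) * (mexp ?B * (?Xa * ?Xb)) = (?b - ?a) * mdd x ?b ?a" .
  qed
  then show "compatible x c"
    unfolding compatible_def x1 by simp
qed

text \<open>The coefficients lie in \<open>complex fps\<close>, which is not a field, so
  invertibility of g is drawn from its constant term being exactly 1.\<close>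

lemma fps_divide_unit_mult:
  fixes f g :: "complex fps fps"
  assumes "fps_nth g 0 = 1"
  shows "f / g = f * inverse g" "inverse g * g = 1"
proof -
  have inv: "inverse (1 :: complex fps) = 1"
    by (rule fps_ext) (simp add: fps_inverse_one')
  have "subdegree g = 0" "g \<noteq> 0" using assms by auto
  then show "f / g = f * inverse g" by (simp add: fps_divide_def Let_def)
  have "g * fps_right_inverse g (inverse (fps_nth g 0)) = 1"
    by (rule fps_right_inverse) (simp add: assms inv)
  then show "inverse g * g = 1"
    using assms by (simp add: fps_inverse_def mult.commute)
qed

definition hodge_coeff :: "nat \<Rightarrow> nat \<Rightarrow> complex fps" where
  "hodge_coeff i j = - (1 / 2 * (of_nat (Suc i ^ Suc i * Suc j ^ Suc j)
     / of_nat ((Suc i + Suc j) * fact (Suc i) * fact (Suc j)) * hodge_beta ^ (Suc i + Suc j)))"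

lemma hodge_H02_eq: "- hodge_H02 = mbil hodge_coeff mvar mvar"
proof -
  let ?q = "\<lambda>i j. of_nat (Suc i ^ Suc i * Suc j ^ Suc j)
     / of_nat ((Suc i + Suc j) * fact (Suc i) * fact (Suc j)) * hodge_beta ^ (Suc i + Suc j)"
  have mvar: "msummable (mvar :: nat \<Rightarrow> (nat, complex fps) mps)" by (intro madm_summable madm_mvar)
  have "hodge_H02 = mconst (1 / 2) * msum (\<lambda>(i, j). mconst (?q i j) * mvar i * mvar j)"
    unfolding hodge_H02_def Let_def ..
  also have "\<dots> = msum (\<lambda>p. mconst (1 / 2) * (case p of (i, j) \<Rightarrow> mconst (?q i j) * mvar i * mvar j))"
    by (rule msum_mult_left [OF msummable_mbil [OF mvar mvar]])
  finally have "- hodge_H02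
      = msum (\<lambda>p. - (mconst (1 / 2) * (case p of (i, j) \<Rightarrow> mconst (?q i j) * mvar i * mvar j)))"
    by (simp only: msum_uminus)
  also have "\<dots> = mbil hodge_coeff mvar mvar"
    unfolding mbil_def hodge_coeff_def
    by (rule msum_cong) (simp only: case_prod_unfold mconst_uminus mconst_mult mult_minus_left mult.assoc)
  finally show ?thesis .
qed

lemma compatible_hodge: "fps_nth hodge_x 0 = 0" "fps_nth hodge_x 1 = 1" "compatible hodge_x hodge_coeff"
proof -
  let ?w = "fps_X * fexp_lin (- hodge_beta)"
  have w0: "fps_nth ?w 0 = 0" and w1: "1 * fps_nth ?w 1 = 1"
    by (simp_all add: fexp_lin_nth_0)
  obtain T where T: "fps_nth T 0 = 0" "T oo ?w = fps_X" "?w oo T = fps_X"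
    using fps_compose_inverse [OF w0 w1] by blast
  interpret tree_function hodge_beta T
    by standard (use T in simp_all)
  let ?D = "1 + fps_const hodge_beta * fps_X"
  let ?\<tau> = "fps_X / ?D"
  have D: "fps_nth ?D 0 = 1" by simp
  have \<tau>: "?\<tau> * ?D = fps_X"
    unfolding fps_divide_unit_mult(1) [OF D] mult.assoc fps_divide_unit_mult(2) [OF D] by simp
  have \<tau>0: "fps_nth ?\<tau> 0 = 0" using arg_cong [OF \<tau>, of "\<lambda>f. fps_nth f 0"] by simp
  have x: "hodge_x = ?\<tau> * (fexp_lin (- hodge_beta) oo ?\<tau>)"
  proof -
    have "fps_exp 1 = (fexp :: complex fps fps)"
      by (rule fps_ext) (simp add: fexp_nth)
    moreover have "- (fps_const hodge_beta * fps_X / ?D) = (fps_const (- hodge_beta) * fps_X) oo ?\<tau>"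
      using \<tau>0 unfolding fps_divide_unit_mult(1) [OF D]
      by (simp add: fps_compose_mult_distrib fps_compose_uminus mult.assoc flip: fps_const_neg)
    moreover have "fexp oo ((fps_const (- hodge_beta) * fps_X) oo ?\<tau>) = fexp_lin (- hodge_beta) oo ?\<tau>"
      using fps_compose_assoc [OF \<tau>0, of "fps_const (- hodge_beta) * fps_X" fexp]
      by (simp add: fexp_lin_eq_compose del: fps_const_neg)
    ultimately show ?thesis unfolding hodge_x_def by simp
  qed
  \<comment> \<open>Symmetrization absorbs the 1/2, and multiplying by the two factorials reduces
    the rest to divisions by positive integers.\<close>
  have c: "of_nat (Suc i + Suc j) * (hodge_coeff i j + hodge_coeff j i)
      = - (weight (Suc i) * weight (Suc j) * hodge_beta ^ (Suc i + Suc j))" for i j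
  proof -
    define N where "N = Suc i ^ Suc i * Suc j ^ Suc j"
    define F where "F = (fact (Suc i) * fact (Suc j) :: nat)"
    define q :: "complex fps" where "q = of_nat N / of_nat ((Suc i + Suc j) * F)"
    have F: "F > 0" by (simp add: F_def)
    have "hodge_coeff j i = hodge_coeff i j"
      unfolding hodge_coeff_def by (simp only: ac_simps)
    moreover have "1 / 2 * (2 :: complex fps) = 1"
      using divide_of_nat [of 2 "1 :: complex fps"] by simp
    moreover have "hodge_coeff i j = - (1 / 2 * (q * hodge_beta ^ (Suc i + Suc j)))"
      unfolding hodge_coeff_def q_def N_def F_def by (simp only: mult.assoc)
    moreover have "- (1 / 2 * z) + - (1 / 2 * z) = - ((1 / 2 * 2) * z)" for z :: "complex fps"
      by (simp only: mult_2_right distrib_right minus_add_distrib)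
    ultimately have "hodge_coeff i j + hodge_coeff j i = - (q * hodge_beta ^ (Suc i + Suc j))"
      by (simp only: mult_1_left)
    moreover have "of_nat (Suc i + Suc j) * q = weight (Suc i) * weight (Suc j)"
    proof (rule rat_cancel [OF F])
      have "of_nat F * (of_nat (Suc i + Suc j) * q) = q * of_nat ((Suc i + Suc j) * F)"
        by (simp only: of_nat_mult ac_simps)
      also have "\<dots> = of_nat N"
        unfolding q_def by (rule divide_of_nat) (simp add: F_def)
      also have "\<dots> = of_nat N * ((of_nat (fact (Suc i)) * (1 / of_nat (fact (Suc i))))
          * (of_nat (fact (Suc j)) * (1 / of_nat (fact (Suc j)))))"
        by (simp only: rat_inverse [OF fact_gt_zero] mult_1_right)
      also have "\<dots> = of_nat F * (weight (Suc i) * weight (Suc j))"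
        unfolding N_def F_def weight_def of_nat_mult by (simp only: ac_simps)
      finally show "of_nat F * (of_nat (Suc i + Suc j) * q) = of_nat F * (weight (Suc i) * weight (Suc j))" .
    qed
    ultimately show ?thesis
      by (simp only: mult_minus_right mult.assoc [symmetric])
  qed
  show "fps_nth hodge_x 0 = 0" "fps_nth hodge_x 1 = 1" "compatible hodge_x hodge_coeff"
    unfolding x using compatible_tree [OF \<tau> c] by blast+
qed

theorem theorem2p5:
  shows "(\<forall>x :: complex fps. fps_nth x 0 = 0 \<and> fps_nth x 1 \<noteq> 0 \<longrightarrow>
            (\<exists>Q. quadratic Q \<and> KP_automorphism (KP_transform x Q)))
         \<and> (quadratic (- hodge_H02) \<and> KP_automorphism (KP_transform hodge_x (- hodge_H02)))"
proof -
  have quadratic: "quadratic (mbil c mvar mvar)" for c :: "nat \<Rightarrow> nat \<Rightarrow> 'a :: comm_ring_1"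
    unfolding quadratic_def mbil_def by blast
  have "\<exists>Q. quadratic Q \<and> KP_automorphism (KP_transform x Q)"
    if x: "fps_nth x 0 = 0" "fps_nth x 1 \<noteq> 0" for x :: "complex fps"
  proof -
    have d: "inverse (fps_nth x 1) * fps_nth x 1 = 1" using x(2) by simp
    obtain c where "compatible x c" using compatible_exists [OF x(1) d] by blast
    then show ?thesis
      using KP_automorphism_compatible [OF x(1) d] quadratic by blast
  qed
  \<comment> \<open>The leading coefficient of \<open>hodge_x\<close> is 1, so 1 also serves as its
    inverse.\<close>
  moreover have "KP_automorphism (KP_transform hodge_x (- hodge_H02))"
    unfolding hodge_H02_eq using compatible_hodge
    by (intro KP_automorphism_compatible [of _ 1]) simp_all
  ultimately show ?thesis
    using quadratic [of hodge_coeff] by (simp add: hodge_H02_eq)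
qed

end
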